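(* Let $n\ge0$. Every $K$-equivariant $\mathrm{End}(V_n)$-valued Schwartz function $F$ on $\mathbb C^2$ can be expressed in a unique way as a sum $$F=\sum_{j=0}^n\mathbf D_n^j f_j ,$$ where the $f_j$ are $K$-invariant scalar-valued Schwartz functions on $\mathbb C^2$.
   Context: $K=U_2$. For an integer $n\ge0$, $V_n$ is the space of holomorphic homogeneous polynomials of degree $n$ on $\mathbb C^2$, with the representation $[\tau_n(k)p](z)=p(k^{-1}z)$ of $SU_2$ and derived representation $d\tau_n$ of its Lie algebra $\mathfrak{su}_2$. A function $F:\mathbb C^2\to\mathrm{End}(V_n)$ is $K$-equivariant if $F(e^{i\theta}kz)=\tau_n(k)F(z)\tau_n(k)^{-1}$ for all $\theta\in\mathbb R$, $k\in SU_2$, $z\in\mathbb C^2$; a scalar function $f$ is $K$-invariant if $f(kz)=f(z)$ for all $k\in U_2$. Let $X_1=\begin{bmatrix} i&0\\0&-i\end{bmatrix}$, $X_2=\begin{bmatrix}0&1\\-1&0\end{bmatrix}$, $X_3=\begin{bmatrix}0&i\\i&0\end{bmatrix}$ and $\Delta_{z_j}=-4\partial_{z_j}\partial_{\bar z_j}$. The operator $\mathbf D_n$ acts on $\mathrm{End}(V_n)$-valued functions on $\mathbb C^2$ by $$\mathbf D_n=i(\Delta_{z_2}-\Delta_{z_1})\otimes d\tau_n(X_1)-4(\partial_{\bar z_1}\partial_{z_2}-\partial_{z_1}\partial_{\bar z_2})\otimes d\tau_n(X_2)+4i(\partial_{z_1}\partial_{\bar z_2}+\partial_{\bar z_1}\partial_{z_2})\otimes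 d\tau_n(X_3),$$ where $d\tau_n(X_i)$ acts by left multiplication on $\mathrm{End}(V_n)$. For a scalar function $f$, $\mathbf D_n^jf$ means $\mathbf D_n^j(fI)$. *)

theory Defs
  imports "HOL-Analysis.Analysis"
begin

section \<open>Schwartz functions\<close>

definition partial_deriv ::
    "'a::euclidean_space \<Rightarrow> ('a \<Rightarrow> complex) \<Rightarrow> 'a \<Rightarrow> complex" where
  "partial_deriv v f = (\<lambda>z. frechet_derivative f (at z) v)"

definition iterated_partial ::
    "'a::euclidean_space list \<Rightarrow> ('a \<Rightarrow> complex) \<Rightarrow> 'a \<Rightarrow> complex" where
  "iterated_partial vs f = foldr partial_deriv vs f"

text \<open>Lists of basis vectors play the role of multi-indices. That every iterated partial
  derivative is differentiable everywhere expresses that the function is smooth.\<close>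

definition schwartz :: "('a::euclidean_space \<Rightarrow> complex) \<Rightarrow> bool" where
  "schwartz f \<longleftrightarrow>
     (\<forall>vs\<in>lists Basis.
        iterated_partial vs f differentiable_on UNIV \<and>
        (\<forall>m::nat. bounded (range (\<lambda>z. norm z ^ m *\<^sub>R iterated_partial vs f z))))"


section \<open>Unitary groups and the Lie algebra basis\<close>

definition conj_transpose :: "complex^2^2 \<Rightarrow> complex^2^2" where
  "conj_transpose A = (\<chi> i j. cnj (A $ j $ i))"

definition U2 :: "(complex^2^2) set" where
  "U2 = {A. conj_transpose A ** A = mat 1 \<and> A ** conj_transpose A = mat 1}"

definition SU2 :: "(complex^2^2) set" where
  "SU2 = {A \<in> U2. det A = 1}"

definition mexp :: "complex^2^2 \<Rightarrow> complex^2^2" where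
  "mexp A = (\<Sum>m. (1 / fact m) *\<^sub>R (((**) A ^^ m) (mat 1)))"

definition X1 :: "complex^2^2" where
  "X1 = vector [vector [\<i>, 0], vector [0, - \<i>]]"

definition X2 :: "complex^2^2" where
  "X2 = vector [vector [0, 1], vector [- 1, 0]]"

definition X3 :: "complex^2^2" where
  "X3 = vector [vector [0, \<i>], vector [\<i>, 0]]"


section \<open>The representation on homogeneous polynomials\<close>

definition V :: "nat \<Rightarrow> (complex^2 \<Rightarrow> complex) set" where
  "V n = {p. \<exists>c::nat \<Rightarrow> complex. p = (\<lambda>z. \<Sum>k\<le>n. c k * (z $ 1) ^ k * (z $ 2) ^ (n - k))}"

text \<open>An endomorphism of \<open>V n\<close> is represented by a map on all functions of which only the
  restriction to \<open>V n\<close> is relevant; accordingly, endomorphisms are compared on \<open>V n\<close> only.\<close>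

type_synonym operator = "(complex^2 \<Rightarrow> complex) \<Rightarrow> (complex^2 \<Rightarrow> complex)"

definition End_V :: "nat \<Rightarrow> operator set" where
  "End_V n = {T. (\<forall>p\<in>V n. T p \<in> V n) \<and>
     (\<forall>p\<in>V n. \<forall>q\<in>V n. \<forall>a b. T (\<lambda>w. a * p w + b * q w) = (\<lambda>w. a * T p w + b * T q w))}"

text \<open>The representation \<open>\<tau>\<^sub>n\<close> and its derivative \<open>d\<tau>\<^sub>n\<close> are given by formulas that do not
  involve \<open>n\<close>; they are the operators below, acting on \<open>V n\<close>.\<close>

definition tau :: "complex^2^2 \<Rightarrow> operator" where
  "tau k p = (\<lambda>z. p (matrix_inv k *v z))"

definition dtau :: "complex^2^2 \<Rightarrow> operator" where
  "dtau X p = (\<lambda>z. vector_derivative (\<lambda>t::real. tau (mexp (t *\<^sub>R X)) p z) (at 0))"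


section \<open>Invariant and equivariant functions\<close>

definition K_invariant :: "(complex^2 \<Rightarrow> complex) \<Rightarrow> bool" where
  "K_invariant f \<longleftrightarrow> (\<forall>k\<in>U2. \<forall>z. f (k *v z) = f z)"

definition K_equivariant :: "nat \<Rightarrow> (complex^2 \<Rightarrow> operator) \<Rightarrow> bool" where
  "K_equivariant n F \<longleftrightarrow>
     (\<forall>\<theta>::real. \<forall>k\<in>SU2. \<forall>z. \<forall>p\<in>V n.
        F (exp (\<i> * complex_of_real \<theta>) *s (k *v z)) p = tau k (F z (inv_into (V n) (tau k) p)))"

text \<open>The functionals \<open>T \<mapsto> T p w\<close>, for \<open>p\<close> in \<open>V n\<close> and \<open>w\<close> a point, span the dual of the
  finite-dimensional space \<open>End (V n)\<close>. Hence regularity and decay of an \<open>End (V n)\<close>-valued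
  function, as well as its derivatives, may be described through them.\<close>

definition schwartz_End :: "nat \<Rightarrow> (complex^2 \<Rightarrow> operator) \<Rightarrow> bool" where
  "schwartz_End n F \<longleftrightarrow>
     (\<forall>z. F z \<in> End_V n) \<and> (\<forall>p\<in>V n. \<forall>w. schwartz (\<lambda>z. F z p w))"


section \<open>The differential operator\<close>

text \<open>Here \<open>axis j 1\<close> and \<open>axis j \<i>\<close> are the directions of the real coordinates \<open>x\<^sub>j\<close> and
  \<open>y\<^sub>j\<close>, where \<open>z\<^sub>j = x\<^sub>j + \<i> y\<^sub>j\<close>.\<close>

definition d_z :: "2 \<Rightarrow> (complex^2 \<Rightarrow> complex) \<Rightarrow> complex^2 \<Rightarrow> complex" where
  "d_z j f = (\<lambda>z. (partial_deriv (axis j 1) f z - \<i> * partial_deriv (axis j \<i>) f z) / 2)"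

definition d_zbar :: "2 \<Rightarrow> (complex^2 \<Rightarrow> complex) \<Rightarrow> complex^2 \<Rightarrow> complex" where
  "d_zbar j f = (\<lambda>z. (partial_deriv (axis j 1) f z + \<i> * partial_deriv (axis j \<i>) f z) / 2)"

definition Lap :: "2 \<Rightarrow> (complex^2 \<Rightarrow> complex) \<Rightarrow> complex^2 \<Rightarrow> complex" where
  "Lap j f = (\<lambda>z. - 4 * d_z j (d_zbar j f) z)"

text \<open>\<open>tensor_op A T\<close> is \<open>A \<otimes> T\<close>: the scalar differential operator \<open>A\<close> acts in the variable
  \<open>z\<close> and the result is multiplied by \<open>T\<close> from the left.\<close>

definition tensor_op ::
    "((complex^2 \<Rightarrow> complex) \<Rightarrow> (complex^2 \<Rightarrow> complex)) \<Rightarrow> operator \<Rightarrow>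
     (complex^2 \<Rightarrow> operator) \<Rightarrow> (complex^2 \<Rightarrow> operator)" where
  "tensor_op A T F = (\<lambda>z p. T (\<lambda>w. A (\<lambda>u. F u p w) z))"

definition D_op :: "(complex^2 \<Rightarrow> operator) \<Rightarrow> (complex^2 \<Rightarrow> operator)" where
  "D_op F = (\<lambda>z p w.
     tensor_op (\<lambda>f u. \<i> * (Lap 2 f u - Lap 1 f u)) (dtau X1) F z p w
     + tensor_op (\<lambda>f u. - 4 * (d_zbar 1 (d_z 2 f) u - d_z 1 (d_zbar 2 f) u)) (dtau X2) F z p w
     + tensor_op (\<lambda>f u. 4 * \<i> * (d_z 1 (d_zbar 2 f) u + d_zbar 1 (d_z 2 f) u)) (dtau X3) F z p w)"

definition scalar_op :: "(complex^2 \<Rightarrow> complex) \<Rightarrow> (complex^2 \<Rightarrow> operator)" where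
  "scalar_op f = (\<lambda>z p w. f z * p w)"

end

theory Submission
  imports Defs "HOL-Probability.Characteristic_Functions" "HOL-Probability.Sinc_Integral"
begin

text \<open>The Fourier transform turns \<open>D_op\<close> into multiplication by a matrix \<open>A(z)\<close>, namely
  \<open>n |z|\<^sup>2 - 2 \<langle>w, z\<rangle> z \<cdot> \<partial>\<^sub>w\<close> on polynomials in \<open>w\<close>. The transform \<open>F'\<close> of an equivariant \<open>F\<close> is
  determined by its values at the points \<open>(r, 0)\<close>, where it commutes with the torus and hence is
  diagonal in the monomial basis; \<open>A(r, 0)\<close> is diagonal with distinct eigenvalues, so
  \<open>F'(z) = \<Sum>j\<le>n. \<gamma>\<^sub>j(|z|\<^sup>2) A(z)\<^sup>j\<close> for \<open>z \<noteq> 0\<close> by interpolation and equivariance.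

  The point is that the \<open>\<gamma>\<^sub>j\<close> are smooth up to \<open>0\<close>. The coefficient of \<open>w\<^sub>1\<^sup>m w\<^sub>2\<^sup>n\<^sup>-\<^sup>m\<close> in
  \<open>A(z)\<^sup>j w\<^sub>2\<^sup>n\<close> vanishes for \<open>j < m\<close> and is a nonzero multiple of \<open>(cnj z\<^sub>1 z\<^sub>2)\<^sup>m\<close> for \<open>j = m\<close>.
  By downward induction on \<open>m\<close>, \<open>(cnj z\<^sub>1 z\<^sub>2)\<^sup>m \<gamma>\<^sub>m(|z|\<^sup>2)\<close> is therefore a Schwartz function. It has
  weight \<open>-2m\<close> under the torus, so its derivatives of order \<open>< 2m\<close> and of odd order vanish at the
  origin. On the line spanned by \<open>(1, 1)\<close> one can thus divide by \<open>x\<^sup>2\<^sup>m\<close> and take the square root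
  of the variable. The same triangular structure gives uniqueness.\<close>

subsection \<open>Schwartz functions\<close>

text \<open>The coefficients that interpolation produces say nothing near the origin: the nodes r^2
  (n - 2 a) all collapse as r tends to 0, and the \<open>\<gamma>\<close> are chosen separately for
  each radius, so not even continuity is known. Regularity has to come from a formula that does not
  divide by differences of eigenvalues. Applying everything to the single vector w_2^n provides one:
  \<open>symb n z\<close> moves the monomial index by at most one, so the coefficients of its
  successive powers form a triangular system with explicit monomials on the diagonal. One column of
  the transform thus determines every \<open>\<gamma>\<close>, and the only division left is by a
  power of cnj z_1 z_2.

  That division is carried out on functions of one variable. They are kept together with all their
  derivatives (\<open>tower\<close>), so that smoothness at the endpoint 0, the value of |z|^2 at
  the origin, is a matter of one-sided derivatives.

  At the origin itself \<open>symb n 0\<close> vanishes, so the algebra carries no information on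
  the higher coefficients there; identities are derived for nonzero z and completed by
  continuity.\<close>

definition rapid_decay :: "('a::euclidean_space \<Rightarrow> complex) \<Rightarrow> bool" where
  "rapid_decay f \<longleftrightarrow> (\<forall>m::nat. bounded (range (\<lambda>z. norm z ^ m *\<^sub>R f z)))"

text \<open>Counting derivatives turns closure properties into inductions on the order with the
  function left arbitrary. The Leibniz rule then needs no bookkeeping over lists of
  directions.\<close>

primrec schwartz_upto :: "nat \<Rightarrow> ('a::euclidean_space \<Rightarrow> complex) \<Rightarrow> bool" where
  "schwartz_upto 0 f \<longleftrightarrow> rapid_decay f"
| "schwartz_upto (Suc k) f \<longleftrightarrow> f differentiable_on UNIV \<and> rapid_decay f \<and>
     (\<forall>b\<in>Basis. schwartz_upto k (partial_deriv b f))"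

lemma rapid_decayI:
  assumes "\<And>m::nat. \<exists>C. \<forall>z. norm z ^ m * norm (f z) \<le> C"
  shows "rapid_decay f"
  using assms unfolding rapid_decay_def bounded_iff by simp

lemma rapid_decayD:
  assumes "rapid_decay f"
  obtains C where "C \<ge> 0" "\<And>z. norm z ^ m * norm (f z) \<le> C"
proof -
  from assms obtain C where C: "\<And>z. norm (norm z ^ m *\<^sub>R f z) \<le> C"
    unfolding rapid_decay_def bounded_iff by blast
  show thesis
  proof
    show "\<bar>C\<bar> \<ge> 0" by simp
    show "norm z ^ m * norm (f z) \<le> \<bar>C\<bar>" for z
      using C[of z] by (auto intro: order_trans)
  qed
qed

lemma rapid_decay_bounded:
  assumes "rapid_decay f"
  obtains C where "C \<ge> 0" "\<And>z. norm (f z) \<le> C"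
  using rapid_decayD[OF assms, of 0] by auto

lemma rapid_decay_mono:
  assumes "rapid_decay f" "\<And>z. norm (g z) \<le> B * norm (f z)" "B \<ge> 0"
  shows "rapid_decay g"
proof (rule rapid_decayI)
  fix m
  obtain C where C: "\<And>z. norm z ^ m * norm (f z) \<le> C" using rapid_decayD[OF assms(1)] by blast
  have "norm z ^ m * norm (g z) \<le> B * C" for z
  proof -
    have "norm z ^ m * norm (g z) \<le> norm z ^ m * (B * norm (f z))"
      by (intro mult_left_mono assms) auto
    also have "\<dots> = B * (norm z ^ m * norm (f z))" by simp
    also have "\<dots> \<le> B * C" by (intro mult_left_mono C assms)
    finally show ?thesis .
  qed
  then show "\<exists>C. \<forall>z. norm z ^ m * norm (g z) \<le> C" by blast
qed

lemma rapid_decay_add: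
  assumes "rapid_decay f" "rapid_decay g"
  shows "rapid_decay (\<lambda>z. f z + g z)"
proof (rule rapid_decayI)
  fix m
  obtain C where C: "\<And>z. norm z ^ m * norm (f z) \<le> C" using rapid_decayD[OF assms(1)] by blast
  obtain D where D: "\<And>z. norm z ^ m * norm (g z) \<le> D" using rapid_decayD[OF assms(2)] by blast
  have "norm z ^ m * norm (f z + g z) \<le> C + D" for z
  proof -
    have "norm z ^ m * norm (f z + g z) \<le> norm z ^ m * (norm (f z) + norm (g z))"
      by (intro mult_left_mono norm_triangle_ineq) auto
    then show ?thesis using C[of z] D[of z] by (simp add: algebra_simps)
  qed
  then show "\<exists>C. \<forall>z. norm z ^ m * norm (f z + g z) \<le> C" by blast
qed

lemma rapid_decay_mult:
  assumes "rapid_decay f" "rapid_decay g"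
  shows "rapid_decay (\<lambda>z. f z * g z)"
proof -
  obtain C where C: "C \<ge> 0" "\<And>z. norm (f z) \<le> C" using rapid_decay_bounded[OF assms(1)] by blast
  show ?thesis
    by (rule rapid_decay_mono[OF assms(2), of _ C])
      (auto simp: norm_mult intro!: mult_right_mono C)
qed

lemma rapid_decay_norm_mult:
  assumes "rapid_decay f" "\<And>z. norm (g z) \<le> norm z * norm (f z)"
  shows "rapid_decay g"
proof (rule rapid_decayI)
  fix m
  obtain C where C: "\<And>z. norm z ^ Suc m * norm (f z) \<le> C" using rapid_decayD[OF assms(1)] by blast
  have "norm z ^ m * norm (g z) \<le> C" for z
  proof -
    have "norm z ^ m * norm (g z) \<le> norm z ^ m * (norm z * norm (f z))"
      by (intro mult_left_mono assms) auto
    then show ?thesis using C[of z] by (simp add: algebra_simps)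
  qed
  then show "\<exists>C. \<forall>z. norm z ^ m * norm (g z) \<le> C" by blast
qed

lemma schwartz_differentiable:
  assumes "schwartz f" shows "f differentiable (at z)"
proof -
  have "iterated_partial [] f differentiable_on UNIV"
    using assms unfolding schwartz_def by (metis lists.Nil)
  then show ?thesis by (simp add: iterated_partial_def differentiable_on_def)
qed

lemma schwartz_rapid_decay:
  assumes "schwartz f" shows "rapid_decay f"
proof -
  have "\<forall>m::nat. bounded (range (\<lambda>z. norm z ^ m *\<^sub>R iterated_partial [] f z))"
    using assms unfolding schwartz_def by (metis lists.Nil)
  then show ?thesis by (simp add: iterated_partial_def rapid_decay_def)
qed

lemma schwartz_partial_Basis:
  assumes "schwartz f" "b \<in> Basis" shows "schwartz (partial_deriv b f)"
proof -
  have *: "iterated_partial vs (partial_deriv b f) = iterated_partial (vs @ [b]) f" for vs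
    by (simp add: iterated_partial_def)
  show ?thesis unfolding schwartz_def *
    using assms unfolding schwartz_def by (metis append_in_lists_conv lists.Cons lists.Nil)
qed

lemma schwartz_iff_upto: "schwartz f \<longleftrightarrow> (\<forall>k. schwartz_upto k f)"
proof
  assume f: "schwartz f"
  have "\<forall>f. schwartz f \<longrightarrow> schwartz_upto k f" for k :: nat
  proof (induction k)
    case 0 then show ?case by (simp add: schwartz_rapid_decay)
  next
    case (Suc k)
    then show ?case
      by (auto simp: schwartz_rapid_decay differentiable_on_def differentiable_at_withinI
          schwartz_differentiable schwartz_partial_Basis)
  qed
  with f show "\<forall>k. schwartz_upto k f" by blast
next
  assume f: "\<forall>k. schwartz_upto k f"
  have "\<forall>f. (\<forall>k. schwartz_upto k f) \<longrightarrow> iterated_partial vs f differentiable_on UNIV \<and>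
      rapid_decay (iterated_partial vs f)" if "vs \<in> lists Basis" for vs :: "'a list"
    using that
  \<comment> \<open>\<open>foldr\<close> applies the last list entry first, so removing an entry at
    the end replaces \<open>f\<close> by \<open>partial_deriv b f\<close>.\<close>
  proof (induction vs rule: rev_induct)
    case Nil
    then show ?case
      by (metis foldr.simps(1) id_apply iterated_partial_def schwartz_upto.simps)
  next
    case (snoc b vs)
    have *: "iterated_partial (vs @ [b]) f = iterated_partial vs (partial_deriv b f)" for f
      by (simp add: iterated_partial_def)
    have "\<forall>k. schwartz_upto k (partial_deriv b f)" if "\<forall>k. schwartz_upto k f" for f
      using that snoc.prems by (metis append_in_lists_conv listsE schwartz_upto.simps(2))
    then show ?case using snoc unfolding * by auto
  qed
  with f show "schwartz f" unfolding schwartz_def rapid_decay_def by blast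
qed

lemma schwartz_upto_mono: "schwartz_upto (Suc k) f \<Longrightarrow> schwartz_upto k f"
proof (induction k arbitrary: f)
  case (Suc k)
  then show ?case by (metis schwartz_upto.simps(2))
qed simp

lemma partial_deriv_eqI:
  assumes "(f has_derivative f') (at z)" shows "partial_deriv v f z = f' v"
  using assms unfolding partial_deriv_def by (simp add: frechet_derivative_at[symmetric])

lemma partial_deriv_add:
  assumes "f differentiable (at z)" "g differentiable (at z)"
  shows "partial_deriv v (\<lambda>z. f z + g z) z = partial_deriv v f z + partial_deriv v g z"
  using partial_deriv_eqI[OF has_derivative_add[OF assms[unfolded frechet_derivative_works]], of v]
  by (simp add: partial_deriv_def)

lemma partial_deriv_mult:
  assumes "f differentiable (at z)" "g differentiable (at z)"
  shows "partial_deriv v (\<lambda>z. f z * g z) z = partial_deriv v f z * g z + f z * partial_deriv v g z"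
  using partial_deriv_eqI[OF has_derivative_mult[OF assms[unfolded frechet_derivative_works]], of v]
  by (simp add: partial_deriv_def)

lemma partial_deriv_cmult:
  assumes "f differentiable (at z)"
  shows "partial_deriv v (\<lambda>z. c * f z) z = c * partial_deriv v f z"
  using partial_deriv_mult[of "\<lambda>_. c" z f v] assms partial_deriv_eqI[OF has_derivative_const]
  by auto

lemma partial_deriv_inner:
  "partial_deriv v (\<lambda>z. complex_of_real (z \<bullet> b)) z = complex_of_real (v \<bullet> b)"
  by (rule partial_deriv_eqI) (auto intro!: derivative_eq_intros)

lemma differentiable_on_UNIV_D: "f differentiable_on UNIV \<Longrightarrow> f differentiable (at z)"
  by (simp add: differentiable_on_def)

lemma schwartz_upto_add:
  "schwartz_upto k f \<Longrightarrow> schwartz_upto k g \<Longrightarrow> schwartz_upto k (\<lambda>z. f z + g z)"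
proof (induction k arbitrary: f g)
  case (Suc k)
  have "partial_deriv b (\<lambda>z. f z + g z) = (\<lambda>z. partial_deriv b f z + partial_deriv b g z)" for b
    using Suc.prems by (auto simp: partial_deriv_add differentiable_on_UNIV_D)
  with Suc show ?case by (auto simp: rapid_decay_add)
qed (simp add: rapid_decay_add)

lemma schwartz_upto_mult:
  "schwartz_upto k f \<Longrightarrow> schwartz_upto k g \<Longrightarrow> schwartz_upto k (\<lambda>z. f z * g z)"
proof (induction k arbitrary: f g)
  case (Suc k)
  have "partial_deriv b (\<lambda>z. f z * g z) = (\<lambda>z. partial_deriv b f z * g z + f z * partial_deriv b g z)" for b
    using Suc.prems by (auto simp: partial_deriv_mult differentiable_on_UNIV_D)
  moreover have "schwartz_upto k f" "schwartz_upto k g" using Suc.prems schwartz_upto_mono by blast+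
  ultimately show ?case using Suc 
    by (auto simp: rapid_decay_mult intro!: schwartz_upto_add differentiable_on_mult)
qed (simp add: rapid_decay_mult)

lemma schwartz_upto_cmult:
  "schwartz_upto k f \<Longrightarrow> schwartz_upto k (\<lambda>z. c * f z)"
proof (induction k arbitrary: f)
  case 0
  then show ?case
    by (auto intro!: rapid_decay_mono[of f _ "norm c"] simp: norm_mult)
next
  case (Suc k)
  have "partial_deriv b (\<lambda>z. c * f z) = (\<lambda>z. c * partial_deriv b f z)" for b
    using Suc.prems by (auto simp: partial_deriv_cmult differentiable_on_UNIV_D)
  with Suc show ?case
    by (auto intro!: rapid_decay_mono[of f _ "norm c"] simp: norm_mult)
qed

text \<open>A coordinate is not rapidly decreasing, so the product rule for
  \<open>schwartz_upto\<close> does not cover it. Its growth is at most \<open>norm z\<close>, which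
  costs one power in the decay of \<open>f\<close>; the extra Leibniz term is a constant multiple of
  \<open>f\<close>.\<close>

lemma schwartz_upto_coord:
  assumes "norm b \<le> 1"
  shows "schwartz_upto k f \<Longrightarrow> schwartz_upto k (\<lambda>z. complex_of_real (z \<bullet> b) * f z)"
proof (induction k arbitrary: f)
  case 0
  have "\<bar>z \<bullet> b\<bar> \<le> norm z" for z
    using Cauchy_Schwarz_ineq2[of z b] mult_left_mono[OF assms norm_ge_zero[of z]] by simp
  with 0 show ?case
    by (auto intro!: rapid_decay_norm_mult[of f] mult_right_mono simp: norm_mult)
next
  case (Suc k)
  have le: "\<bar>z \<bullet> b\<bar> \<le> norm z" for z
    using Cauchy_Schwarz_ineq2[of z b] mult_left_mono[OF assms norm_ge_zero[of z]] by simp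
  have d: "(\<lambda>z. complex_of_real (z \<bullet> b)) differentiable_on UNIV"
    by (auto simp: differentiable_on_def differentiable_def intro!: exI derivative_eq_intros)
  have *: "partial_deriv v (\<lambda>z. complex_of_real (z \<bullet> b) * f z) =
      (\<lambda>z. complex_of_real (v \<bullet> b) * f z + complex_of_real (z \<bullet> b) * partial_deriv v f z)" for v
    using Suc.prems d by (auto simp: partial_deriv_mult differentiable_on_UNIV_D partial_deriv_inner)
  have "schwartz_upto k f" using Suc.prems schwartz_upto_mono by blast
  then show ?case using Suc d le unfolding schwartz_upto.simps *
    by (auto intro!: rapid_decay_norm_mult[of f] mult_right_mono schwartz_upto_add
        schwartz_upto_cmult differentiable_on_mult simp: norm_mult)
qed

lemma schwartz_add: "schwartz f \<Longrightarrow> schwartz g \<Longrightarrow> schwartz (\<lambda>z. f z + g z)"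
  and schwartz_mult: "schwartz f \<Longrightarrow> schwartz g \<Longrightarrow> schwartz (\<lambda>z. f z * g z)"
  and schwartz_cmult: "schwartz f \<Longrightarrow> schwartz (\<lambda>z. c * f z)"
  and schwartz_coord: "norm b \<le> 1 \<Longrightarrow> schwartz f \<Longrightarrow> schwartz (\<lambda>z. complex_of_real (z \<bullet> b) * f z)"
  by (simp_all add: schwartz_iff_upto schwartz_upto_add schwartz_upto_mult schwartz_upto_cmult
      schwartz_upto_coord)

lemma schwartz_diff: "schwartz f \<Longrightarrow> schwartz g \<Longrightarrow> schwartz (\<lambda>z. f z - g z)"
  using schwartz_add[of f "\<lambda>z. -1 * g z"] schwartz_cmult[of g "-1"] by simp

lemma schwartz_upto_0: "schwartz_upto k (\<lambda>z. 0)"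
proof (induction k)
  case (Suc k)
  have "partial_deriv b (\<lambda>z. 0) = (\<lambda>z. 0)" for b :: 'a
    using partial_deriv_eqI[OF has_derivative_const] by blast
  with Suc show ?case by (auto simp: rapid_decay_def)
qed (auto simp: rapid_decay_def)

lemma schwartz_0: "schwartz (\<lambda>z. 0)"
  by (simp add: schwartz_iff_upto schwartz_upto_0)

lemma schwartz_sum: "(\<And>i. i \<in> I \<Longrightarrow> schwartz (f i)) \<Longrightarrow> schwartz (\<lambda>z. \<Sum>i\<in>I. f i z)"
  by (induction I rule: infinite_finite_induct) (auto simp: schwartz_0 schwartz_add)

lemma partial_deriv_Basis_sum:
  assumes "f differentiable (at z)"
  shows "partial_deriv v f z = (\<Sum>b\<in>Basis. complex_of_real (v \<bullet> b) * partial_deriv b f z)"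
proof -
  have l: "linear (frechet_derivative f (at z))" using assms by (rule linear_frechet_derivative)
  have "frechet_derivative f (at z) v = frechet_derivative f (at z) (\<Sum>b\<in>Basis. (v \<bullet> b) *\<^sub>R b)"
    by (simp add: euclidean_representation)
  also have "\<dots> = (\<Sum>b\<in>Basis. (v \<bullet> b) *\<^sub>R frechet_derivative f (at z) b)"
    using l by (simp add: linear_sum linear_scale)
  finally show ?thesis by (simp add: partial_deriv_def scaleR_conv_of_real)
qed

text \<open>The definition only speaks of basis directions; a direction such as
  \<open>diag_dir\<close> is reached through linearity of the derivative.\<close>

lemma schwartz_partial: assumes "schwartz f" shows "schwartz (partial_deriv v f)"
proof -
  have "partial_deriv v f = (\<lambda>z. \<Sum>b\<in>Basis. complex_of_real (v \<bullet> b) * partial_deriv b f z)"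
    using partial_deriv_Basis_sum[OF schwartz_differentiable[OF assms]] by blast
  then show ?thesis
    using assms by (auto intro!: schwartz_sum schwartz_cmult schwartz_partial_Basis)
qed

lemma schwartz_continuous_on: "schwartz f \<Longrightarrow> continuous_on A f"
  by (meson continuous_at_imp_continuous_on differentiable_imp_continuous_within schwartz_differentiable)

lemma schwartz_borel_measurable [measurable (raw)]: "schwartz f \<Longrightarrow> f \<in> borel_measurable borel"
  by (rule borel_measurable_continuous_onI) (rule schwartz_continuous_on)

subsection \<open>The Fourier transform\<close>

lemma nn_integral_inverse_1_plus_square:
  "(\<integral>\<^sup>+x. ennreal (inverse (1 + (x::real)\<^sup>2)) \<partial>lborel) < \<infinity>"
proof -
  have "integrable lborel (\<lambda>x::real. inverse (1 + x\<^sup>2))"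
    using integrable_inverse_1_plus_square by (simp add: set_integrable_def)
  then show ?thesis by (simp add: integrable_iff_bounded)
qed

text \<open>A majorant in product form: by Tonelli its integral factors into one-dimensional
  integrals of 1 / (1 + x^2).\<close>

definition weight :: "'a::euclidean_space \<Rightarrow> real" where
  "weight x = (\<Prod>b\<in>Basis. inverse (1 + (x \<bullet> b)\<^sup>2))"

lemma weight_measurable [measurable]: "weight \<in> borel_measurable borel"
  unfolding weight_def by measurable

lemma weight_nonneg: "weight x \<ge> 0"
  by (auto simp: weight_def intro!: prod_nonneg)

lemma integrable_weight: "integrable lborel (weight :: 'a::euclidean_space \<Rightarrow> real)"
proof (rule integrableI_bounded)
  have "(\<integral>\<^sup>+x. ennreal (norm (weight (x::'a))) \<partial>lborel)
      = (\<integral>\<^sup>+x. (\<Prod>b\<in>Basis. ennreal (inverse (1 + ((x::'a) \<bullet> b)\<^sup>2))) \<partial>lborel)"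
    by (simp add: weight_nonneg) (simp add: weight_def prod_ennreal)
  also have "\<dots> = (\<Prod>b\<in>(Basis::'a set). (\<integral>\<^sup>+x. ennreal (inverse (1 + (x::real)\<^sup>2)) \<partial>lborel))"
    by (rule nn_integral_lborel_prod) auto
  also have "\<dots> < \<infinity>" using nn_integral_inverse_1_plus_square by (simp add: power_less_top_ennreal)
  finally show "(\<integral>\<^sup>+x. ennreal (norm (weight (x::'a))) \<partial>lborel) < \<infinity>" .
qed simp

lemma weight_ge: "weight (x::'a::euclidean_space) * (1 + (norm x)\<^sup>2) ^ DIM('a) \<ge> 1"
proof -
  have "(\<Prod>b\<in>(Basis::'a set). 1 + (x \<bullet> b)\<^sup>2) \<le> (\<Prod>b\<in>(Basis::'a set). 1 + (norm x)\<^sup>2)"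
    by (intro prod_mono) (auto simp: Basis_le_norm abs_le_square_iff[symmetric])
  then have "weight x * (\<Prod>b\<in>(Basis::'a set). 1 + (x \<bullet> b)\<^sup>2) \<le> weight x * (1 + (norm x)\<^sup>2) ^ DIM('a)"
    by (intro mult_left_mono weight_nonneg) simp
  moreover have "weight x * (\<Prod>b\<in>(Basis::'a set). 1 + (x \<bullet> b)\<^sup>2) = 1"
    unfolding weight_def prod.distrib[symmetric]
    by (intro prod.neutral) (auto simp: add_nonneg_eq_0_iff)
  ultimately show ?thesis by simp
qed

lemma rapid_decay_poly:
  assumes "rapid_decay f"
  shows "rapid_decay (\<lambda>x. complex_of_real ((1 + (norm x)\<^sup>2) ^ N) * f x)"
proof (induction N)
  case (Suc N)
  let ?f = "\<lambda>x. complex_of_real ((1 + (norm x)\<^sup>2) ^ N) * f x"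
  have 1: "rapid_decay (\<lambda>x. complex_of_real (norm x) * ?f x)"
    by (rule rapid_decay_norm_mult[OF Suc]) (simp add: norm_mult)
  have "rapid_decay (\<lambda>x. complex_of_real (norm x) * (complex_of_real (norm x) * ?f x))"
    by (rule rapid_decay_norm_mult[OF 1]) (simp add: norm_mult)
  from rapid_decay_add[OF Suc this] show ?case
    by (simp add: algebra_simps power2_eq_square)
qed (simp add: assms)

text \<open>The slack \<open>norm (x - y) \<le> 1\<close> lets one majorant at \<open>x\<close>
  control a derivative along a whole segment starting at \<open>x\<close>, as needed for difference
  quotients. The factor 4 comes from 1 + (|y| + 1)^2 \<le> 3 + 2 |y|^2 \<le> 4 (1 + |y|^2).\<close>

lemma rapid_decay_le_weight:
  fixes f :: "'a::euclidean_space \<Rightarrow> complex"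
  assumes "rapid_decay f"
  obtains C where "C \<ge> 0" "\<And>x y. norm (x - y) \<le> 1 \<Longrightarrow> norm (f y) \<le> C * weight x"
proof -
  let ?N = "DIM('a)"
  obtain C where C: "C \<ge> 0" "\<And>x. norm (complex_of_real ((1 + (norm x)\<^sup>2) ^ ?N) * f x) \<le> C"
    using rapid_decay_bounded[OF rapid_decay_poly[OF assms]] by blast
  have "norm (f y) \<le> (C * 4 ^ ?N) * weight x" if "norm (x - y) \<le> 1" for x y
  proof -
    have "norm x \<le> norm y + 1" using that norm_triangle_ineq2[of x y] by linarith
    then have "(norm x)\<^sup>2 \<le> (norm y + 1)\<^sup>2" by (intro power_mono) auto
    moreover have "(norm y + 1)\<^sup>2 \<le> 2 * (norm y)\<^sup>2 + 2"
      using zero_le_power2[of "norm y - 1"] by (simp add: power2_eq_square algebra_simps)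
    ultimately have "1 + (norm x)\<^sup>2 \<le> 4 * (1 + (norm y)\<^sup>2)" using zero_le_power2[of "norm y"] by (smt (verit))
    then have "(1 + (norm x)\<^sup>2) ^ ?N \<le> (4 * (1 + (norm y)\<^sup>2)) ^ ?N" by (intro power_mono) auto
    then have le: "(1 + (norm x)\<^sup>2) ^ ?N \<le> 4 ^ ?N * (1 + (norm y)\<^sup>2) ^ ?N" by (simp only: power_mult_distrib)
    have "1 \<le> weight x * (1 + (norm x)\<^sup>2) ^ ?N" by (rule weight_ge)
    also have "\<dots> \<le> weight x * (4 ^ ?N * (1 + (norm y)\<^sup>2) ^ ?N)"
      by (intro mult_left_mono le weight_nonneg)
    finally have "norm (f y) * 1 \<le> norm (f y) * (weight x * (4 ^ ?N * (1 + (norm y)\<^sup>2) ^ ?N))"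
      by (intro mult_left_mono) auto
    also have "\<dots> = (norm (complex_of_real ((1 + (norm y)\<^sup>2) ^ ?N) * f y)) * (4 ^ ?N * weight x)"
      by (simp add: norm_mult norm_power del: of_real_power of_real_add) 
    also have "\<dots> \<le> C * (4 ^ ?N * weight x)" by (intro mult_right_mono C) (simp add: weight_nonneg)
    finally show ?thesis by simp
  qed
  with C show thesis by (intro that[of "C * 4 ^ ?N"]) auto
qed

lemma integrable_rapid_decay:
  fixes f :: "'a::euclidean_space \<Rightarrow> complex"
  assumes "rapid_decay f" and [measurable]: "f \<in> borel_measurable borel"
  shows "integrable lborel f"
proof -
  obtain C where C: "C \<ge> 0" "\<And>x y. norm (x - y) \<le> 1 \<Longrightarrow> norm (f y) \<le> C * weight x"
    using rapid_decay_le_weight[OF assms(1)] by blast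
  have "integrable lborel (\<lambda>x. C * weight x :: real)" by (intro integrable_mult_right integrable_weight)
  then show ?thesis
  proof (rule Bochner_Integration.integrable_bound)
    show "AE x in lborel. norm (f x) \<le> norm (C * weight x)"
      using C(1) C(2)[of x x for x] weight_nonneg by (intro AE_I2) (simp add: abs_mult abs_of_nonneg[OF weight_nonneg])
  qed simp
qed

lemma integrable_schwartz: "schwartz f \<Longrightarrow> integrable lborel f"
  by (intro integrable_rapid_decay schwartz_rapid_decay schwartz_borel_measurable)

section \<open>The transform exchanges derivatives and coordinates\<close>

definition fourier :: "('a::euclidean_space \<Rightarrow> complex) \<Rightarrow> 'a \<Rightarrow> complex" where
  "fourier f \<xi> = (\<integral>x. f x * cis (- (x \<bullet> \<xi>)) \<partial>lborel)"

lemma cis_measurable [measurable]: "cis \<in> borel_measurable borel"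
  by (intro borel_measurable_continuous_onI continuous_intros)

lemma integrable_mult_cis:
  assumes "integrable lborel f" and [measurable]: "h \<in> borel_measurable borel"
  shows "integrable lborel (\<lambda>x. f x * cis (h x))"
proof -
  have [measurable]: "f \<in> borel_measurable borel" using assms(1) by (auto dest: borel_measurable_integrable)
  show ?thesis
    by (rule Bochner_Integration.integrable_bound[OF assms(1)]) (auto simp: norm_mult)
qed

lemma fourier_integrable:
  "schwartz f \<Longrightarrow> integrable lborel (\<lambda>x. f x * cis (- (x \<bullet> \<xi>)))"
  by (intro integrable_mult_cis integrable_schwartz) auto

lemma fourier_add:
  "schwartz f \<Longrightarrow> schwartz g \<Longrightarrow> fourier (\<lambda>x. f x + g x) \<xi> = fourier f \<xi> + fourier g \<xi>"
  unfolding fourier_def distrib_right by (intro Bochner_Integration.integral_add fourier_integrable)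

lemma fourier_cmult: "fourier (\<lambda>x. c * f x) \<xi> = c * fourier f \<xi>"
  unfolding fourier_def by (simp add: mult.assoc)

lemma fourier_sum:
  "(\<And>i. i \<in> I \<Longrightarrow> schwartz (f i)) \<Longrightarrow> fourier (\<lambda>x. \<Sum>i\<in>I. f i x) \<xi> = (\<Sum>i\<in>I. fourier (f i) \<xi>)"
  unfolding fourier_def sum_distrib_right
  by (rule Bochner_Integration.integral_sum) (auto intro: fourier_integrable)

lemma norm_fourier_le: "norm (fourier f \<xi>) \<le> (\<integral>x. norm (f x) \<partial>lborel)"
  unfolding fourier_def using integral_norm_bound[of lborel "\<lambda>x. f x * cis (- (x \<bullet> \<xi>))"]
  by (simp add: norm_mult)

lemma cis_taylor: "norm (cis a - 1 - \<i> * a) \<le> a\<^sup>2"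
proof -
  have "2 * norm (cis a - 1 - \<i> * a) \<le> a\<^sup>2"
    using iexp_approx1[of a 1] by (simp add: cis_conv_exp diff_diff_eq power2_eq_square)
  then show ?thesis using norm_ge_zero[of "cis a - 1 - \<i> * a"] by linarith
qed

text \<open>The second-order bound \<open>cis_taylor\<close> leaves a remainder of at most |h|^2
  times the integral of |x|^2 |f|, which gives the total derivative at once and without a limit
  theorem. Writing the derivative as a sum over \<open>Basis\<close> makes the partial derivatives
  readable from it.\<close>

lemma fourier_has_derivative:
  fixes f :: "'a::euclidean_space \<Rightarrow> complex"
  assumes f: "schwartz f"
  shows "(fourier f has_derivative (\<lambda>h. \<Sum>b\<in>Basis. of_real (h \<bullet> b) *
      fourier (\<lambda>x. - \<i> * (of_real (x \<bullet> b) * f x)) \<xi>)) (at \<xi>)"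
proof (rule has_derivativeI)
  let ?g = "\<lambda>b x. - \<i> * (complex_of_real (x \<bullet> b) * f x)"
  let ?D = "\<lambda>h. \<Sum>b\<in>Basis. of_real (h \<bullet> b) * fourier (?g b) \<xi>"
  let ?e = "\<lambda>\<xi> x. f x * cis (- (x \<bullet> \<xi>))"
  let ?d = "\<lambda>h x. - \<i> * of_real (x \<bullet> h) * ?e \<xi> x"
  have g: "schwartz (?g b)" if "b \<in> Basis" for b
    using that by (intro schwartz_cmult schwartz_coord f) simp
  have bl: "bounded_linear (\<lambda>h. complex_of_real (h \<bullet> b) * c)" for b :: 'a and c
    by (intro bounded_linear_mult_const bounded_linear_compose[OF bounded_linear_of_real] bounded_linear_inner_left)
  show "bounded_linear ?D" by (intro bounded_linear_sum bl)
  have [measurable]: "f \<in> borel_measurable borel" using f by simp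
  define K where "K = (\<integral>x. norm x ^ 2 * norm (f x) \<partial>lborel)"
  have "integrable lborel (\<lambda>x. complex_of_real ((1 + (norm x)\<^sup>2) ^ 1) * f x)"
    by (intro integrable_rapid_decay rapid_decay_poly schwartz_rapid_decay f) simp
  then have intK: "integrable lborel (\<lambda>x. norm x ^ 2 * norm (f x))"
    by (rule Bochner_Integration.integrable_bound)
      (auto simp: norm_mult norm_power simp del: of_real_add of_real_power intro!: mult_right_mono)
  have D: "?D h = (\<integral>x. ?d h x \<partial>lborel)" and intD: "integrable lborel (?d h)" for h
  proof -
    have eq: "(\<Sum>b\<in>Basis. complex_of_real (h \<bullet> b) * (?g b x * cis (- (x \<bullet> \<xi>)))) = ?d h x" for x
      by (simp add: euclidean_inner[of x h] sum_distrib_left sum_distrib_right algebra_simps)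
    have i: "integrable lborel (\<lambda>x. complex_of_real (h \<bullet> b) * (?g b x * cis (- (x \<bullet> \<xi>))))" if "b \<in> Basis" for b
      by (intro integrable_mult_right fourier_integrable g that)
    show "integrable lborel (?d h)"
      unfolding eq[symmetric] by (intro Bochner_Integration.integrable_sum i)
    have "?D h = (\<Sum>b\<in>Basis. (\<integral>x. of_real (h \<bullet> b) * (?g b x * cis (- (x \<bullet> \<xi>))) \<partial>lborel))"
      unfolding fourier_def by simp
    also have "\<dots> = (\<integral>x. ?d h x \<partial>lborel)"
      unfolding eq[symmetric] by (intro Bochner_Integration.integral_sum[symmetric] i)
    finally show "?D h = (\<integral>x. ?d h x \<partial>lborel)" .
  qed
  have main: "norm (fourier f (\<xi> + h) - fourier f \<xi> - ?D h) \<le> (norm h)\<^sup>2 * K" for h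
  proof -
    have eq: "fourier f (\<xi> + h) - fourier f \<xi> - ?D h = (\<integral>x. ?e (\<xi> + h) x - ?e \<xi> x - ?d h x \<partial>lborel)"
      unfolding D unfolding fourier_def
      by (subst Bochner_Integration.integral_diff, intro Bochner_Integration.integrable_diff fourier_integrable f, rule intD,
         subst Bochner_Integration.integral_diff, intro fourier_integrable f, intro fourier_integrable f, rule refl)
    have pt: "norm (?e (\<xi> + h) x - ?e \<xi> x - ?d h x) \<le> (norm h)\<^sup>2 * (norm x ^ 2 * norm (f x))" for x
    proof -
      have "cis (- (x \<bullet> (\<xi> + h))) = cis (- (x \<bullet> \<xi>)) * cis (- (x \<bullet> h))"
        by (simp add: cis_mult inner_add_right)
      then have "?e (\<xi> + h) x - ?e \<xi> x - ?d h x = ?e \<xi> x * (cis (- (x \<bullet> h)) - 1 - \<i> * of_real (- (x \<bullet> h)))"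
        by (simp only:) (simp add: algebra_simps)
      then have "norm (?e (\<xi> + h) x - ?e \<xi> x - ?d h x) = norm (f x) * norm (cis (- (x \<bullet> h)) - 1 - \<i> * of_real (- (x \<bullet> h)))"
        by (simp add: norm_mult)
      also have "\<dots> \<le> norm (f x) * (- (x \<bullet> h))\<^sup>2" by (intro mult_left_mono cis_taylor) auto
      also have "\<dots> \<le> norm (f x) * (norm x * norm h)\<^sup>2"
        by (intro mult_left_mono) (use Cauchy_Schwarz_ineq2[of x h] in \<open>auto simp: abs_le_square_iff[symmetric] simp flip: power_mult_distrib\<close>)
      finally show ?thesis by (simp add: power_mult_distrib algebra_simps)
    qed
    show ?thesis unfolding eq K_def integral_mult_right_zero[symmetric]
      by (rule Bochner_Integration.integral_norm_bound_integral)
        (intro Bochner_Integration.integrable_diff fourier_integrable f intD integrable_mult_right intK pt)+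
  qed
  have "norm ((fourier f y - fourier f \<xi> - ?D (y - \<xi>)) /\<^sub>R norm (y - \<xi>)) \<le> norm (y - \<xi>) * K" for y
  proof (cases "y = \<xi>")
    case False
    then have pos: "norm (y - \<xi>) > 0" by simp
    have "norm (fourier f y - fourier f \<xi> - ?D (y - \<xi>)) \<le> (norm (y - \<xi>) * K) * norm (y - \<xi>)"
      using main[of "y - \<xi>"] by (simp add: power2_eq_square mult_ac)
    with pos show ?thesis unfolding norm_scaleR norm_inverse real_norm_def abs_inverse abs_norm_cancel
      by (simp only: divide_inverse[symmetric] mult.commute[of "inverse _"] pos_divide_le_eq)
  qed simp
  then show "((\<lambda>y. (fourier f y - fourier f \<xi> - ?D (y - \<xi>)) /\<^sub>R norm (y - \<xi>)) \<longlongrightarrow> 0) (at \<xi>)"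
  proof (rule Lim_null_comparison[OF always_eventually[OF allI]])
    show "((\<lambda>y. norm (y - \<xi>) * K) \<longlongrightarrow> 0) (at \<xi>)"
      by (auto intro!: tendsto_eq_intros)
  qed
qed

lemma partial_deriv_fourier:
  assumes "schwartz f" "b \<in> Basis"
  shows "partial_deriv b (fourier f) = fourier (\<lambda>x. - \<i> * (of_real (x \<bullet> b) * f x))"
proof
  fix \<xi>
  have "partial_deriv b (fourier f) \<xi> = (\<Sum>b'\<in>Basis. of_real (b \<bullet> b') *
      fourier (\<lambda>x. - \<i> * (of_real (x \<bullet> b') * f x)) \<xi>)"
    by (rule partial_deriv_eqI[OF fourier_has_derivative[OF assms(1)]])
  also have "\<dots> = (\<Sum>b'\<in>Basis. if b' = b then fourier (\<lambda>x. - \<i> * (of_real (x \<bullet> b') * f x)) \<xi> else 0)"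
    by (intro sum.cong) (auto simp: inner_Basis assms(2))
  also have "\<dots> = fourier (\<lambda>x. - \<i> * (of_real (x \<bullet> b) * f x)) \<xi>" using assms(2) by simp
  finally show "partial_deriv b (fourier f) \<xi> = fourier (\<lambda>x. - \<i> * (of_real (x \<bullet> b) * f x)) \<xi>" .
qed

lemma fourier_translate:
  fixes f :: "'a::euclidean_space \<Rightarrow> complex"
  assumes [measurable]: "f \<in> borel_measurable borel"
  shows "fourier (\<lambda>x. f (x + a)) \<xi> = cis (a \<bullet> \<xi>) * fourier f \<xi>"
proof -
  have "fourier f \<xi> = (\<integral>x. f x * cis (- (x \<bullet> \<xi>)) \<partial>distr lborel borel ((+) a))"
    unfolding fourier_def by (simp add: lborel_distr_plus)
  also have "\<dots> = (\<integral>x. cis (- (a \<bullet> \<xi>)) * (f (x + a) * cis (- (x \<bullet> \<xi>))) \<partial>lborel)"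
    by (subst integral_distr) (auto simp: inner_add_left add.commute cis_mult mult.left_commute)
  also have "\<dots> = cis (- (a \<bullet> \<xi>)) * fourier (\<lambda>x. f (x + a)) \<xi>"
    unfolding fourier_def by simp
  finally show ?thesis by (simp add: cis_mult flip: mult.assoc)
qed

lemma integrable_translate:
  fixes f :: "'a::euclidean_space \<Rightarrow> complex"
  assumes "integrable lborel f" shows "integrable lborel (\<lambda>x. f (x + a))"
proof -
  have [measurable]: "f \<in> borel_measurable borel" using assms by (auto dest: borel_measurable_integrable)
  have "integrable (distr lborel borel ((+) a)) f"
    unfolding lborel_distr_plus by (rule assms)
  then show ?thesis by (subst (asm) integrable_distr_eq) (auto simp: add.commute)
qed

lemma has_vector_derivative_line:
  assumes f: "\<And>z. f differentiable (at z)"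
  shows "((\<lambda>t. f (x + t *\<^sub>R v)) has_vector_derivative partial_deriv v f (x + t *\<^sub>R v)) (at t within S)"
proof -
  have *: "(f has_derivative frechet_derivative f (at (x + t *\<^sub>R v))) (at (x + t *\<^sub>R v))"
    using f frechet_derivative_works by blast
  have "((\<lambda>t. f (x + t *\<^sub>R v)) has_derivative (\<lambda>s. frechet_derivative f (at (x + t *\<^sub>R v)) (s *\<^sub>R v))) (at t within S)"
    by (rule has_derivative_compose[where f="\<lambda>t. x + t *\<^sub>R v" and g=f, OF _ *])
      (auto intro!: derivative_eq_intros)
  then show ?thesis using linear_frechet_derivative[OF f]
    by (simp add: partial_deriv_def linear_scale has_vector_derivative_def)
qed

lemma norm_increment_le:
  fixes f :: "'a::euclidean_space \<Rightarrow> complex"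
  assumes f: "\<And>z. f differentiable (at z)"
    and B: "\<And>t. 0 \<le> t \<Longrightarrow> t \<le> h \<Longrightarrow> norm (partial_deriv v f (x + t *\<^sub>R v)) \<le> B" and h: "0 \<le> h"
  shows "norm (f (x + h *\<^sub>R v) - f x) \<le> B * h"
proof -
  have d: "((\<lambda>t. f (x + t *\<^sub>R v)) has_derivative (\<lambda>s. s *\<^sub>R partial_deriv v f (x + t *\<^sub>R v))) (at t within {0..h})" for t
    using has_vector_derivative_line[OF f] by (simp add: has_vector_derivative_def)
  
  have "norm (f (x + h *\<^sub>R v) - f (x + 0 *\<^sub>R v)) \<le> B * norm (h - 0)"
  proof (rule differentiable_bound[OF convex_real_interval(5) d])
    fix t assume t: "t \<in> {0..h}"
    show "onorm (\<lambda>s. s *\<^sub>R partial_deriv v f (x + t *\<^sub>R v)) \<le> B"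
    proof (rule onorm_le)
      show "norm (s *\<^sub>R partial_deriv v f (x + t *\<^sub>R v)) \<le> B * norm s" for s
        using mult_right_mono[OF B[of t], of "\<bar>s\<bar>"] t by (simp add: mult.commute)
    qed
  qed (use h in auto)
  then show ?thesis using h by simp
qed

text \<open>Translation replaces integration by parts: a difference quotient of \<open>f\<close>
  transforms into (cis (h b \<bullet> \<xi>) - 1) / h times the transform of \<open>f\<close>, and
  both sides converge, the left one by dominated convergence.\<close>

lemma fourier_partial_deriv:
  fixes f :: "'a::euclidean_space \<Rightarrow> complex"
  assumes f: "schwartz f" and b: "b \<in> Basis"
  shows "fourier (partial_deriv b f) \<xi> = \<i> * of_real (b \<bullet> \<xi>) * fourier f \<xi>"
proof -
  \<comment> \<open>Dominated convergence wants a sequence; step sizes of at most 1 keep the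
    segments inside the unit ball allowed by \<open>rapid_decay_le_weight\<close>.\<close>
  define h where "h = (\<lambda>n. inverse (real (Suc n)))"
  have h: "0 < h n" "h n \<le> 1" for n by (auto simp: h_def divide_simps)
  have h0: "h \<longlonglongrightarrow> 0" unfolding h_def by (rule LIMSEQ_inverse_real_of_nat)
  have h0': "filterlim h (at 0) sequentially"
    using h0 h by (auto simp: filterlim_at less_imp_neq[symmetric] order.strict_iff_not)
  have [measurable]: "f \<in> borel_measurable borel" "partial_deriv b f \<in> borel_measurable borel"
    using f by (simp_all add: schwartz_borel_measurable schwartz_partial)
  let ?q = "\<lambda>n x. (f (x + h n *\<^sub>R b) - f x) / of_real (h n)"
  obtain C where C: "C \<ge> 0" "\<And>x y. norm (x - y) \<le> 1 \<Longrightarrow> norm (partial_deriv b f y) \<le> C * weight x"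
    using rapid_decay_le_weight[OF schwartz_rapid_decay[OF schwartz_partial[OF f]]] by blast
  have dom: "norm (?q n x) \<le> C * weight x" for n x
  proof -
    have "norm (f (x + h n *\<^sub>R b) - f x) \<le> (C * weight x) * h n"
    proof (rule norm_increment_le)
      show "norm (partial_deriv b f (x + t *\<^sub>R b)) \<le> C * weight x" if "0 \<le> t" "t \<le> h n" for t
        by (rule C) (use that h[of n] b in auto)
    qed (use f h[of n] in \<open>auto simp: schwartz_differentiable less_imp_le\<close>)
    then show ?thesis using h[of n] by (simp add: norm_divide divide_simps)
  qed
  have lim: "(\<lambda>n. ?q n x) \<longlonglongrightarrow> partial_deriv b f x" for x
  proof -
    have "((\<lambda>t. f (x + t *\<^sub>R b)) has_vector_derivative partial_deriv b f x) (at 0)"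
      using has_vector_derivative_line[OF schwartz_differentiable[OF f], where x=x and t=0 and v=b] by simp
    then have "((\<lambda>t. ((f (x + t *\<^sub>R b) - f x) - t *\<^sub>R partial_deriv b f x) /\<^sub>R norm t) \<longlongrightarrow> 0) (at 0)"
      by (simp add: has_vector_derivative_def has_derivative_def)
    from filterlim_compose[OF this h0']
    have "(\<lambda>n. ((f (x + h n *\<^sub>R b) - f x) - h n *\<^sub>R partial_deriv b f x) /\<^sub>R norm (h n)) \<longlonglongrightarrow> 0" .
    moreover have "((f (x + h n *\<^sub>R b) - f x) - h n *\<^sub>R partial_deriv b f x) /\<^sub>R norm (h n)
        = ?q n x - partial_deriv b f x" for n
      using h[of n] by (simp add: scaleR_conv_of_real field_simps)
    ultimately show ?thesis by (simp add: LIM_zero_iff)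
  qed
  have L1: "(\<lambda>n. \<integral>x. ?q n x * cis (- (x \<bullet> \<xi>)) \<partial>lborel) \<longlonglongrightarrow> (\<integral>x. partial_deriv b f x * cis (- (x \<bullet> \<xi>)) \<partial>lborel)"
  proof (rule integral_dominated_convergence[where w="\<lambda>x. C * weight x"])
    show "integrable lborel (\<lambda>x. C * weight x :: real)" by (intro integrable_mult_right integrable_weight)
    show "AE x in lborel. (\<lambda>n. ?q n x * cis (- (x \<bullet> \<xi>))) \<longlonglongrightarrow> partial_deriv b f x * cis (- (x \<bullet> \<xi>))"
      by (intro always_eventually allI tendsto_intros lim)
    show "AE x in lborel. norm (?q n x * cis (- (x \<bullet> \<xi>))) \<le> C * weight x" for n
      using dom unfolding norm_mult norm_cis mult_1_right by (intro AE_I2)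
  qed simp_all
  have L2: "(\<integral>x. ?q n x * cis (- (x \<bullet> \<xi>)) \<partial>lborel)
      = (cis (h n * (b \<bullet> \<xi>)) - 1) / of_real (h n) * fourier f \<xi>" for n
  proof -
    have [measurable]: "(\<lambda>x. f (x + h n *\<^sub>R b)) \<in> borel_measurable borel" by measurable
    note i1 = integrable_translate[OF integrable_schwartz[OF f], of "h n *\<^sub>R b"]
    have "(\<integral>x. ?q n x * cis (- (x \<bullet> \<xi>)) \<partial>lborel) =
       (\<integral>x. (f (x + h n *\<^sub>R b) * cis (- (x \<bullet> \<xi>)) - f x * cis (- (x \<bullet> \<xi>))) / of_real (h n) \<partial>lborel)"
      by (simp add: left_diff_distrib)
    also have "\<dots> = (fourier (\<lambda>x. f (x + h n *\<^sub>R b)) \<xi> - fourier f \<xi>) / of_real (h n)"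
      unfolding fourier_def using i1 fourier_integrable[OF f]
      by (simp add: integrable_mult_cis)
    finally show ?thesis by (simp add: fourier_translate algebra_simps)
  qed
  have L3: "(\<lambda>n. (cis (h n * (b \<bullet> \<xi>)) - 1) / of_real (h n) * fourier f \<xi>)
      \<longlonglongrightarrow> \<i> * of_real (b \<bullet> \<xi>) * fourier f \<xi>"
  proof (rule tendsto_mult[OF _ tendsto_const])
    have "norm ((cis (h n * (b \<bullet> \<xi>)) - 1) / of_real (h n) - \<i> * of_real (b \<bullet> \<xi>)) \<le> h n * (b \<bullet> \<xi>)\<^sup>2" for n
    proof -
      have "(cis (h n * (b \<bullet> \<xi>)) - 1) / of_real (h n) - \<i> * of_real (b \<bullet> \<xi>)
        = (cis (h n * (b \<bullet> \<xi>)) - 1 - \<i> * of_real (h n * (b \<bullet> \<xi>))) / of_real (h n)"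
        using h[of n] by (simp add: field_simps)
      then have "norm ((cis (h n * (b \<bullet> \<xi>)) - 1) / of_real (h n) - \<i> * of_real (b \<bullet> \<xi>))
        = norm (cis (h n * (b \<bullet> \<xi>)) - 1 - \<i> * of_real (h n * (b \<bullet> \<xi>))) / h n"
        using h[of n] by (simp add: norm_divide)
      also have "\<dots> \<le> (h n * (b \<bullet> \<xi>))\<^sup>2 / h n"
        by (intro divide_right_mono cis_taylor) (use h[of n] in simp)
      also have "\<dots> = h n * (b \<bullet> \<xi>)\<^sup>2" using h[of n] by (simp add: power2_eq_square)
      finally show ?thesis .
    qed
    then have "(\<lambda>n. (cis (h n * (b \<bullet> \<xi>)) - 1) / of_real (h n) - \<i> * of_real (b \<bullet> \<xi>)) \<longlonglongrightarrow> 0"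
    proof (rule Lim_null_comparison[OF always_eventually[OF allI]])
      show "(\<lambda>n. h n * (b \<bullet> \<xi>)\<^sup>2) \<longlonglongrightarrow> 0"
        by (rule tendsto_mult_left_zero[OF h0])
    qed
    then show "(\<lambda>n. (cis (h n * (b \<bullet> \<xi>)) - 1) / of_real (h n)) \<longlonglongrightarrow> \<i> * of_real (b \<bullet> \<xi>)"
      by (rule LIM_zero_cancel)
  qed
  show ?thesis
    using LIMSEQ_unique[OF L1[unfolded L2] L3] by (simp only: fourier_def)
qed

lemma le_1_plus_square: "a \<le> 1 + a * a" for a :: real
  using zero_le_square[of "2 * a - 1"] zero_le_square[of a] by (simp add: algebra_simps)

text \<open>Iterating minus the Laplacian multiplies the transform by |\<xi>|^(2m), and every
  transform is bounded by an L^1 norm. Odd powers of |\<xi>| are covered by a \<le> 1 + a^2.\<close>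

lemma rapid_decay_fourier:
  fixes f :: "'a::euclidean_space \<Rightarrow> complex"
  assumes f: "schwartz f"
  shows "rapid_decay (fourier f)"
proof (rule rapid_decayI)
  fix m :: nat
  have *: "\<exists>g. schwartz g \<and> (\<forall>\<xi>. fourier g \<xi> = of_real (norm \<xi> ^ (2 * m)) * fourier f \<xi>)"
  proof (induction m)
    case (Suc m)
    then obtain g where g: "schwartz g" "\<And>\<xi>. fourier g \<xi> = of_real (norm \<xi> ^ (2 * m)) * fourier f \<xi>" by blast
    let ?g = "\<lambda>x. -1 * (\<Sum>b\<in>Basis. partial_deriv b (partial_deriv b g) x)"
    have "fourier ?g \<xi> = of_real (norm \<xi> ^ (2 * Suc m)) * fourier f \<xi>" for \<xi>
    proof -
      have "fourier ?g \<xi> = - (\<Sum>b\<in>Basis. \<i> * of_real (b \<bullet> \<xi>) * (\<i> * of_real (b \<bullet> \<xi>) * fourier g \<xi>))"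
        using g(1) by (simp only: fourier_cmult fourier_sum schwartz_partial)
          (simp add: fourier_partial_deriv schwartz_partial cong: sum.cong)
      also have "\<dots> = (\<Sum>b\<in>Basis. of_real ((b \<bullet> \<xi>)\<^sup>2)) * fourier g \<xi>"
        unfolding sum_negf[symmetric] sum_distrib_right
      proof (intro sum.cong refl)
        have "- (\<i> * a * (\<i> * a * c)) = a * a * c" for a c :: complex
          by (simp add: algebra_simps)
        then show "- (\<i> * of_real (b \<bullet> \<xi>) * (\<i> * of_real (b \<bullet> \<xi>) * fourier g \<xi>)) =
            of_real ((b \<bullet> \<xi>)\<^sup>2) * fourier g \<xi>" for b
          by (simp add: power2_eq_square)
      qed
      also have "(\<Sum>b\<in>Basis. complex_of_real ((b \<bullet> \<xi>)\<^sup>2)) = of_real ((norm \<xi>)\<^sup>2)"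
        by (subst power2_norm_eq_inner, subst euclidean_inner) (simp add: power2_eq_square inner_commute)
      finally show ?thesis by (simp add: g power_mult power2_eq_square)
    qed
    moreover have "schwartz ?g" by (intro schwartz_cmult schwartz_sum schwartz_partial g)
    ultimately show ?case by blast
  qed (use f in auto)
  then obtain g where g: "schwartz g" "\<And>\<xi>. fourier g \<xi> = of_real (norm \<xi> ^ (2 * m)) * fourier f \<xi>" by blast
  have "norm \<xi> ^ m * norm (fourier f \<xi>) \<le> (\<integral>x. norm (f x) \<partial>lborel) + (\<integral>x. norm (g x) \<partial>lborel)" for \<xi>
  proof -
    have "norm \<xi> ^ m \<le> 1 + norm \<xi> ^ (2 * m)"
      using le_1_plus_square[of "norm \<xi> ^ m"] by (simp add: mult_2 power_add)
    then have "norm \<xi> ^ m * norm (fourier f \<xi>) \<le> (1 + norm \<xi> ^ (2 * m)) * norm (fourier f \<xi>)"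
      by (intro mult_right_mono) auto
    also have "\<dots> = norm (fourier f \<xi>) + norm (fourier g \<xi>)"
      by (simp add: g norm_mult norm_power algebra_simps)
    finally show ?thesis using norm_fourier_le[of f \<xi>] norm_fourier_le[of g \<xi>] by linarith
  qed
  then show "\<exists>C. \<forall>\<xi>. norm \<xi> ^ m * norm (fourier f \<xi>) \<le> C" by blast
qed

lemma schwartz_fourier:
  fixes f :: "'a::euclidean_space \<Rightarrow> complex"
  assumes "schwartz f" shows "schwartz (fourier f)"
proof -
  have "\<forall>f::'a \<Rightarrow> complex. schwartz f \<longrightarrow> schwartz_upto k (fourier f)" for k
  proof (induction k)
    case (Suc k)
    show ?case
    proof (intro allI impI)
      fix f :: "'a \<Rightarrow> complex" assume f: "schwartz f"
      have "fourier f differentiable_on UNIV"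
        using fourier_has_derivative[OF f] by (auto simp: differentiable_on_def differentiable_def)
      moreover have "schwartz_upto k (partial_deriv b (fourier f))" if b: "b \<in> Basis" for b
      proof -
        have "schwartz (\<lambda>x. - \<i> * (complex_of_real (x \<bullet> b) * f x))"
          using b by (intro schwartz_cmult schwartz_coord f) simp
        with Suc show ?thesis unfolding partial_deriv_fourier[OF f b] by blast
      qed
      ultimately show "schwartz_upto (Suc k) (fourier f)" by (simp add: rapid_decay_fourier f)
    qed
  qed (simp add: rapid_decay_fourier)
  then show ?thesis using assms by (simp add: schwartz_iff_upto)
qed

subsection \<open>Fourier inversion and orthogonal invariance\<close>

lemma lborel_integral_scale:
  fixes f :: "'a::euclidean_space \<Rightarrow> complex"
  assumes [measurable]: "f \<in> borel_measurable borel" and c: "c \<noteq> 0"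
  shows "(\<integral>x. f x \<partial>lborel) = of_real (\<bar>c\<bar> ^ DIM('a)) * (\<integral>x. f (c *\<^sub>R x) \<partial>lborel)"
proof -
  have "(\<integral>x. f x \<partial>lborel) = (\<integral>x. f x \<partial>density (distr lborel borel (\<lambda>x. 0 + c *\<^sub>R x)) (\<lambda>_. ennreal (\<bar>c\<bar> ^ DIM('a))))"
    using lborel_affine[OF c, of "0::'a"] by simp
  also have "\<dots> = (\<integral>x. (\<bar>c\<bar> ^ DIM('a)) *\<^sub>R f x \<partial>distr lborel borel (\<lambda>x. 0 + c *\<^sub>R x))"
    by (subst integral_density) auto
  also have "\<dots> = (\<integral>x. (\<bar>c\<bar> ^ DIM('a)) *\<^sub>R f (c *\<^sub>R x) \<partial>lborel)"
    by (subst integral_distr) auto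
  finally show ?thesis by (simp add: scaleR_conv_of_real)
qed

lemma fourier_multiplication_formula:
  fixes f g :: "'a::euclidean_space \<Rightarrow> complex"
  assumes f: "integrable lborel f" and g: "integrable lborel g"
  shows "(\<integral>x. fourier f x * g x \<partial>lborel) = (\<integral>x. f x * fourier g x \<partial>lborel)"
proof -
  have [measurable]: "f \<in> borel_measurable borel" "g \<in> borel_measurable borel"
    using f g by (auto dest: borel_measurable_integrable)
  have "integrable (lborel \<Otimes>\<^sub>M lborel) (\<lambda>(x, y). f x * g y * cis (- (x \<bullet> y)))"
  proof (rule lborel_pair.Fubini_integrable)
    show "integrable lborel (\<lambda>x. \<integral>y. norm (case (x, y) of (x, y) \<Rightarrow> f x * g y * cis (- (x \<bullet> y))) \<partial>lborel)"
      using f by (simp add: norm_mult)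
    show "AE x in lborel. integrable lborel (\<lambda>y. case (x, y) of (x, y) \<Rightarrow> f x * g y * cis (- (x \<bullet> y)))"
      using g by (auto intro!: AE_I2 integrable_mult_cis integrable_mult_right)
  qed measurable
  from lborel_pair.Fubini_integral[OF this]
  have "(\<integral>y. (\<integral>x. f x * g y * cis (- (x \<bullet> y)) \<partial>lborel) \<partial>lborel) =
    (\<integral>x. (\<integral>y. f x * g y * cis (- (x \<bullet> y)) \<partial>lborel) \<partial>lborel)" by simp
  moreover have "(\<integral>x. f x * g y * cis (- (x \<bullet> y)) \<partial>lborel) = fourier f y * g y" for y
    unfolding fourier_def by (simp add: mult.assoc mult.left_commute[of _ "g y"] mult.commute[of _ "g y"])
  moreover have "(\<integral>y. f x * g y * cis (- (x \<bullet> y)) \<partial>lborel) = f x * fourier g x" for x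
    unfolding fourier_def by (simp add: mult.assoc inner_commute)
  ultimately show ?thesis by simp
qed

text \<open>Regularise the inversion integral by \<open>\<gamma> (\<epsilon> \<xi>)\<close>, move the Fourier transform to the other
  factor, rescale, and let \<open>\<epsilon>\<close> tend to \<open>0\<close>. Only the nonvanishing of the constant matters later,
  so the Gaussian integral is never evaluated.\<close>

lemma fourier_fourier_aux:
  fixes f \<gamma> :: "'a::euclidean_space \<Rightarrow> complex"
  assumes f: "schwartz f" and \<gamma>: "schwartz \<gamma>" "\<gamma> 0 = 1"
  shows "fourier (fourier f) (- x) = (\<integral>u. fourier \<gamma> u \<partial>lborel) * f x"
proof -
  define h where "h = (\<lambda>n. inverse (real (Suc n)))"
  have h: "0 < h n" for n by (auto simp: h_def divide_simps)
  have h0: "h \<longlonglongrightarrow> 0" unfolding h_def by (rule LIMSEQ_inverse_real_of_nat)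
  have [measurable]: "f \<in> borel_measurable borel" "\<gamma> \<in> borel_measurable borel"
    "fourier f \<in> borel_measurable borel" "fourier \<gamma> \<in> borel_measurable borel"
    using f \<gamma> by (simp_all add: schwartz_borel_measurable schwartz_fourier)
  have contf: "isCont f z" and cont\<gamma>: "isCont \<gamma> z" for z
    using schwartz_differentiable[OF f] schwartz_differentiable[OF \<gamma>(1)]
    by (auto intro: differentiable_imp_continuous_within)
  obtain C where C: "C \<ge> 0" "\<And>z. norm (f z) \<le> C"
    using rapid_decay_bounded[OF schwartz_rapid_decay[OF f]] by blast
  obtain D where D: "D \<ge> 0" "\<And>z. norm (\<gamma> z) \<le> D"
    using rapid_decay_bounded[OF schwartz_rapid_decay[OF \<gamma>(1)]] by blast
  let ?A = "\<lambda>n. \<integral>\<xi>. cis (x \<bullet> \<xi>) * fourier f \<xi> * \<gamma> (h n *\<^sub>R \<xi>) \<partial>lborel"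
  have L1: "?A \<longlonglongrightarrow> (\<integral>\<xi>. cis (x \<bullet> \<xi>) * fourier f \<xi> * 1 \<partial>lborel)"
  proof (rule integral_dominated_convergence[where w="\<lambda>\<xi>. norm (fourier f \<xi>) * D"])
    show "integrable lborel (\<lambda>\<xi>. norm (fourier f \<xi>) * D)"
      by (intro integrable_mult_left integrable_norm integrable_schwartz schwartz_fourier f)
    have "(\<lambda>n. \<gamma> (h n *\<^sub>R \<xi>)) \<longlonglongrightarrow> 1" for \<xi>
    proof -
      have "(\<lambda>n. h n *\<^sub>R \<xi>) \<longlonglongrightarrow> 0" using tendsto_scaleR[OF h0 tendsto_const, of \<xi>] by simp
      from isCont_tendsto_compose[OF cont\<gamma> this] show ?thesis by (simp add: \<gamma>)
    qed
    then show "AE \<xi> in lborel. (\<lambda>n. cis (x \<bullet> \<xi>) * fourier f \<xi> * \<gamma> (h n *\<^sub>R \<xi>)) \<longlonglongrightarrow> cis (x \<bullet> \<xi>) * fourier f \<xi> * 1"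
      by (intro AE_I2 tendsto_mult tendsto_const)
    show "AE \<xi> in lborel. norm (cis (x \<bullet> \<xi>) * fourier f \<xi> * \<gamma> (h n *\<^sub>R \<xi>)) \<le> norm (fourier f \<xi>) * D" for n
      by (intro AE_I2) (auto simp: norm_mult intro!: mult_left_mono D)
  qed simp_all
  have L2: "?A = (\<lambda>n. \<integral>u. f (h n *\<^sub>R u + x) * fourier \<gamma> u \<partial>lborel)"
  proof
    fix n
    let ?\<gamma> = "\<lambda>\<xi>. \<gamma> (h n *\<^sub>R \<xi>)"
    have i\<gamma>: "integrable lborel ?\<gamma>"
    proof -
      have "rapid_decay ?\<gamma>"
      proof (rule rapid_decayI)
        fix m
        obtain K where K: "\<And>z. norm z ^ m * norm (\<gamma> z) \<le> K"
          using rapid_decayD[OF schwartz_rapid_decay[OF \<gamma>(1)]] by blast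
        have "norm z ^ m * norm (?\<gamma> z) \<le> K / h n ^ m" for z
          using K[of "h n *\<^sub>R z"] h[of n] by (simp add: power_mult_distrib field_simps)
        then show "\<exists>C. \<forall>z. norm z ^ m * norm (?\<gamma> z) \<le> C" by blast
      qed
      then show ?thesis by (rule integrable_rapid_decay) simp
    qed
    have scale: "fourier \<gamma> u = of_real (\<bar>h n\<bar> ^ DIM('a)) * fourier ?\<gamma> (h n *\<^sub>R u)" for u
      unfolding fourier_def using h[of n] by (subst lborel_integral_scale[where c="h n"]) auto
    \<comment> \<open>The rescaled function is only shown to decay rapidly, so measurability of its
      transform is read off from that of \<open>fourier \<gamma>\<close> through the scaling
      identity.\<close>
    have m\<gamma>: "fourier ?\<gamma> \<in> borel_measurable borel"
    proof -
      have "fourier ?\<gamma> = (\<lambda>v. fourier \<gamma> (inverse (h n) *\<^sub>R v) / of_real (\<bar>h n\<bar> ^ DIM('a)))"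
        using h[of n] by (auto simp: scale fun_eq_iff)
      then show ?thesis by simp
    qed
    note [measurable] = m\<gamma>
    have "?A n = (\<integral>\<xi>. fourier (\<lambda>u. f (u + x)) \<xi> * ?\<gamma> \<xi> \<partial>lborel)"
      by (simp add: fourier_translate)
    also have "\<dots> = (\<integral>u. f (u + x) * fourier ?\<gamma> u \<partial>lborel)"
      by (intro fourier_multiplication_formula integrable_translate integrable_schwartz f i\<gamma>)
    also have "\<dots> = of_real (\<bar>h n\<bar> ^ DIM('a)) * (\<integral>u. f (h n *\<^sub>R u + x) * fourier ?\<gamma> (h n *\<^sub>R u) \<partial>lborel)"
      using h[of n] by (subst lborel_integral_scale[where c="h n"]) auto
    also have "\<dots> = (\<integral>u. f (h n *\<^sub>R u + x) * fourier \<gamma> u \<partial>lborel)"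
      unfolding scale by (subst integral_mult_right_zero[symmetric]) (simp add: mult.left_commute)
    finally show "?A n = (\<integral>u. f (h n *\<^sub>R u + x) * fourier \<gamma> u \<partial>lborel)" by simp
  qed
  have L3: "(\<lambda>n. \<integral>u. f (h n *\<^sub>R u + x) * fourier \<gamma> u \<partial>lborel) \<longlonglongrightarrow> (\<integral>u. f x * fourier \<gamma> u \<partial>lborel)"
  proof (rule integral_dominated_convergence[where w="\<lambda>u. C * norm (fourier \<gamma> u)"])
    show "integrable lborel (\<lambda>u. C * norm (fourier \<gamma> u))"
      by (intro integrable_mult_right integrable_norm integrable_schwartz schwartz_fourier \<gamma>)
    have "(\<lambda>n. f (h n *\<^sub>R u + x)) \<longlonglongrightarrow> f x" for u
    proof -
      have "(\<lambda>n. h n *\<^sub>R u + x) \<longlonglongrightarrow> x"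
        using tendsto_add[OF tendsto_scaleR[OF h0 tendsto_const] tendsto_const, of u x] by simp
      from isCont_tendsto_compose[OF contf this] show ?thesis .
    qed
    then show "AE u in lborel. (\<lambda>n. f (h n *\<^sub>R u + x) * fourier \<gamma> u) \<longlonglongrightarrow> f x * fourier \<gamma> u"
      by (intro AE_I2 tendsto_mult tendsto_const)
    show "AE u in lborel. norm (f (h n *\<^sub>R u + x) * fourier \<gamma> u) \<le> C * norm (fourier \<gamma> u)" for n
      by (intro AE_I2) (auto simp: norm_mult intro!: mult_right_mono C)
  qed simp_all
  have "(\<integral>\<xi>. cis (x \<bullet> \<xi>) * fourier f \<xi> * 1 \<partial>lborel) = (\<integral>u. f x * fourier \<gamma> u \<partial>lborel)"
    using LIMSEQ_unique[OF L1 L3[folded L2]] .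
  then show ?thesis
    by (simp add: fourier_def[of "fourier f"] inner_commute mult.commute)
qed

lemma continuous_AE_eq_0:
  fixes f :: "'a::euclidean_space \<Rightarrow> complex"
  assumes "continuous_on UNIV f" "AE x in lborel. f x = 0"
  shows "f x = 0"
proof (rule ccontr)
  assume "f x \<noteq> 0"
  have op: "open {x. f x \<noteq> 0}"
    using open_Collect_neq[OF assms(1) continuous_on_const] .
  have "{x. f x \<noteq> 0} \<in> null_sets lborel"
    using assms(2) op by (subst (asm) AE_iff_null) auto
  then have "negligible {x. f x \<noteq> 0}"
    by (simp add: negligible_iff_null_sets null_sets_completionI)
  with open_not_negligible[OF op] \<open>f x \<noteq> 0\<close> show False by blast
qed

lemma integral_nonneg_continuous_eq_0:
  fixes f :: "'a::euclidean_space \<Rightarrow> real"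
  assumes "integrable lborel f" "continuous_on UNIV f" "\<And>x. f x \<ge> 0" "(\<integral>x. f x \<partial>lborel) = 0"
  shows "f z = 0"
proof -
  have "AE x in lborel. f x = 0"
    using integral_nonneg_eq_0_iff_AE[OF assms(1)] assms(3,4) by simp
  then have "complex_of_real (f z) = 0"
    using assms(2) by (intro continuous_AE_eq_0[of "\<lambda>x. complex_of_real (f x)" z]) (auto intro!: continuous_intros)
  then show ?thesis by simp
qed

text \<open>If the constant vanished, so would the transform of \<open>G\<close>, and the
  multiplication formula would make the integral of G^2 zero. The Gaussian is real and even, so
  \<open>G\<close> is real and hence zero; but \<open>G 0\<close> is the integral of a positive
  function. Smoothness of the Gaussian enters as an assumption because it is obtained below from the
  theory of radial functions.\<close>

lemma fourier_fourier:
  assumes gauss: "schwartz (\<lambda>x::'a::euclidean_space. complex_of_real (exp (- (norm x)\<^sup>2)))"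
  obtains c where "c \<noteq> 0"
    "\<And>(f::'a \<Rightarrow> complex) x. schwartz f \<Longrightarrow> fourier (fourier f) (- x) = c * f x"
proof
  define \<gamma> where "\<gamma> = (\<lambda>x::'a. complex_of_real (exp (- (norm x)\<^sup>2)))"
  define G where "G = fourier \<gamma>"
  have s1: "schwartz \<gamma>" using gauss by (simp add: \<gamma>_def)
  have s2: "schwartz G" unfolding G_def by (rule schwartz_fourier[OF s1])
  have [measurable]: "\<gamma> \<in> borel_measurable borel" by (rule schwartz_borel_measurable[OF s1])
  let ?c = "\<integral>u. G u \<partial>lborel"
  show inv: "fourier (fourier f) (- x) = ?c * f x" if "schwartz f" for f :: "'a \<Rightarrow> complex" and x
    unfolding G_def by (rule fourier_fourier_aux[OF that s1]) (simp add: \<gamma>_def)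
  show "?c \<noteq> 0"
  proof
    assume c: "?c = 0"
    have "fourier G x = 0" for x using inv[OF s1, of "-x"] c by (simp add: G_def)
    then have 0: "(\<integral>x. G x * G x \<partial>lborel) = 0"
      using fourier_multiplication_formula[OF integrable_schwartz[OF s1] integrable_schwartz[OF s2]]
      by (simp add: G_def)
    have Im0: "Im (G \<xi>) = 0" for \<xi>
    proof -
      have "G \<xi> = (\<integral>x. \<gamma> (-1 *\<^sub>R x) * cis (- ((-1 *\<^sub>R x) \<bullet> \<xi>)) \<partial>lborel)"
        unfolding fourier_def G_def by (subst lborel_integral_scale[where c="-1"]) auto
      also have "\<dots> = (\<integral>x. cnj (\<gamma> x * cis (- (x \<bullet> \<xi>))) \<partial>lborel)" by (simp add: cis_cnj \<gamma>_def)
      also have "\<dots> = cnj (G \<xi>)" unfolding fourier_def G_def by (rule Bochner_Integration.integral_cnj)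
      finally show ?thesis by (simp add: complex_eq_iff)
    qed
    have sq: "G x * G x = complex_of_real ((Re (G x))\<^sup>2)" for x
      by (simp add: complex_eq_iff Im0 power2_eq_square)
    have "(\<integral>x. (Re (G x))\<^sup>2 \<partial>lborel) = 0" using 0 unfolding sq integral_complex_of_real by simp
    moreover have "integrable lborel (\<lambda>x. (Re (G x))\<^sup>2)"
      using integrable_Re[OF integrable_schwartz[OF schwartz_mult[OF s2 s2]]] unfolding sq by simp
    ultimately have "(Re (G 0))\<^sup>2 = 0"
      by (intro integral_nonneg_continuous_eq_0[where f="\<lambda>x. (Re (G x))\<^sup>2"])
        (auto intro!: continuous_intros schwartz_continuous_on s2)
    then have "G 0 = 0" using Im0 by (simp add: complex_eq_iff)
    then have "(\<integral>x. exp (- (norm (x::'a))\<^sup>2) \<partial>lborel) = 0"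
      by (simp add: fourier_def G_def \<gamma>_def)
    moreover have "integrable lborel (\<lambda>x::'a. exp (- (norm x)\<^sup>2))"
      using integrable_Re[OF integrable_schwartz[OF gauss]] by simp
    ultimately have "exp (- (norm (0::'a))\<^sup>2) = 0"
      by (intro integral_nonneg_continuous_eq_0[where f="\<lambda>x::'a. exp (- (norm x)\<^sup>2)"])
       (auto intro!: continuous_intros)
    then show False by simp
  qed
qed

section \<open>Invariance of Lebesgue measure under orthogonal maps\<close>

lemma lborel_distr_orthogonal_cart:
  fixes T :: "real^'n::{finite,wellorder} \<Rightarrow> real^'n::_"
  assumes T: "orthogonal_transformation T"
  shows "distr lborel borel T = lborel"
proof (rule lborel_eqI[symmetric])
  fix l u :: "real^'n::_" assume le: "\<And>b. b \<in> Basis \<Longrightarrow> l \<bullet> b \<le> u \<bullet> b"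
  have [measurable]: "T \<in> borel_measurable borel"
    by (intro borel_measurable_continuous_onI linear_continuous_on)
      (simp add: T linear_conv_bounded_linear[symmetric] orthogonal_transformation_linear)
  have bij: "bij T" and inv: "orthogonal_transformation (inv T)"
    using T orthogonal_transformation_bij orthogonal_transformation_inv by blast+
  have eq: "T -` box l u = inv T ` box l u" by (rule bij_vimage_eq_inv_image[OF bij])
  have lm: "box l u \<in> lmeasurable" by simp
  have ms: "T -` box l u \<in> sets borel"
    using measurable_sets[of T borel borel "box l u"] by simp
  have "emeasure (distr lborel borel T) (box l u) = emeasure lborel (T -` box l u)"
    by (subst emeasure_distr) auto
  also have "\<dots> = emeasure lebesgue (T -` box l u)" using ms by simp
  also have "\<dots> = ennreal (measure lebesgue (inv T ` box l u))"
    unfolding eq by (rule emeasure_eq_measure2[OF measurable_orthogonal_image[OF inv lm]])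
  also have "\<dots> = ennreal (measure lebesgue (box l u))"
    by (simp add: measure_orthogonal_image[OF inv lm])
  also have "\<dots> = (\<Prod>b\<in>Basis. (u - l) \<bullet> b)"
    using le by (simp add: measure_lborel_box_eq inner_diff_left)
  finally show "emeasure (distr lborel borel T) (box l u) = (\<Prod>b\<in>Basis. (u - l) \<bullet> b)" .
qed simp

text \<open>An isometry taking the standard basis to the standard basis. Boxes therefore correspond
  to boxes of equal volume, and measure invariance passes from \<open>real^4\<close> to
  \<open>complex^2\<close> by conjugation.\<close>

definition to_complex :: "real^4 \<Rightarrow> complex^2" where
  "to_complex x = (\<chi> i. if i = 1 then Complex (x $ 1) (x $ 2) else Complex (x $ 3) (x $ 4))"

definition of_complex :: "complex^2 \<Rightarrow> real^4" where
  "of_complex z = (\<chi> p. if p = 1 then Re (z $ 1) else if p = 2 then Im (z $ 1)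
     else if p = 3 then Re (z $ 2) else Im (z $ 2))"

lemma to_of_complex [simp]: "to_complex (of_complex z) = z" "of_complex (to_complex x) = x"
  by (simp_all add: to_complex_def of_complex_def vec_eq_iff forall_2 forall_4)

lemma inner_of_complex: "of_complex z \<bullet> of_complex w = z \<bullet> w"
  by (simp add: inner_vec_def sum_2 sum_4 of_complex_def inner_complex_def)

lemma inner_to_complex: "to_complex x \<bullet> to_complex y = x \<bullet> y"
  using inner_of_complex[of "to_complex x" "to_complex y"] by simp

lemma linear_of_complex: "linear of_complex" and linear_to_complex: "linear to_complex"
  by (auto intro!: linearI simp: of_complex_def to_complex_def vec_eq_iff complex_eq_iff)

lemma Basis_complex2: "(Basis :: (complex^2) set) = {axis 1 1, axis 1 \<i>, axis 2 1, axis 2 \<i>}"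
  by (auto simp: Basis_vec_def Basis_complex_def UNIV_2)

lemma of_complex_Basis: "of_complex ` Basis = Basis"
proof -
  have "(Basis :: (real^4) set) = {axis 1 1, axis 2 1, axis 3 1, axis 4 1}"
    by (auto simp: Basis_vec_def UNIV_4)
  moreover have "of_complex (axis 1 1) = axis 1 1" "of_complex (axis 1 \<i>) = axis 2 1"
    "of_complex (axis 2 1) = axis 3 1" "of_complex (axis 2 \<i>) = axis 4 1"
    by (simp_all add: of_complex_def axis_def vec_eq_iff forall_4)
  ultimately show ?thesis unfolding Basis_complex2 by simp
qed

lemma lborel_distr_to_complex: "distr lborel borel to_complex = lborel"
proof (rule lborel_eqI[symmetric])
  fix l u :: "complex^2" assume le: "\<And>b. b \<in> Basis \<Longrightarrow> l \<bullet> b \<le> u \<bullet> b"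
  have [measurable]: "to_complex \<in> borel_measurable borel"
    by (intro borel_measurable_continuous_onI linear_continuous_on)
      (simp add: linear_conv_bounded_linear[symmetric] linear_to_complex)
  have in_eq: "to_complex x \<bullet> b = x \<bullet> of_complex b" for x b
    using inner_to_complex[of x "of_complex b"] by simp
  have "to_complex -` box l u = box (of_complex l) (of_complex u)"
    unfolding box_def of_complex_Basis[symmetric] by (auto simp: in_eq inner_of_complex)
  then have "emeasure (distr lborel borel to_complex) (box l u) = emeasure lborel (box (of_complex l) (of_complex u))"
    by (subst emeasure_distr) auto
  also have "\<dots> = (\<Prod>b\<in>Basis. (of_complex u - of_complex l) \<bullet> b)"
  proof (rule emeasure_lborel_box)
    fix b :: "real^4" assume "b \<in> Basis"
    then show "of_complex l \<bullet> b \<le> of_complex u \<bullet> b"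
      using le unfolding of_complex_Basis[symmetric] by (auto simp: inner_of_complex)
  qed
  also have "(\<Prod>b\<in>Basis. (of_complex u - of_complex l) \<bullet> b) = (\<Prod>b\<in>Basis. (u - l) \<bullet> b)"
  proof -
    have "inj_on of_complex Basis" by (metis inj_onI to_of_complex(1))
    then show ?thesis unfolding of_complex_Basis[symmetric]
      by (simp add: prod.reindex inner_diff_left inner_of_complex)
  qed
  finally show "emeasure (distr lborel borel to_complex) (box l u) = (\<Prod>b\<in>Basis. (u - l) \<bullet> b)" .
qed simp

lemma lborel_distr_orthogonal:
  fixes T :: "complex^2 \<Rightarrow> complex^2"
  assumes T: "orthogonal_transformation T"
  shows "distr lborel borel T = lborel"
proof -
  let ?S = "of_complex \<circ> T \<circ> to_complex"
  have S: "orthogonal_transformation ?S"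
    using T by (auto simp: orthogonal_transformation_def inner_of_complex inner_to_complex
        intro!: linear_compose linear_of_complex linear_to_complex)
  have [measurable]: "to_complex \<in> borel_measurable borel" "?S \<in> borel_measurable borel" "T \<in> borel_measurable borel"
    using T S by (auto intro!: borel_measurable_continuous_onI linear_continuous_on
      simp: linear_conv_bounded_linear[symmetric] linear_to_complex orthogonal_transformation_linear)
  have "distr lborel borel T = distr (distr lborel borel to_complex) borel T"
    by (simp add: lborel_distr_to_complex)
  also have "\<dots> = distr lborel borel (T \<circ> to_complex)" by (simp add: distr_distr)
  also have "T \<circ> to_complex = to_complex \<circ> ?S" by (auto simp: o_def)
  also have "distr lborel borel (to_complex \<circ> ?S) = distr (distr lborel borel ?S) borel to_complex"
    by (simp add: distr_distr del: comp_apply)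
  also have "\<dots> = lborel" by (simp add: lborel_distr_orthogonal_cart[OF S] lborel_distr_to_complex del: comp_apply)
  finally show ?thesis .
qed

lemma fourier_orthogonal:
  fixes T :: "complex^2 \<Rightarrow> complex^2"
  assumes T: "orthogonal_transformation T" and [measurable]: "f \<in> borel_measurable borel"
  shows "fourier f (T \<xi>) = fourier (\<lambda>x. f (T x)) \<xi>"
proof -
  have [measurable]: "T \<in> borel_measurable borel"
    using T by (auto intro!: borel_measurable_continuous_onI linear_continuous_on
      simp: linear_conv_bounded_linear[symmetric] orthogonal_transformation_linear)
  have "fourier f (T \<xi>) = (\<integral>x. f x * cis (- (x \<bullet> T \<xi>)) \<partial>distr lborel borel T)"
    by (simp add: fourier_def lborel_distr_orthogonal[OF T])
  also have "\<dots> = (\<integral>x. f (T x) * cis (- (T x \<bullet> T \<xi>)) \<partial>lborel)"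
    by (subst integral_distr) auto
  finally show ?thesis using T by (simp add: fourier_def orthogonal_transformation_def)
qed

subsection \<open>Smooth rapidly decreasing functions on the half-line\<close>

text \<open>A Schwartz function on the closed half-line, presented with all its derivatives. Having
  them as data, one-sided at 0, makes differentiation a shift of the index and lets quotients be
  specified derivative by derivative.\<close>

definition tower :: "(nat \<Rightarrow> real \<Rightarrow> complex) \<Rightarrow> bool" where
  "tower g \<longleftrightarrow> (\<forall>m. \<forall>s\<ge>0. (g m has_vector_derivative g (Suc m) s) (at s within {0..})) \<and>
     (\<forall>m p. \<exists>C. \<forall>s\<ge>0. s ^ p * norm (g m s) \<le> C)"

lemma tower_deriv:
  "tower g \<Longrightarrow> s \<ge> 0 \<Longrightarrow> (g m has_vector_derivative g (Suc m) s) (at s within {0..})"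
  by (simp add: tower_def)

lemma tower_bound:
  assumes "tower g" obtains C where "\<And>s. s \<ge> 0 \<Longrightarrow> s ^ p * norm (g m s) \<le> C"
  using assms unfolding tower_def by blast

lemma tower_shift: "tower g \<Longrightarrow> tower (\<lambda>m. g (Suc m))"
  by (simp add: tower_def)

lemma tower_cmult: assumes "tower g" shows "tower (\<lambda>m s. c * g m s)"
  unfolding tower_def
proof (intro conjI allI impI)
  show "((\<lambda>s. c * g m s) has_vector_derivative c * g (Suc m) s) (at s within {0..})" if "s \<ge> 0" for m s
    using tower_deriv[OF assms that] by (intro has_vector_derivative_mult_right)
  fix m p
  obtain C where C: "\<And>s. s \<ge> 0 \<Longrightarrow> s ^ p * norm (g m s) \<le> C" using tower_bound[OF assms] by blast
  have "s ^ p * norm (c * g m s) \<le> norm c * C" if "s \<ge> 0" for s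
    using mult_left_mono[OF C[OF that], of "norm c"] by (simp add: norm_mult mult_ac)
  then show "\<exists>C. \<forall>s\<ge>0. s ^ p * norm (c * g m s) \<le> C" by blast
qed

lemma tower_continuous: assumes "tower g" shows "continuous_on {0..} (g m)"
  using tower_deriv[OF assms] has_vector_derivative_continuous
  by (fastforce simp: continuous_on_eq_continuous_within)

lemma tower_chain:
  assumes "tower g" "S \<subseteq> {0..}" "s \<ge> 0" "t \<in> S"
  shows "((\<lambda>t. g m (t * s)) has_vector_derivative s *\<^sub>R g (Suc m) (t * s)) (at t within S)"
proof -
  have "(g m has_vector_derivative g (Suc m) (t * s)) (at (t * s) within {0..})"
    using assms by (intro tower_deriv) auto
  then have "(g m has_vector_derivative g (Suc m) (t * s)) (at (t * s) within (\<lambda>t. t * s) ` S)"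
    by (rule has_vector_derivative_within_subset) (use assms in auto)
  moreover have "((\<lambda>t. t * s) has_vector_derivative s) (at t within S)"
    by (auto intro!: derivative_eq_intros simp flip: has_real_derivative_iff_has_vector_derivative)
  ultimately show ?thesis using vector_diff_chain_within by (fastforce simp: o_def)
qed

text \<open>The derivatives of \<open>g 0 s / s\<close>, as \<open>g 0 s = s \<integral>\<^sub>0\<^sup>1 g' (t s) dt\<close> when \<open>g 0 0 = 0\<close>.\<close>

definition tdiv :: "(nat \<Rightarrow> real \<Rightarrow> complex) \<Rightarrow> nat \<Rightarrow> real \<Rightarrow> complex" where
  "tdiv g m s = integral {0..1} (\<lambda>t. of_real t ^ m * g (Suc m) (t * s))"

lemma tdiv_integrable:
  assumes "tower g" "s \<ge> 0"
  shows "(\<lambda>t. of_real t ^ m * g k (t * s)) integrable_on {0..1::real}"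
  by (intro integrable_continuous_interval continuous_intros
      continuous_on_compose2[OF tower_continuous[OF assms(1)]]) (use assms in auto)

lemma tdiv_deriv:
  assumes g: "tower g" and s: "s \<ge> 0"
  shows "(tdiv g m has_vector_derivative tdiv g (Suc m) s) (at s within {0..})"
proof -
  have "((\<lambda>s. integral (cbox 0 1) (\<lambda>t. of_real t ^ m * g (Suc m) (t * s))) has_vector_derivative
      integral (cbox 0 1) (\<lambda>t. of_real t ^ Suc m * g (Suc (Suc m)) (t * s))) (at s within {0..})"
  proof (rule leibniz_rule_vector_derivative)
    fix x t :: real assume x: "x \<in> {0..}" and t: "t \<in> cbox 0 1"
    have "((\<lambda>x. g (Suc m) (x * t)) has_vector_derivative t *\<^sub>R g (Suc (Suc m)) (x * t)) (at x within {0..})"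
      using x t by (intro tower_chain[OF g]) auto
    from has_vector_derivative_mult_right[OF this, of "of_real t ^ m"]
    show "((\<lambda>s. of_real t ^ m * g (Suc m) (t * s)) has_vector_derivative
        of_real t ^ Suc m * g (Suc (Suc m)) (t * x)) (at x within {0..})"
      by (simp add: scaleR_conv_of_real mult_ac)
  next
    show "(\<lambda>t. of_real t ^ m * g (Suc m) (t * x)) integrable_on cbox 0 (1::real)" if "x \<in> {0..}" for x
      using tdiv_integrable[OF g] that by simp
    show "continuous_on ({0..} \<times> cbox 0 1) (\<lambda>(x, t). of_real t ^ Suc m * g (Suc (Suc m)) (t * x))"
      unfolding case_prod_beta
      by (intro continuous_intros continuous_on_compose2[OF tower_continuous[OF g]]) auto
  qed (use s in auto)
  then show ?thesis by (simp add: tdiv_def[abs_def])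
qed

text \<open>This is s q(s) = g(s) - g(0) differentiated m + 1 times, obtained by integrating the
  t-derivative of t^(m+1) g^(m+1)(t s) over [0, 1]. At s = 0 it gives the Taylor coefficients of the
  quotient, and for large s its decay.\<close>

lemma tdiv_identity:
  assumes g: "tower g" and s: "s \<ge> 0"
  shows "of_real s * tdiv g (Suc m) s + of_nat (Suc m) * tdiv g m s = g (Suc m) s"
proof -
  let ?F = "\<lambda>t. of_real t ^ Suc m * g (Suc m) (t * s)"
  let ?f = "\<lambda>t. of_real s * (of_real t ^ Suc m * g (Suc (Suc m)) (t * s)) +
      of_nat (Suc m) * (of_real t ^ m * g (Suc m) (t * s))"
  have "(?f has_integral ?F 1 - ?F 0) {0..1}"
  proof (rule fundamental_theorem_of_calculus)
    fix t :: real assume t: "t \<in> {0..1}"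
    have d: "((\<lambda>t. g (Suc m) (t * s)) has_vector_derivative s *\<^sub>R g (Suc (Suc m)) (t * s)) (at t within {0..1})"
      using s t by (intro tower_chain[OF g]) auto
    have "((\<lambda>t. complex_of_real (t ^ Suc m)) has_vector_derivative complex_of_real (real (Suc m) * t ^ m)) (at t within {0..1})"
      using DERIV_pow[of "Suc m" t "{0..1}"] by (intro has_vector_derivative_of_real) simp
    from has_vector_derivative_mult[OF this d]
    show "(?F has_vector_derivative ?f t) (at t within {0..1})"
      by (simp add: o_def scaleR_conv_of_real algebra_simps)
  qed simp
  then have "integral {0..1} ?f = g (Suc m) s" by (simp add: integral_unique)
  moreover have "integral {0..1} ?f = of_real s * tdiv g (Suc m) s + of_nat (Suc m) * tdiv g m s"
    unfolding tdiv_def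
    by (subst Henstock_Kurzweil_Integration.integral_add)
      (auto intro!: integrable_on_mult_right tdiv_integrable[OF g s] simp del: power_Suc of_nat_Suc)
  ultimately show ?thesis by simp
qed

lemma tdiv_at_0: assumes "tower g" shows "tdiv g m 0 = g (Suc m) 0 / of_nat (Suc m)"
  using tdiv_identity[OF assms, of 0 m] by (simp add: field_simps del: of_nat_Suc)

lemma tdiv_0:
  assumes g: "tower g" and s: "s \<ge> 0"
  shows "of_real s * tdiv g 0 s = g 0 s - g 0 0"
proof -
  have "((\<lambda>t. of_real s * g (Suc 0) (t * s)) has_integral g 0 (1 * s) - g 0 (0 * s)) {0..1}"
  proof (rule fundamental_theorem_of_calculus)
    fix t :: real assume t: "t \<in> {0..1}"
    show "((\<lambda>t. g 0 (t * s)) has_vector_derivative of_real s * g (Suc 0) (t * s)) (at t within {0..1})"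
      using tower_chain[OF g, of "{0..1}" s t 0] s t by (simp add: scaleR_conv_of_real)
  qed simp
  then have "integral {0..1} (\<lambda>t. of_real s * g (Suc 0) (t * s)) = g 0 s - g 0 0"
    by (simp only: integral_unique mult_1_left mult_zero_left)
  then show ?thesis
    by (simp only: Henstock_Kurzweil_Integration.integral_mult_right tdiv_def) simp
qed

text \<open>On [0, 1] the bounds come from compactness. For s \<ge> 1 the top derivative in
  \<open>tdiv_identity\<close> is solved for, since dividing by s does no harm there. The induction
  starts from \<open>g 0 0 = 0\<close>: otherwise the quotient would decay only like 1 / s.\<close>

lemma tower_tdiv: assumes g: "tower g" and g0: "g 0 0 = 0" shows "tower (tdiv g)"
  unfolding tower_def
proof (intro conjI allI impI)
  show "(tdiv g m has_vector_derivative tdiv g (Suc m) s) (at s within {0..})" if "s \<ge> 0" for m s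
    by (rule tdiv_deriv[OF g that])
  have cont: "continuous_on {0..1} (\<lambda>s. s ^ p * norm (tdiv g m s))" for p m
  proof -
    have "continuous_on {0..} (tdiv g m)"
      using tdiv_deriv[OF g] has_vector_derivative_continuous
      by (fastforce simp: continuous_on_eq_continuous_within)
    then have "continuous_on {0..1} (tdiv g m)" by (rule continuous_on_subset) auto
    then show ?thesis by (intro continuous_intros)
  qed
  have small: "\<exists>C. \<forall>s\<in>{0..1}. s ^ p * norm (tdiv g m s) \<le> C" for p m
    using compact_imp_bounded[OF compact_continuous_image[OF cont[of p m] compact_Icc]]
    by (auto simp: bounded_iff)
  have large: "\<exists>C. \<forall>s\<ge>1. s ^ p * norm (tdiv g m s) \<le> C" for p m
  proof (induction m)
    case 0
    obtain C where C: "\<And>s. s \<ge> 0 \<Longrightarrow> s ^ p * norm (g 0 s) \<le> C" using tower_bound[OF g] by blast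
    have "s ^ p * norm (tdiv g 0 s) \<le> C" if "s \<ge> 1" for s
    proof -
      have "norm (tdiv g 0 s) * 1 \<le> norm (tdiv g 0 s) * s" using that by (intro mult_left_mono) auto
      also have "\<dots> = norm (g 0 s)"
        using arg_cong[OF tdiv_0[OF g, of s], of norm] that g0 by (simp add: norm_mult mult.commute)
      finally have "s ^ p * norm (tdiv g 0 s) \<le> s ^ p * norm (g 0 s)"
        using that by (intro mult_left_mono) auto
      with C[of s] that show ?thesis by linarith
    qed
    then show ?case by blast
  next
    case (Suc m)
    then obtain D where D: "\<And>s. s \<ge> 1 \<Longrightarrow> s ^ p * norm (tdiv g m s) \<le> D" by blast
    obtain C where C: "\<And>s. s \<ge> 0 \<Longrightarrow> s ^ p * norm (g (Suc m) s) \<le> C" using tower_bound[OF g] by blast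
    have "s ^ p * norm (tdiv g (Suc m) s) \<le> C + real (Suc m) * D" if "s \<ge> 1" for s
    proof -
      have "norm (tdiv g (Suc m) s) * 1 \<le> norm (tdiv g (Suc m) s) * s" using that by (intro mult_left_mono) auto
      also have "\<dots> = norm (of_real s * tdiv g (Suc m) s)" using that by (simp add: norm_mult)
      also have "of_real s * tdiv g (Suc m) s = g (Suc m) s - of_nat (Suc m) * tdiv g m s"
        using tdiv_identity[OF g, of s m] that by (simp add: algebra_simps)
      also have "norm \<dots> \<le> norm (g (Suc m) s) + real (Suc m) * norm (tdiv g m s)"
        using norm_triangle_ineq4[of "g (Suc m) s" "of_nat (Suc m) * tdiv g m s"]
        by (simp only: norm_mult norm_of_nat)
      finally have "s ^ p * norm (tdiv g (Suc m) s) \<le> s ^ p * (norm (g (Suc m) s) + real (Suc m) * norm (tdiv g m s))"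
        using that by (intro mult_left_mono) auto
      also have "\<dots> = s ^ p * norm (g (Suc m) s) + real (Suc m) * (s ^ p * norm (tdiv g m s))"
        by (simp add: algebra_simps)
      also have "\<dots> \<le> C + real (Suc m) * D"
        using that by (intro add_mono mult_left_mono C D) auto
      finally show ?thesis .
    qed
    then show ?case by blast
  qed
  fix m p
  obtain C where C: "\<And>s. s \<in> {0..1} \<Longrightarrow> s ^ p * norm (tdiv g m s) \<le> C" using small by blast
  obtain D where D: "\<And>s. s \<ge> 1 \<Longrightarrow> s ^ p * norm (tdiv g m s) \<le> D" using large by blast
  have "s ^ p * norm (tdiv g m s) \<le> max C D" if "s \<ge> 0" for s
    using C[of s] D[of s] that by (cases "s \<le> 1") (auto simp: le_max_iff_disj)
  then show "\<exists>C. \<forall>s\<ge>0. s ^ p * norm (tdiv g m s) \<le> C" by blast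
qed

text \<open>The last conclusion says that division by s^N shifts Taylor coefficients by N. It
  carries the vanishing of odd derivatives over to the quotient when N is even.\<close>

lemma tower_tdiv_power:
  assumes g: "tower g" and z: "\<And>l. l < N \<Longrightarrow> g l 0 = 0"
  obtains h where "tower h" "\<And>s. s \<ge> 0 \<Longrightarrow> g 0 s = of_real s ^ N * h 0 s"
    "\<And>l. g (l + N) 0 = 0 \<Longrightarrow> h l 0 = 0"
proof -
  have "\<exists>h. tower h \<and> (\<forall>s\<ge>0. g 0 s = of_real s ^ N * h 0 s) \<and> (\<forall>l. g (l + N) 0 = 0 \<longrightarrow> h l 0 = 0)"
    using z
  proof (induction N)
    case 0
    then show ?case using g by auto
  next
    case (Suc N)
    then obtain h where h: "tower h" "\<And>s. s \<ge> 0 \<Longrightarrow> g 0 s = of_real s ^ N * h 0 s"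
      "\<And>l. g (l + N) 0 = 0 \<Longrightarrow> h l 0 = 0" by (metis less_SucI)
    have h0: "h 0 0 = 0" using h(3)[of 0] Suc.prems[of N] by simp
    have "tower (tdiv h)" by (rule tower_tdiv[OF h(1) h0])
    moreover have "g 0 s = of_real s ^ Suc N * tdiv h 0 s" if "s \<ge> 0" for s
      using tdiv_0[OF h(1) that] h(2)[OF that] h0 by (simp add: mult_ac)
    moreover have "tdiv h l 0 = 0" if "g (l + Suc N) 0 = 0" for l
      using h(3)[of "Suc l"] that by (simp add: tdiv_at_0[OF h(1)])
    ultimately show ?case by blast
  qed
  then show thesis using that by blast
qed

section \<open>Even functions and substitution of the square root\<close>

definition even_tower :: "(nat \<Rightarrow> real \<Rightarrow> complex) \<Rightarrow> bool" where
  "even_tower g \<longleftrightarrow> tower g \<and> (\<forall>l. odd l \<longrightarrow> g l 0 = 0)"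

definition half_quot :: "(nat \<Rightarrow> real \<Rightarrow> complex) \<Rightarrow> nat \<Rightarrow> real \<Rightarrow> complex" where
  "half_quot g m s = 1 / 2 * tdiv (\<lambda>m. g (Suc m)) m s"

text \<open>For even \<phi> the derivative is odd and \<phi>'(r) / r is even again. Evenness is
  expressed by Taylor coefficients at 0, and the l-th one of the quotient is a multiple of the (l +
  2)-nd one of \<open>g\<close>, so parity is kept.\<close>

lemma even_tower_half_quot: assumes "even_tower g" shows "even_tower (half_quot g)"
proof -
  have g: "tower (\<lambda>m. g (Suc m))" and 0: "\<And>l. odd l \<Longrightarrow> g l 0 = 0"
    using assms tower_shift by (auto simp: even_tower_def)
  show ?thesis unfolding even_tower_def
  proof (intro conjI allI impI)
    show "tower (half_quot g)"
      using tower_cmult[OF tower_tdiv[OF g], of "1/2"] 0[of 1] by (simp add: half_quot_def[abs_def])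
    show "half_quot g l 0 = 0" if "odd l" for l
      using 0[of "Suc (Suc l)"] that by (simp add: half_quot_def tdiv_at_0[OF g])
  qed
qed

lemma half_quot_0:
  assumes "even_tower g" "s \<ge> 0" shows "of_real (2 * s) * half_quot g 0 s = g 1 s"
  using tdiv_0[of "\<lambda>m. g (Suc m)" s] assms tower_shift by (simp add: half_quot_def even_tower_def)

text \<open>The fundamental theorem of calculus needs the derivative only in the interior, and the
  resulting integral formula is differentiable up to the endpoint. This bypasses the singularity of
  \<open>sqrt\<close> at 0.\<close>

lemma has_vector_derivative_from_interior:
  fixes H h :: "real \<Rightarrow> complex"
  assumes H: "continuous_on {0..} H" and h: "continuous_on {0..} h"
    and d: "\<And>s. s > 0 \<Longrightarrow> (H has_vector_derivative h s) (at s)" and s: "s \<ge> 0"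
  shows "(H has_vector_derivative h s) (at s within {0..})"
proof -
  have eq: "H u = H 0 + integral {0..u} h" if "u \<in> {0..s + 1}" for u
  proof -
    have "(h has_integral H u - H 0) {0..u}"
    proof (rule fundamental_theorem_of_calculus_interior)
      show "continuous_on {0..u} H" by (rule continuous_on_subset[OF H]) auto
    qed (use that d in auto)
    then show ?thesis by (simp add: integral_unique)
  qed
  have "continuous_on {0..s + 1} h" by (rule continuous_on_subset[OF h]) auto
  then have "((\<lambda>u. integral {0..u} h) has_vector_derivative h s) (at s within {0..s + 1})"
    by (rule integral_has_vector_derivative) (use s in auto)
  from has_vector_derivative_add[OF has_vector_derivative_const this]
  have "((\<lambda>u. H 0 + integral {0..u} h) has_vector_derivative h s) (at s within {0..s + 1})" by simp
  then have "(H has_vector_derivative h s) (at s within {0..s + 1})"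
    by (rule has_vector_derivative_transform[rotated 2]) (use s in simp, rule eq)
  moreover have "at s within {0..} = at s within {0..s + 1}"
    by (rule at_within_nhd[of _ "{..<s + 1}"]) auto
  ultimately show ?thesis by simp
qed

text \<open>Whitney's theorem on even functions: the \<open>k\<close>-th derivative of \<open>s \<mapsto> g 0 (sqrt s)\<close> is
  obtained from \<open>g\<close> by applying \<open>\<phi> \<mapsto> \<phi>' / (2 r)\<close> \<open>k\<close> times and substituting \<open>sqrt s\<close>.\<close>

lemma tower_sqrt:
  assumes g: "even_tower g"
  shows "tower (\<lambda>k s. (half_quot ^^ k) g 0 (sqrt s))"
proof -
  have ev: "even_tower ((half_quot ^^ k) g)" for k
    by (induction k) (simp_all add: g even_tower_half_quot)
  then have tw: "tower ((half_quot ^^ k) g)" for k by (simp add: even_tower_def)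
  have cont: "continuous_on {0..} (\<lambda>s. (half_quot ^^ k) g 0 (sqrt s))" for k
    by (rule continuous_on_compose2[OF tower_continuous[OF tw] continuous_on_real_sqrt[OF continuous_on_id]]) auto
  show ?thesis unfolding tower_def
  proof (intro conjI allI impI)
    fix k and s :: real assume s: "s \<ge> 0"
    show "((\<lambda>s. (half_quot ^^ k) g 0 (sqrt s)) has_vector_derivative
        (half_quot ^^ Suc k) g 0 (sqrt s)) (at s within {0..})"
    proof (rule has_vector_derivative_from_interior[OF cont cont _ s])
      fix s :: real assume s: "s > 0"
      have "(((half_quot ^^ k) g 0 \<circ> sqrt) has_vector_derivative
          (inverse (sqrt s) / 2) *\<^sub>R (half_quot ^^ k) g (Suc 0) (sqrt s)) (at s within {0<..})"
      proof (rule vector_diff_chain_within)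
        show "(sqrt has_vector_derivative inverse (sqrt s) / 2) (at s within {0<..})"
          by (rule has_vector_derivative_at_within,
              rule DERIV_real_sqrt[OF s, unfolded has_real_derivative_iff_has_vector_derivative])
        have "((half_quot ^^ k) g 0 has_vector_derivative (half_quot ^^ k) g (Suc 0) (sqrt s)) (at (sqrt s) within {0..})"
          by (rule tower_deriv[OF tw]) (use s in auto)
        then show "((half_quot ^^ k) g 0 has_vector_derivative (half_quot ^^ k) g (Suc 0) (sqrt s)) (at (sqrt s) within sqrt ` {0<..})"
          by (rule has_vector_derivative_within_subset) auto
      qed
      moreover have "(inverse (sqrt s) / 2) *\<^sub>R (half_quot ^^ k) g (Suc 0) (sqrt s) = (half_quot ^^ Suc k) g 0 (sqrt s)"
      proof -
        have "(half_quot ^^ k) g (Suc 0) (sqrt s) = of_real (2 * sqrt s) * (half_quot ^^ Suc k) g 0 (sqrt s)"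
          using half_quot_0[OF ev[of k], of "sqrt s"] s by simp
        then show ?thesis using s by (simp add: scaleR_conv_of_real)
      qed
      moreover have "at s within {0<..} = at s" using s by (intro at_within_open) auto
      ultimately show "((\<lambda>s. (half_quot ^^ k) g 0 (sqrt s)) has_vector_derivative
          (half_quot ^^ Suc k) g 0 (sqrt s)) (at s)" by (simp only: o_def)
    qed
  next
    fix k p
    obtain C where C: "\<And>s. s \<ge> 0 \<Longrightarrow> s ^ (2 * p) * norm ((half_quot ^^ k) g 0 s) \<le> C"
      using tower_bound[OF tw] by blast
    have "s ^ p * norm ((half_quot ^^ k) g 0 (sqrt s)) \<le> C" if "s \<ge> 0" for s
      using C[of "sqrt s"] that by (simp add: power_mult)
    then show "\<exists>C. \<forall>s\<ge>0. s ^ p * norm ((half_quot ^^ k) g 0 (sqrt s)) \<le> C" by blast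
  qed
qed

section \<open>Radial Schwartz functions\<close>

lemma has_derivative_radial:
  fixes z :: "'a::euclidean_space"
  assumes "tower g"
  shows "((\<lambda>z. g 0 ((norm z)\<^sup>2)) has_derivative (\<lambda>h. (2 * (z \<bullet> h)) *\<^sub>R g 1 ((norm z)\<^sup>2))) (at z)"
proof -
  have "(g 0 has_derivative (\<lambda>h. h *\<^sub>R g 1 (z \<bullet> z))) (at (z \<bullet> z) within {0..})"
    using tower_deriv[OF assms, of "z \<bullet> z" 0] by (simp add: has_vector_derivative_def)
  \<comment> \<open>The squared norm only takes values in the half-line, so a one-sided derivative
    suffices for the chain rule, even at the origin.\<close>
  then have "(g 0 has_derivative (\<lambda>h. h *\<^sub>R g 1 (z \<bullet> z))) (at (z \<bullet> z) within range (\<lambda>z::'a. z \<bullet> z))"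
    by (rule has_derivative_subset) auto
  moreover have "((\<lambda>z. z \<bullet> z) has_derivative (\<lambda>h. 2 * (z \<bullet> h))) (at z)"
    by (auto intro!: derivative_eq_intros simp: inner_commute)
  ultimately show ?thesis
    using has_derivative_in_compose[of "\<lambda>z. z \<bullet> z" "\<lambda>h. 2 * (z \<bullet> h)" z UNIV "g 0"]
    by (simp add: power2_norm_eq_inner)
qed

text \<open>The derivative along \<open>b\<close> is 2 (z \<bullet> b) g'(|z|^2): a coordinate times
  a radial function of the shifted tower, so induction on the order applies.\<close>

lemma schwartz_radial:
  assumes "tower g" shows "schwartz (\<lambda>z::'a::euclidean_space. g 0 ((norm z)\<^sup>2))"
proof -
  have decay: "rapid_decay (\<lambda>z::'a. g 0 ((norm z)\<^sup>2))" if tw: "tower g" for g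
  proof (rule rapid_decayI)
    fix m
    obtain C where C: "\<And>s. s \<ge> 0 \<Longrightarrow> s ^ m * norm (g 0 s) \<le> C" using tower_bound[OF tw] by blast
    obtain D where D: "\<And>s. s \<ge> 0 \<Longrightarrow> s ^ 0 * norm (g 0 s) \<le> D" using tower_bound[OF tw] by blast
    have "norm z ^ m * norm (g 0 ((norm z)\<^sup>2)) \<le> C + D" for z :: 'a
    proof -
      have "norm z ^ m \<le> 1 + ((norm z)\<^sup>2) ^ m"
        using le_1_plus_square[of "norm z ^ m"] by (simp add: power2_eq_square power_mult_distrib)
      then have "norm z ^ m * norm (g 0 ((norm z)\<^sup>2)) \<le> (1 + ((norm z)\<^sup>2) ^ m) * norm (g 0 ((norm z)\<^sup>2))"
        by (intro mult_right_mono) auto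
      then show ?thesis using C[of "(norm z)\<^sup>2"] D[of "(norm z)\<^sup>2"] by (simp add: distrib_right)
    qed
    then show "\<exists>C. \<forall>z::'a. norm z ^ m * norm (g 0 ((norm z)\<^sup>2)) \<le> C" by blast
  qed
  have "\<forall>g. tower g \<longrightarrow> schwartz_upto k (\<lambda>z::'a. g 0 ((norm z)\<^sup>2))" for k
  proof (induction k)
    case (Suc k)
    show ?case
    proof (intro allI impI)
      fix g assume g: "tower g"
      have "partial_deriv b (\<lambda>z::'a. g 0 ((norm z)\<^sup>2)) =
          (\<lambda>z. 2 * (of_real (z \<bullet> b) * g (Suc 0) ((norm z)\<^sup>2)))" for b
        using partial_deriv_eqI[OF has_derivative_radial[OF g]]
        by (auto simp: scaleR_conv_of_real fun_eq_iff mult.assoc)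
      moreover have "schwartz_upto k (\<lambda>z::'a. g (Suc 0) ((norm z)\<^sup>2))"
        using Suc tower_shift[OF g] by blast
      moreover have "(\<lambda>z::'a. g 0 ((norm z)\<^sup>2)) differentiable_on UNIV"
        using has_derivative_radial[OF g] by (auto simp: differentiable_on_def differentiable_def)
      ultimately show "schwartz_upto (Suc k) (\<lambda>z::'a. g 0 ((norm z)\<^sup>2))"
        by (auto simp: decay[OF g] intro!: schwartz_upto_cmult schwartz_upto_coord)
    qed
  qed (simp add: decay)
  then show ?thesis using assms by (simp add: schwartz_iff_upto)
qed

lemma schwartz_gauss: "schwartz (\<lambda>x::'a::euclidean_space. complex_of_real (exp (- (norm x)\<^sup>2)))"
proof -
  have "tower (\<lambda>m s. complex_of_real ((-1) ^ m * exp (- s)))"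
    unfolding tower_def
  proof (intro conjI allI impI)
    fix m and s :: real
    show "((\<lambda>s. complex_of_real ((-1) ^ m * exp (- s))) has_vector_derivative
        complex_of_real ((-1) ^ Suc m * exp (- s))) (at s within {0..})"
      by (intro has_vector_derivative_of_real) (auto intro!: derivative_eq_intros)
  next
    fix m p
    have "s ^ p * norm (complex_of_real ((-1) ^ m * exp (- s))) \<le> real p ^ p" if s: "s \<ge> 0" for s
    proof (cases "p = 0")
      case False
      \<comment> \<open>From (1 + s / p)^p \<le> exp s one gets s^p exp (- s) \<le> p^p.\<close>
      have "(s / real p) ^ p \<le> (1 + s / real p) ^ p" using s by (intro power_mono) auto
      also have "\<dots> \<le> exp s" using False s by (intro exp_ge_one_plus_x_over_n_power_n) auto
      finally have "s ^ p \<le> real p ^ p * exp s" using False by (simp add: power_divide field_simps)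
      then have "s ^ p * exp (- s) \<le> real p ^ p" by (simp add: exp_minus field_simps)
      then show ?thesis by (simp only: norm_of_real abs_mult power_abs) simp
    qed (use s in \<open>simp add: norm_mult norm_power\<close>)
    then show "\<exists>C. \<forall>s\<ge>0. s ^ p * norm (complex_of_real ((-1) ^ m * exp (- s))) \<le> C" by blast
  qed
  from schwartz_radial[OF this] show ?thesis by simp
qed

subsection \<open>Interpolation\<close>

lemma Lagrange_basis:
  fixes x :: "nat \<Rightarrow> complex"
  assumes "inj_on x {..n}"
  obtains L where "\<And>i. i \<le> n \<Longrightarrow> degree (L i) \<le> n"
    "\<And>i j. i \<le> n \<Longrightarrow> j \<le> n \<Longrightarrow> poly (L i) (x j) = (if i = j then 1 else 0)"
proof
  define L where "L = (\<lambda>i. smult (inverse (\<Prod>j\<in>{..n} - {i}. x i - x j)) (\<Prod>j\<in>{..n} - {i}. [:- x j, 1:]))"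
  show "degree (L i) \<le> n" if "i \<le> n" for i
  proof -
    have "degree (\<Prod>j\<in>{..n} - {i}. [:- x j, 1:]) \<le> (\<Sum>j\<in>{..n} - {i}. degree [:- x j, 1:])"
      using degree_prod_sum_le[of "{..n} - {i}" "\<lambda>j. [:- x j, 1:]"] by (simp add: o_def)
    also have "\<dots> = n" using that by simp
    finally show ?thesis unfolding L_def using degree_smult_le order_trans by blast
  qed
  show "poly (L i) (x j) = (if i = j then 1 else 0)" if "i \<le> n" "j \<le> n" for i j
  proof (cases "i = j")
    case True
    have "(\<Prod>k\<in>{..n} - {i}. x i - x k) \<noteq> 0" using assms that(1) by (auto simp: inj_on_def)
    then show ?thesis using True by (simp add: L_def poly_prod)
  next
    case False
    then have "(\<Prod>k\<in>{..n} - {i}. x j - x k) = 0" using that by (intro prod_zero) auto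
    then show ?thesis using False by (simp add: L_def poly_prod)
  qed
qed

lemma poly_degree_le:
  fixes p :: "complex poly"
  assumes "degree p \<le> n" shows "poly p x = (\<Sum>i\<le>n. coeff p i * x ^ i)"
  unfolding poly_altdef using assms by (intro sum.mono_neutral_left) (auto simp: coeff_eq_0)

lemma interpolation:
  fixes x y :: "nat \<Rightarrow> complex"
  assumes "inj_on x {..n}"
  obtains c where "\<And>k. k \<le> n \<Longrightarrow> y k = (\<Sum>j\<le>n. c j * x k ^ j)"
proof -
  obtain L where L: "\<And>i. i \<le> n \<Longrightarrow> degree (L i) \<le> n"
    "\<And>i j. i \<le> n \<Longrightarrow> j \<le> n \<Longrightarrow> poly (L i) (x j) = (if i = j then 1 else 0)"
    using Lagrange_basis[OF assms] by blast
  let ?p = "\<Sum>i\<le>n. smult (y i) (L i)"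
  have deg: "degree ?p \<le> n"
    by (intro degree_sum_le) (auto intro: order_trans[OF degree_smult_le] L)
  have "y k = (\<Sum>j\<le>n. coeff ?p j * x k ^ j)" if "k \<le> n" for k
    using that by (subst poly_degree_le[OF deg, symmetric]) (simp add: poly_sum L(2) if_distrib cong: if_cong)
  then show thesis by (rule that)
qed

text \<open>Coefficients are fixed linear combinations of values at the nodes 0, ..., n. Since the
  Schwartz condition on operators only concerns values \<open>F z p w\<close>, this is how it
  reaches the coefficients.\<close>

lemma coefficient_weights:
  obtains lam x where "\<And>k c. k \<le> n \<Longrightarrow> (\<Sum>i\<le>n. lam k i * (\<Sum>j\<le>n. c j * (x i :: complex) ^ j)) = c k"
proof -
  let ?x = "\<lambda>i::nat. of_nat i :: complex"
  have inj: "inj_on ?x {..n}" by (auto simp: inj_on_def)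
  obtain L where L: "\<And>i. i \<le> n \<Longrightarrow> degree (L i) \<le> n"
    "\<And>i j. i \<le> n \<Longrightarrow> j \<le> n \<Longrightarrow> poly (L i) (?x j) = (if i = j then 1 else 0)"
    using Lagrange_basis[OF inj] by blast
  have "(\<Sum>i\<le>n. coeff (L i) k * (\<Sum>j\<le>n. c j * ?x i ^ j)) = c k" if "k \<le> n" for k and c :: "nat \<Rightarrow> complex"
  proof -
    define p where "p = (\<Sum>j\<le>n. monom (c j) j)"
    have dp: "degree p \<le> n" unfolding p_def
      by (intro degree_sum_le) (auto intro: order_trans[OF degree_monom_le])
    have cp: "coeff p j = c j" if "j \<le> n" for j
      using that by (simp add: p_def coeff_sum)
    have pe: "poly p y = (\<Sum>j\<le>n. c j * y ^ j)" for y
      by (simp add: p_def poly_sum poly_monom)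
    let ?q = "\<Sum>i\<le>n. smult (poly p (?x i)) (L i)"
    have "p = ?q"
    proof (rule poly_eqI_degree)
      show "poly p y = poly ?q y" if "y \<in> ?x ` {..n}" for y
        using that by (auto simp: poly_sum L(2) if_distrib cong: if_cong)
      have "degree ?q \<le> n"
        by (intro degree_sum_le) (auto intro: order_trans[OF degree_smult_le] L)
      then show "degree p < card (?x ` {..n})" "degree ?q < card (?x ` {..n})"
        using dp by (auto simp: card_image[OF inj])
    qed
    then have "c k = coeff ?q k" using cp that by metis
    then show ?thesis by (simp add: coeff_sum pe mult.commute)
  qed
  then show thesis by (rule that)
qed

subsection \<open>Homogeneous polynomials\<close>

definition bimon :: "nat \<Rightarrow> nat \<Rightarrow> complex^2 \<Rightarrow> complex" where
  "bimon n k w = (w $ 1) ^ k * (w $ 2) ^ (n - k)"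

lemma V_iff: "p \<in> V n \<longleftrightarrow> (\<exists>c. p = (\<lambda>w. \<Sum>k\<le>n. c k * bimon n k w))"
  by (simp add: V_def bimon_def mult.assoc)

lemma V_I: "(\<lambda>w. \<Sum>k\<le>n. c k * bimon n k w) \<in> V n"
  using V_iff by blast

text \<open>A choice is harmless on \<open>V n\<close>, where an expansion exists and is unique by
  \<open>coef_weights\<close>.\<close>

definition coef :: "nat \<Rightarrow> (complex^2 \<Rightarrow> complex) \<Rightarrow> nat \<Rightarrow> complex" where
  "coef n p = (SOME c. p = (\<lambda>w. \<Sum>k\<le>n. c k * bimon n k w))"

lemma V_coef: assumes "p \<in> V n" shows "p = (\<lambda>w. \<Sum>k\<le>n. coef n p k * bimon n k w)"
proof -
  have "\<exists>c. p = (\<lambda>w. \<Sum>k\<le>n. c k * bimon n k w)" using assms by (simp only: V_iff)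
  then show ?thesis unfolding coef_def by (rule someI_ex)
qed

lemma V_coef_apply: "p \<in> V n \<Longrightarrow> p w = (\<Sum>k\<le>n. coef n p k * bimon n k w)"
  using V_coef by (rule fun_cong)

text \<open>At the points (x, 1) a homogeneous polynomial becomes a polynomial in x with the same
  coefficients.\<close>

lemma coef_weights:
  obtains lam pt where
    "\<And>p k. p \<in> V n \<Longrightarrow> k \<le> n \<Longrightarrow> coef n p k = (\<Sum>i\<le>n. lam k i * p (pt i))"
    "\<And>k c. k \<le> n \<Longrightarrow> coef n (\<lambda>w. \<Sum>j\<le>n. c j * bimon n j w) k = c k"
proof -
  obtain lam x where lx: "\<And>k c. k \<le> n \<Longrightarrow> (\<Sum>i\<le>n. lam k i * (\<Sum>j\<le>n. c j * (x i :: complex) ^ j)) = c k"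
    using coefficient_weights[of n] by blast
  define pt :: "nat \<Rightarrow> complex^2" where "pt = (\<lambda>i. vector [x i, 1])"
  have 1: "coef n p k = (\<Sum>i\<le>n. lam k i * p (pt i))" if "p \<in> V n" "k \<le> n" for p k
  proof -
    have "(\<Sum>i\<le>n. lam k i * p (pt i)) = (\<Sum>i\<le>n. lam k i * (\<Sum>j\<le>n. coef n p j * x i ^ j))"
      by (subst V_coef_apply[OF that(1)]) (simp add: bimon_def pt_def)
    then show ?thesis using lx[OF that(2)] by simp
  qed
  have 2: "coef n (\<lambda>w. \<Sum>j\<le>n. c j * bimon n j w) k = c k" if "k \<le> n" for k c
  proof -
    have "(\<lambda>w. \<Sum>j\<le>n. c j * bimon n j w) \<in> V n" using V_iff by blast
    from 1[OF this that] show ?thesis using lx[OF that, of c] by (simp add: bimon_def pt_def)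
  qed
  show thesis by (rule that[OF 1 2])
qed

lemma coef_sum_mono: "k \<le> n \<Longrightarrow> coef n (\<lambda>w. \<Sum>j\<le>n. c j * bimon n j w) k = c k"
  using coef_weights[of n] by metis

lemma V_add: assumes "p \<in> V n" "q \<in> V n" shows "(\<lambda>w. p w + q w) \<in> V n"
proof -
  have "(\<lambda>w. p w + q w) = (\<lambda>w. \<Sum>k\<le>n. (coef n p k + coef n q k) * bimon n k w)"
    using V_coef_apply[OF assms(1)] V_coef_apply[OF assms(2)] by (simp add: distrib_right sum.distrib)
  then show ?thesis by (simp only: V_I)
qed

lemma V_cmult: assumes "p \<in> V n" shows "(\<lambda>w. a * p w) \<in> V n"
proof -
  have "(\<lambda>w. a * p w) = (\<lambda>w. \<Sum>k\<le>n. (a * coef n p k) * bimon n k w)"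
    using V_coef_apply[OF assms(1)] by (simp add: sum_distrib_left mult.assoc)
  then show ?thesis by (simp only: V_I)
qed

lemma V_mono: assumes "k \<le> n" shows "bimon n k \<in> V n"
proof -
  have "bimon n k = (\<lambda>w. \<Sum>j\<le>n. (if j = k then 1 else 0) * bimon n j w)"
    using assms by (simp add: if_distrib[of "\<lambda>c. c * _"] cong: if_cong)
  then show ?thesis by (simp only: V_I)
qed

lemma V_zero: "(\<lambda>w. 0) \<in> V n"
  using V_cmult[OF V_mono[of 0 n], of 0] by simp

lemma V_sum: "(\<And>i. i \<in> I \<Longrightarrow> p i \<in> V n) \<Longrightarrow> (\<lambda>w. \<Sum>i\<in>I. p i w) \<in> V n"
  by (induction I rule: infinite_finite_induct) (auto simp: V_zero V_add)

lemma coef_linear: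
  assumes "finite I" "\<And>i. i \<in> I \<Longrightarrow> p i \<in> V n" "k \<le> n"
  shows "coef n (\<lambda>w. \<Sum>i\<in>I. a i * p i w) k = (\<Sum>i\<in>I. a i * coef n (p i) k)"
proof -
  have "(\<lambda>w. \<Sum>i\<in>I. a i * p i w) = (\<lambda>w. \<Sum>j\<le>n. (\<Sum>i\<in>I. a i * coef n (p i) j) * bimon n j w)"
  proof
    fix w
    have "(\<Sum>i\<in>I. a i * p i w) = (\<Sum>i\<in>I. a i * (\<Sum>j\<le>n. coef n (p i) j * bimon n j w))"
      using V_coef_apply[OF assms(2)] by simp
    also have "\<dots> = (\<Sum>j\<le>n. (\<Sum>i\<in>I. a i * coef n (p i) j) * bimon n j w)"
      unfolding sum_distrib_left sum_distrib_right by (subst sum.swap) (simp add: mult.assoc)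
    finally show "(\<Sum>i\<in>I. a i * p i w) = (\<Sum>j\<le>n. (\<Sum>i\<in>I. a i * coef n (p i) j) * bimon n j w)" .
  qed
  then show ?thesis by (simp only: coef_sum_mono[OF assms(3)])
qed

text \<open>The derivative of \<open>bimon n k\<close> at \<open>w\<close> in the direction
  \<open>v\<close>. Where an exponent is truncated at 0, its factor vanishes.\<close>

definition bimon_deriv :: "nat \<Rightarrow> nat \<Rightarrow> complex^2 \<Rightarrow> complex^2 \<Rightarrow> complex" where
  "bimon_deriv n k w v = of_nat k * (w $ 1) ^ (k - 1) * v $ 1 * (w $ 2) ^ (n - k)
     + of_nat (n - k) * (w $ 1) ^ k * (w $ 2) ^ (n - k - 1) * v $ 2"

lemma has_vector_derivative_mono_curve:
  assumes "(u1 has_vector_derivative v1) (at t)" "(u2 has_vector_derivative v2) (at t)"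
  shows "((\<lambda>t. (u1 t :: complex) ^ k * u2 t ^ m) has_vector_derivative
    of_nat k * u1 t ^ (k - 1) * v1 * u2 t ^ m + of_nat m * u1 t ^ k * u2 t ^ (m - 1) * v2) (at t)"
proof -
  have pow: "((\<lambda>t. (u t :: complex) ^ k) has_vector_derivative of_nat k * u t ^ (k - 1) * v) (at t)"
    if "(u has_vector_derivative v) (at t)" for u v k
  proof -
    have "((\<lambda>x. x ^ k) has_field_derivative of_nat k * u t ^ (k - 1)) (at (u t))"
      by (auto intro!: derivative_eq_intros)
    from field_vector_diff_chain_at[OF that this] show ?thesis by (simp add: o_def mult.commute)
  qed
  from has_vector_derivative_mult[OF pow[OF assms(1), of k] pow[OF assms(2), of m]]
  show ?thesis by (simp add: algebra_simps)
qed

subsection \<open>The derived representation\<close>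

lemma matrix_scaleR_mult: "(a *\<^sub>R A) ** B = a *\<^sub>R (A ** (B :: complex^2^2))"
  "A ** (a *\<^sub>R B) = a *\<^sub>R (A ** (B :: complex^2^2))"
  by (simp_all add: vec_eq_iff matrix_matrix_mult_def scaleR_sum_right)

lemma matrix_add_mult: "(A + C) ** B = A ** B + C ** (B :: complex^2^2)"
  "A ** (B + C) = A ** B + A ** (C :: complex^2^2)"
  by (simp_all add: vec_eq_iff matrix_matrix_mult_def sum.distrib algebra_simps)

text \<open>Each of the three generators squares to -1, so the exponential series splits into the
  cosine and sine series and no general theory of the matrix exponential is required.\<close>

lemma mexp_square_minus_1:
  assumes X: "X ** X = - mat 1"
  shows "mexp (t *\<^sub>R X) = cos t *\<^sub>R mat 1 + sin t *\<^sub>R X"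
proof -
  have XX: "X ** (- B) = - (X ** B)" for B :: "complex^2^2"
    using matrix_scaleR_mult(2)[of X "-1" B] by simp
  have pw: "(((**) (t *\<^sub>R X)) ^^ m) (mat 1) = t ^ m *\<^sub>R (if even m then (- 1) ^ (m div 2) *\<^sub>R mat 1
      else (- 1) ^ ((m - Suc 0) div 2) *\<^sub>R X)" for m
  proof (induction m)
    case (Suc m)
    then show ?case
      by (auto simp: matrix_scaleR_mult X XX elim!: oddE evenE simp: mult_ac)
  qed simp
  have "(\<lambda>m. (cos_coeff m *\<^sub>R t ^ m) *\<^sub>R (mat 1 :: complex^2^2) + (sin_coeff m *\<^sub>R t ^ m) *\<^sub>R X)
      sums (cos t *\<^sub>R mat 1 + sin t *\<^sub>R X)"
    by (intro sums_add sums_scaleR_left cos_converges sin_converges)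
  moreover have "(cos_coeff m *\<^sub>R t ^ m) *\<^sub>R (mat 1 :: complex^2^2) + (sin_coeff m *\<^sub>R t ^ m) *\<^sub>R X
      = (1 / fact m) *\<^sub>R (((**) (t *\<^sub>R X) ^^ m) (mat 1))" for m
    by (simp add: pw cos_coeff_def sin_coeff_def mult.commute)
  ultimately show ?thesis unfolding mexp_def by (simp add: sums_iff)
qed

lemma matrix_inv_eqI:
  fixes A B :: "complex^2^2"
  assumes "A ** B = mat 1" "B ** A = mat 1" shows "matrix_inv A = B"
proof -
  have "A ** matrix_inv A = mat 1 \<and> matrix_inv A ** A = mat 1"
    unfolding matrix_inv_def by (rule someI[of _ B]) (use assms in auto)
  then have "B ** (A ** matrix_inv A) = B" by simp
  then show ?thesis using assms by (simp add: matrix_mul_assoc)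
qed

lemma matrix_inv_mexp:
  assumes X: "X ** X = - mat 1"
  shows "matrix_inv (mexp (t *\<^sub>R X)) = cos t *\<^sub>R mat 1 - sin t *\<^sub>R X"
proof -
  have 1: "cos t * cos t + sin t * sin t = 1" for t :: real
    using sin_cos_squared_add2[of t] by (simp add: power2_eq_square)
  have *: "(cos t *\<^sub>R mat 1 + sin t *\<^sub>R X) ** (cos t *\<^sub>R mat 1 + (- sin t) *\<^sub>R X) = mat 1"
    "(cos t *\<^sub>R mat 1 + (- sin t) *\<^sub>R X) ** (cos t *\<^sub>R mat 1 + sin t *\<^sub>R X) = mat 1"
    using 1[of t] by (simp_all only: matrix_add_mult matrix_scaleR_mult X)
      (simp_all add: scaleR_add_left[symmetric] algebra_simps)
  show ?thesis unfolding mexp_square_minus_1[OF X]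
    by (rule matrix_inv_eqI) (use * in simp_all)
qed

text \<open>The sign comes from the inverse in \<open>tau\<close>: the curve through
  \<open>w\<close> has velocity - X w at time 0.\<close>

lemma dtau_sum_mono:
  assumes X: "X ** X = - mat 1"
  shows "dtau X (\<lambda>w. \<Sum>k\<le>n. c k * bimon n k w) w = - (\<Sum>k\<le>n. c k * bimon_deriv n k w (X *v w))"
proof -
  have cs: "(cos t *\<^sub>R mat 1 - sin t *\<^sub>R X) *v w = cos t *\<^sub>R w - sin t *\<^sub>R (X *v w)" for t
    by (simp add: vec_eq_iff matrix_vector_mult_def forall_2 sum_2 mat_def algebra_simps)
  let ?u = "\<lambda>i t. (cos t *\<^sub>R w - sin t *\<^sub>R (X *v w)) $ i"
  have u: "(?u i has_vector_derivative - ((X *v w) $ i)) (at 0)" for i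
    by (auto intro!: derivative_eq_intros simp: has_real_derivative_iff_has_vector_derivative[symmetric])
  have "((\<lambda>t. \<Sum>k\<le>n. c k * bimon n k (cos t *\<^sub>R w - sin t *\<^sub>R (X *v w))) has_vector_derivative
      (\<Sum>k\<le>n. c k * (- bimon_deriv n k w (X *v w)))) (at 0)"
  proof (intro has_vector_derivative_sum has_vector_derivative_mult_right)
    fix k
    show "((\<lambda>t. bimon n k (cos t *\<^sub>R w - sin t *\<^sub>R (X *v w))) has_vector_derivative - bimon_deriv n k w (X *v w)) (at 0)"
      using has_vector_derivative_mono_curve[OF u[of 1] u[of 2], of k "n - k"]
      by (simp add: bimon_def bimon_deriv_def mult_ac)
  qed
  then show ?thesis
    unfolding dtau_def tau_def matrix_inv_mexp[OF X] cs by (simp add: vector_derivative_at sum_negf)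
qed

lemma X_square: "X1 ** X1 = - mat 1" "X2 ** X2 = - mat 1" "X3 ** X3 = - mat 1"
  by (simp_all add: X1_def X2_def X3_def vec_eq_iff matrix_matrix_mult_def forall_2 sum_2 mat_def)

lemma X_mult: "X1 *v w = vector [\<i> * w $ 1, - \<i> * w $ 2]" "X2 *v w = vector [w $ 2, - w $ 1]"
  "X3 *v w = vector [\<i> * w $ 2, \<i> * w $ 1]"
  by (simp_all add: X1_def X2_def X3_def vec_eq_iff matrix_vector_mult_def forall_2 sum_2)

subsection \<open>Constant coefficient operators and their symbols\<close>

text \<open>The second clause is linearity in the form that \<open>tensor_op\<close> calls for: the
  value at \<open>w\<close> is expanded in monomials, which are constants \<open>a k\<close> for an
  operator acting in the other variable.\<close>

definition has_symbol ::
    "((complex^2 \<Rightarrow> complex) \<Rightarrow> (complex^2 \<Rightarrow> complex)) \<Rightarrow> (complex^2 \<Rightarrow> complex) \<Rightarrow> bool" where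
  "has_symbol A \<sigma> \<longleftrightarrow>
     (\<forall>f. schwartz f \<longrightarrow> schwartz (A f) \<and> (\<forall>\<zeta>. fourier (A f) \<zeta> = \<sigma> \<zeta> * fourier f \<zeta>)) \<and>
     (\<forall>(n::nat) f a. (\<forall>k\<le>n. schwartz (f k)) \<longrightarrow>
        A (\<lambda>u. \<Sum>k\<le>n. f k u * a k) = (\<lambda>u. \<Sum>k\<le>n. A (f k) u * a k))"

lemma has_symbolD:
  fixes n :: nat
  assumes "has_symbol A \<sigma>"
  shows "schwartz f \<Longrightarrow> schwartz (A f)" "schwartz f \<Longrightarrow> fourier (A f) \<zeta> = \<sigma> \<zeta> * fourier f \<zeta>"
    "(\<And>k. k \<le> n \<Longrightarrow> schwartz (g k)) \<Longrightarrow>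
      A (\<lambda>u. \<Sum>k\<le>n. g k u * a k) = (\<lambda>u. \<Sum>k\<le>n. A (g k) u * a k)"
proof -
  show "schwartz f \<Longrightarrow> schwartz (A f)" "schwartz f \<Longrightarrow> fourier (A f) \<zeta> = \<sigma> \<zeta> * fourier f \<zeta>"
    using assms by (simp_all add: has_symbol_def)
  show "A (\<lambda>u. \<Sum>k\<le>n. g k u * a k) = (\<lambda>u. \<Sum>k\<le>n. A (g k) u * a k)" if "\<And>k. k \<le> n \<Longrightarrow> schwartz (g k)"
    using assms[unfolded has_symbol_def, THEN conjunct2, rule_format, of n g a] that by simp
qed

lemma partial_deriv_sum:
  assumes "\<And>k. k \<in> I \<Longrightarrow> f k differentiable (at z)"
  shows "partial_deriv v (\<lambda>u. \<Sum>k\<in>I. f k u * a k) z = (\<Sum>k\<in>I. partial_deriv v (f k) z * a k)"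
proof -
  have "((\<lambda>u. \<Sum>k\<in>I. f k u * a k) has_derivative
      (\<lambda>h. \<Sum>k\<in>I. frechet_derivative (f k) (at z) h * a k)) (at z)"
  proof (intro has_derivative_sum has_derivative_mult_left)
    show "(f k has_derivative frechet_derivative (f k) (at z)) (at z)" if "k \<in> I" for k
      using assms[OF that] frechet_derivative_works by blast
  qed
  from partial_deriv_eqI[OF this] show ?thesis by (simp add: partial_deriv_def)
qed

lemma has_symbol_partial:
  assumes "b \<in> Basis"
  shows "has_symbol (partial_deriv b) (\<lambda>\<zeta>. \<i> * of_real (b \<bullet> \<zeta>))"
  unfolding has_symbol_def
  by (auto simp: schwartz_partial fourier_partial_deriv assms fun_eq_iff intro!: partial_deriv_sum schwartz_differentiable)

lemma has_symbol_add:
  assumes A: "has_symbol A \<sigma>" and B: "has_symbol B \<rho>"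
  shows "has_symbol (\<lambda>f u. A f u + B f u) (\<lambda>\<zeta>. \<sigma> \<zeta> + \<rho> \<zeta>)"
  unfolding has_symbol_def
  by (auto simp: schwartz_add fourier_add has_symbolD[OF A] has_symbolD[OF B] distrib_right sum.distrib)

lemma has_symbol_cmult:
  assumes A: "has_symbol A \<sigma>" shows "has_symbol (\<lambda>f u. c * A f u) (\<lambda>\<zeta>. c * \<sigma> \<zeta>)"
  unfolding has_symbol_def
  by (auto simp: schwartz_cmult fourier_cmult has_symbolD[OF A] sum_distrib_left mult.assoc)

lemma has_symbol_comp:
  assumes A: "has_symbol A \<sigma>" and B: "has_symbol B \<rho>"
  shows "has_symbol (\<lambda>f. A (B f)) (\<lambda>\<zeta>. \<sigma> \<zeta> * \<rho> \<zeta>)"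
  unfolding has_symbol_def by (auto simp: has_symbolD[OF A] has_symbolD[OF B])

lemma axis_in_Basis: "axis j 1 \<in> (Basis :: (complex^2) set)" "axis j \<i> \<in> (Basis :: (complex^2) set)"
  by (auto simp: axis_in_Basis_iff Basis_complex_def)

lemma has_symbol_cong: "has_symbol A \<sigma> \<Longrightarrow> A = B \<Longrightarrow> (\<And>\<zeta>. \<sigma> \<zeta> = \<rho> \<zeta>) \<Longrightarrow> has_symbol B \<rho>"
  using ext[of \<sigma> \<rho>] by blast

text \<open>With \<zeta>_j = \<xi> + \<i> \<eta> the two real directions contribute \<i> \<xi> and
  \<i> \<eta>. Their holomorphic combination is half of \<i> (\<xi> - \<i> \<eta>), which is why
  \<open>d_z\<close> yields the conjugate coordinate.\<close>

lemma has_symbol_d_z: "has_symbol (d_z j) (\<lambda>\<zeta>. \<i> / 2 * cnj (\<zeta> $ j))"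
  and has_symbol_d_zbar: "has_symbol (d_zbar j) (\<lambda>\<zeta>. \<i> / 2 * (\<zeta> $ j))"
proof -
  show "has_symbol (d_z j) (\<lambda>\<zeta>. \<i> / 2 * cnj (\<zeta> $ j))"
    by (rule has_symbol_cong[OF has_symbol_add[OF
        has_symbol_cmult[OF has_symbol_partial[OF axis_in_Basis(1)[of j]], of "1 / 2"]
        has_symbol_cmult[OF has_symbol_partial[OF axis_in_Basis(2)[of j]], of "- \<i> / 2"]]])
      (auto simp: d_z_def fun_eq_iff field_simps inner_axis' inner_complex_def complex_eq_iff)
  show "has_symbol (d_zbar j) (\<lambda>\<zeta>. \<i> / 2 * (\<zeta> $ j))"
    by (rule has_symbol_cong[OF has_symbol_add[OF
        has_symbol_cmult[OF has_symbol_partial[OF axis_in_Basis(1)[of j]], of "1 / 2"]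
        has_symbol_cmult[OF has_symbol_partial[OF axis_in_Basis(2)[of j]], of "\<i> / 2"]]])
      (auto simp: d_zbar_def fun_eq_iff field_simps inner_axis' inner_complex_def complex_eq_iff)
qed

lemma has_symbol_Lap: "has_symbol (Lap j) (\<lambda>\<zeta>. \<zeta> $ j * cnj (\<zeta> $ j))"
  by (rule has_symbol_cong[OF has_symbol_cmult[OF has_symbol_comp[OF has_symbol_d_z[of j] has_symbol_d_zbar[of j]], of "-4"]])
    (simp_all add: Lap_def fun_eq_iff algebra_simps)

lemma has_symbol_coefficients:
  "has_symbol (\<lambda>f u. \<i> * (Lap 2 f u - Lap 1 f u))
     (\<lambda>\<zeta>. \<i> * (\<zeta> $ 2 * cnj (\<zeta> $ 2) - \<zeta> $ 1 * cnj (\<zeta> $ 1)))"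
  "has_symbol (\<lambda>f u. - 4 * (d_zbar 1 (d_z 2 f) u - d_z 1 (d_zbar 2 f) u))
     (\<lambda>\<zeta>. \<zeta> $ 1 * cnj (\<zeta> $ 2) - cnj (\<zeta> $ 1) * \<zeta> $ 2)"
  "has_symbol (\<lambda>f u. 4 * \<i> * (d_z 1 (d_zbar 2 f) u + d_zbar 1 (d_z 2 f) u))
     (\<lambda>\<zeta>. - \<i> * (cnj (\<zeta> $ 1) * \<zeta> $ 2 + \<zeta> $ 1 * cnj (\<zeta> $ 2)))"
proof -
  note zz = has_symbol_comp[OF has_symbol_d_zbar[of 1] has_symbol_d_z[of 2]]
    and zz' = has_symbol_comp[OF has_symbol_d_z[of 1] has_symbol_d_zbar[of 2]]
  show "has_symbol (\<lambda>f u. \<i> * (Lap 2 f u - Lap 1 f u))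
     (\<lambda>\<zeta>. \<i> * (\<zeta> $ 2 * cnj (\<zeta> $ 2) - \<zeta> $ 1 * cnj (\<zeta> $ 1)))"
    by (rule has_symbol_cong[OF has_symbol_cmult[OF has_symbol_add[OF has_symbol_Lap[of 2]
        has_symbol_cmult[OF has_symbol_Lap[of 1], of "-1"]], of "\<i>"]]) (simp_all add: fun_eq_iff)
  show "has_symbol (\<lambda>f u. - 4 * (d_zbar 1 (d_z 2 f) u - d_z 1 (d_zbar 2 f) u))
     (\<lambda>\<zeta>. \<zeta> $ 1 * cnj (\<zeta> $ 2) - cnj (\<zeta> $ 1) * \<zeta> $ 2)"
    by (rule has_symbol_cong[OF has_symbol_cmult[OF has_symbol_add[OF zz
        has_symbol_cmult[OF zz', of "-1"]], of "-4"]]) (simp_all add: fun_eq_iff algebra_simps)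
  show "has_symbol (\<lambda>f u. 4 * \<i> * (d_z 1 (d_zbar 2 f) u + d_zbar 1 (d_z 2 f) u))
     (\<lambda>\<zeta>. - \<i> * (cnj (\<zeta> $ 1) * \<zeta> $ 2 + \<zeta> $ 1 * cnj (\<zeta> $ 2)))"
    by (rule has_symbol_cong[OF has_symbol_cmult[OF has_symbol_add[OF zz' zz], of "4 * \<i>"]])
      (simp_all add: fun_eq_iff algebra_simps)
qed

subsection \<open>The symbol of the operator\<close>

definition herm :: "complex^2 \<Rightarrow> complex^2 \<Rightarrow> complex" where
  "herm w z = w $ 1 * cnj (z $ 1) + w $ 2 * cnj (z $ 2)"

text \<open>The symbol of \<open>D_op\<close> at \<open>z\<close>, in the manifestly equivariant form
  \<open>n |z|\<^sup>2 - 2 \<langle>w, z\<rangle> z \<cdot> \<partial>\<^sub>w\<close>.\<close>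

definition symb :: "nat \<Rightarrow> complex^2 \<Rightarrow> operator" where
  "symb n z p w = of_nat n * herm z z * p w
     - 2 * herm w z * deriv (\<lambda>s. p (w + s *s z)) 0"

lemma deriv_sum_bimonom:
  "deriv (\<lambda>s. \<Sum>k\<le>n. c k * bimon n k (w + s *s z)) 0 = (\<Sum>k\<le>n. c k * bimon_deriv n k w z)"
proof (rule DERIV_imp_deriv, intro DERIV_sum DERIV_cmult)
  fix k
  have pow: "((\<lambda>s. (a + s * b) ^ j) has_field_derivative of_nat j * a ^ (j - 1) * b) (at 0)" for a b :: complex and j
    by (auto intro!: derivative_eq_intros)
  show "((\<lambda>s. bimon n k (w + s *s z)) has_field_derivative bimon_deriv n k w z) (at 0)"
    using DERIV_mult[OF pow[of "w $ 1" "z $ 1" k] pow[of "w $ 2" "z $ 2" "n - k"]]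
    by (simp add: bimon_def bimon_deriv_def algebra_simps)
qed

lemma symb_sum_bimonom:
  "symb n z (\<lambda>w. \<Sum>k\<le>n. c k * bimon n k w) w =
    (\<Sum>k\<le>n. c k * (of_nat n * herm z z * bimon n k w
     - 2 * herm w z * bimon_deriv n k w z))"
  unfolding symb_def deriv_sum_bimonom sum_distrib_left sum_subtractf[symmetric]
  by (intro sum.cong refl) (simp add: algebra_simps)

text \<open>Here \<open>a\<close> and \<open>b\<close> are the two partial derivatives of the
  monomial. Keeping them opaque makes all identities about the symbol linear in them, without
  exponents; the last equation is Euler's identity.\<close>

lemma bimon_deriv_coefficients:
  assumes "k \<le> n"
  obtains a b where "\<And>v. bimon_deriv n k w v = a * v $ 1 + b * v $ 2"
    "of_nat k * bimon n k w = a * w $ 1" "of_nat (n - k) * bimon n k w = b * w $ 2"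
    "of_nat k * bimon n (k - 1) w = a * w $ 2" "of_nat (n - k) * bimon n (Suc k) w = b * w $ 1"
    "of_nat n * bimon n k w = a * w $ 1 + b * w $ 2"
proof -
  define a where "a = of_nat k * (w $ 1) ^ (k - 1) * (w $ 2) ^ (n - k)"
  define b where "b = of_nat (n - k) * (w $ 1) ^ k * (w $ 2) ^ (n - k - 1)"
  have bd: "bimon_deriv n k w v = a * v $ 1 + b * v $ 2" for v
    by (simp add: bimon_deriv_def a_def b_def)
  have 1: "of_nat k * bimon n k w = a * w $ 1"
    by (cases k) (auto simp: a_def bimon_def)
  have 2: "of_nat (n - k) * bimon n k w = b * w $ 2"
    by (cases "n - k") (auto simp: b_def bimon_def)
  have 3: "of_nat k * bimon n (k - 1) w = a * w $ 2"
    using assms by (cases k) (auto simp: a_def bimon_def Suc_diff_Suc[symmetric] Suc_le_eq)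
  have 4: "of_nat (n - k) * bimon n (Suc k) w = b * w $ 1"
    by (auto simp: b_def bimon_def)
  have 5: "of_nat n * bimon n k w = a * w $ 1 + b * w $ 2"
    using assms unfolding 1[symmetric] 2[symmetric] by (simp add: of_nat_diff algebra_simps)
  show thesis by (rule that[OF bd 1 2 3 4 5])
qed

text \<open>The symbol is tridiagonal in the monomial basis: raising the index by one costs a factor
  cnj z_1 z_2, lowering it a factor z_1 cnj z_2.\<close>

lemma symb_bimonom_general:
  assumes "k \<le> n"
  shows "of_nat n * herm z z * bimon n k w
     - 2 * herm w z * bimon_deriv n k w z =
    (z $ 2 * cnj (z $ 2) - z $ 1 * cnj (z $ 1)) * (of_nat k - of_nat (n - k)) * bimon n k w
    - 2 * z $ 1 * cnj (z $ 2) * (of_nat k * bimon n (k - 1) w)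
    - 2 * cnj (z $ 1) * z $ 2 * (of_nat (n - k) * bimon n (Suc k) w)"
proof -
  obtain a b where ab: "\<And>v. bimon_deriv n k w v = a * v $ 1 + b * v $ 2"
    "of_nat k * bimon n k w = a * w $ 1" "of_nat (n - k) * bimon n k w = b * w $ 2"
    "of_nat k * bimon n (k - 1) w = a * w $ 2" "of_nat (n - k) * bimon n (Suc k) w = b * w $ 1"
    "of_nat n * bimon n k w = a * w $ 1 + b * w $ 2"
    using bimon_deriv_coefficients[OF assms, of w] by blast
  have m: "of_nat n * x * bimon n k w = x * (of_nat n * bimon n k w)"
    "x * (of_nat k - of_nat (n - k)) * bimon n k w = x * (of_nat k * bimon n k w - of_nat (n - k) * bimon n k w)" for x
    by (simp_all only: left_diff_distrib right_diff_distrib mult_ac)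
  show ?thesis unfolding m ab by (simp add: herm_def algebra_simps)
qed

text \<open>Combined with these scalar symbols, \<open>X1\<close>, \<open>X2\<close>,
  \<open>X3\<close> add up to the traceless Hermitian matrix M = 2 P - |z|^2, where P w =
  \<langle>w, z\<rangle> z. Minus the derivative along M w is -2 \<langle>w, z\<rangle> times the
  derivative along z, plus |z|^2 times the derivative along w, which Euler's identity turns into n
  |z|^2.\<close>

lemma symb_bimonom_dtau:
  assumes "k \<le> n"
  shows "\<i> * (z $ 2 * cnj (z $ 2) - z $ 1 * cnj (z $ 1)) * (- bimon_deriv n k w (X1 *v w))
      + (z $ 1 * cnj (z $ 2) - cnj (z $ 1) * z $ 2) * (- bimon_deriv n k w (X2 *v w))
      + - \<i> * (cnj (z $ 1) * z $ 2 + z $ 1 * cnj (z $ 2)) * (- bimon_deriv n k w (X3 *v w)) =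
    of_nat n * herm z z * bimon n k w
     - 2 * herm w z * bimon_deriv n k w z"
proof -
  obtain a b where ab: "\<And>v. bimon_deriv n k w v = a * v $ 1 + b * v $ 2"
    "of_nat n * bimon n k w = a * w $ 1 + b * w $ 2"
    using bimon_deriv_coefficients[OF assms, of w] by blast
  have m: "of_nat n * x * bimon n k w = x * (of_nat n * bimon n k w)" for x by (simp only: mult_ac)
  show ?thesis unfolding m ab X_mult by (simp add: herm_def algebra_simps)
qed

lemma bimon_deriv_X_in_V:
  assumes "k \<le> n"
  shows "(\<lambda>w. bimon_deriv n k w (X1 *v w)) \<in> V n" "(\<lambda>w. bimon_deriv n k w (X2 *v w)) \<in> V n"
    "(\<lambda>w. bimon_deriv n k w (X3 *v w)) \<in> V n"
proof -
  have a: "(\<lambda>w. of_nat k * bimon n (k - 1) w) \<in> V n"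
    using assms by (intro V_cmult V_mono) auto
  \<comment> \<open>For k = n the monomial of index n + 1 would leave \<open>V n\<close>, but its
    factor is 0.\<close>
  have b: "(\<lambda>w. of_nat (n - k) * bimon n (Suc k) w) \<in> V n"
  proof (cases "k = n")
    case False
    then show ?thesis using assms by (intro V_cmult V_mono) auto
  qed (simp add: V_zero)
  have P: "bimon_deriv n k w (X1 *v w) = (\<i> * of_nat k) * bimon n k w + (- \<i> * of_nat (n - k)) * bimon n k w"
    "bimon_deriv n k w (X2 *v w) = of_nat k * bimon n (k - 1) w + -1 * (of_nat (n - k) * bimon n (Suc k) w)"
    "bimon_deriv n k w (X3 *v w) = \<i> * (of_nat k * bimon n (k - 1) w) + \<i> * (of_nat (n - k) * bimon n (Suc k) w)" for w
  proof -
    obtain a b where bd: "\<And>v. bimon_deriv n k w v = a * v $ 1 + b * v $ 2" and ab: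
      "of_nat k * bimon n k w = a * w $ 1" "of_nat (n - k) * bimon n k w = b * w $ 2"
      "of_nat k * bimon n (k - 1) w = a * w $ 2" "of_nat (n - k) * bimon n (Suc k) w = b * w $ 1"
      using bimon_deriv_coefficients[OF assms, of w] by blast
    show "bimon_deriv n k w (X1 *v w) = (\<i> * of_nat k) * bimon n k w + (- \<i> * of_nat (n - k)) * bimon n k w"
      "bimon_deriv n k w (X2 *v w) = of_nat k * bimon n (k - 1) w + -1 * (of_nat (n - k) * bimon n (Suc k) w)"
      "bimon_deriv n k w (X3 *v w) = \<i> * (of_nat k * bimon n (k - 1) w) + \<i> * (of_nat (n - k) * bimon n (Suc k) w)"
      unfolding mult.assoc ab bd X_mult by (simp_all add: algebra_simps)
  qed
  show "(\<lambda>w. bimon_deriv n k w (X1 *v w)) \<in> V n"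
    unfolding P(1) by (rule V_add[OF V_cmult[OF V_mono[OF assms]] V_cmult[OF V_mono[OF assms]]])
  show "(\<lambda>w. bimon_deriv n k w (X2 *v w)) \<in> V n"
    unfolding P(2) by (rule V_add[OF a V_cmult[OF b]])
  show "(\<lambda>w. bimon_deriv n k w (X3 *v w)) \<in> V n"
    unfolding P(3) by (rule V_add[OF V_cmult[OF a] V_cmult[OF b]])
qed

section \<open>Fourier transforms of operator-valued functions\<close>

definition schwartz_V :: "nat \<Rightarrow> (complex^2 \<Rightarrow> operator) \<Rightarrow> bool" where
  "schwartz_V n G \<longleftrightarrow> (\<forall>p\<in>V n. (\<forall>z. G z p \<in> V n) \<and> (\<forall>w. schwartz (\<lambda>z. G z p w)))"

definition fourier_op :: "(complex^2 \<Rightarrow> operator) \<Rightarrow> (complex^2 \<Rightarrow> operator)" where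
  "fourier_op G \<zeta> p w = fourier (\<lambda>z. G z p w) \<zeta>"

lemma schwartz_coef:
  assumes "schwartz_V n G" "p \<in> V n" "k \<le> n"
  shows "schwartz (\<lambda>z. coef n (G z p) k)"
proof -
  obtain lam pt where l: "\<And>p k. p \<in> V n \<Longrightarrow> k \<le> n \<Longrightarrow> coef n p k = (\<Sum>i\<le>n. lam k i * p (pt i))"
    using coef_weights[of n] by metis
  have "(\<lambda>z. coef n (G z p) k) = (\<lambda>z. \<Sum>i\<le>n. lam k i * G z p (pt i))"
    using l assms by (simp add: schwartz_V_def)
  then show ?thesis using assms by (auto simp: schwartz_V_def intro!: schwartz_sum schwartz_cmult)
qed

lemma fourier_op_expansion:
  assumes "schwartz_V n G" "p \<in> V n"
  shows "fourier_op G \<zeta> p = (\<lambda>w. \<Sum>k\<le>n. fourier (\<lambda>z. coef n (G z p) k) \<zeta> * bimon n k w)"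
proof
  fix w
  have "(\<lambda>z. G z p w) = (\<lambda>z. \<Sum>k\<le>n. bimon n k w * coef n (G z p) k)"
    using V_coef_apply assms by (simp add: schwartz_V_def mult.commute)
  then show "fourier_op G \<zeta> p w = (\<Sum>k\<le>n. fourier (\<lambda>z. coef n (G z p) k) \<zeta> * bimon n k w)"
    unfolding fourier_op_def
    by (simp only:) (subst fourier_sum,
      auto simp: fourier_cmult mult.commute intro!: schwartz_cmult schwartz_coef assms)
qed

lemma fourier_op_in_V: "schwartz_V n G \<Longrightarrow> p \<in> V n \<Longrightarrow> fourier_op G \<zeta> p \<in> V n"
  by (simp only: fourier_op_expansion V_I)

text \<open>Expanding in monomials separates the variables: \<open>A\<close> meets only the
  coefficients, functions of \<open>z\<close>, and \<open>dtau X\<close> only the monomials in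
  \<open>w\<close>.\<close>

lemma tensor_op_dtau:
  assumes G: "schwartz_V n G" "p \<in> V n" and A: "has_symbol A \<sigma>" and X: "X ** X = - mat 1"
  shows "tensor_op A (dtau X) G z p w =
    (\<Sum>k\<le>n. A (\<lambda>z. coef n (G z p) k) z * (- bimon_deriv n k w (X *v w)))"
proof -
  have "A (\<lambda>u. G u p w) z = (\<Sum>k\<le>n. A (\<lambda>z. coef n (G z p) k) z * bimon n k w)" for w
  proof -
    have "(\<lambda>u. G u p w) = (\<lambda>u. \<Sum>k\<le>n. coef n (G u p) k * bimon n k w)"
      using V_coef_apply G by (simp add: schwartz_V_def)
    then show ?thesis
      using has_symbolD(3)[OF A, of n "\<lambda>k z. coef n (G z p) k" "\<lambda>k. bimon n k w"] schwartz_coef[OF G]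
      by simp
  qed
  then show ?thesis by (simp add: tensor_op_def dtau_sum_mono[OF X] sum_negf)
qed

lemma D_op_props:
  assumes G: "schwartz_V n G"
  shows "schwartz_V n (D_op G)"
    and "p \<in> V n \<Longrightarrow> fourier_op (D_op G) \<zeta> p w = symb n \<zeta> (fourier_op G \<zeta> p) w"
proof -
  note S = has_symbol_coefficients
  note T = tensor_op_dtau[OF G _ S(1) X_square(1)] tensor_op_dtau[OF G _ S(2) X_square(2)]
    tensor_op_dtau[OF G _ S(3) X_square(3)]
  let ?A1 = "\<lambda>f u. \<i> * (Lap 2 f u - Lap 1 f u)"
  let ?A2 = "\<lambda>f u. - 4 * (d_zbar 1 (d_z 2 f) u - d_z 1 (d_zbar 2 f) u)"
  let ?A3 = "\<lambda>f u. 4 * \<i> * (d_z 1 (d_zbar 2 f) u + d_zbar 1 (d_z 2 f) u)"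
  let ?c = "\<lambda>p k z. coef n (G z p) k"
  let ?b1 = "\<lambda>k w. - bimon_deriv n k w (X1 *v w)"
  let ?b2 = "\<lambda>k w. - bimon_deriv n k w (X2 *v w)"
  let ?b3 = "\<lambda>k w. - bimon_deriv n k w (X3 *v w)"
  let ?s1 = "\<lambda>\<zeta>. \<i> * (\<zeta> $ 2 * cnj (\<zeta> $ 2) - \<zeta> $ 1 * cnj (\<zeta> $ 1))"
  let ?s2 = "\<lambda>\<zeta>. \<zeta> $ 1 * cnj (\<zeta> $ 2) - cnj (\<zeta> $ 1) * \<zeta> $ 2"
  let ?s3 = "\<lambda>\<zeta>. - \<i> * (cnj (\<zeta> $ 1) * \<zeta> $ 2 + \<zeta> $ 1 * cnj (\<zeta> $ 2))"
  let ?R = "\<lambda>p w z. (\<Sum>k\<le>n. ?b1 k w * ?A1 (?c p k) z)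
     + (\<Sum>k\<le>n. ?b2 k w * ?A2 (?c p k) z)
     + (\<Sum>k\<le>n. ?b3 k w * ?A3 (?c p k) z)"
  have D: "D_op G z p w =
     ?R p w z" if "p \<in> V n" for z p w
    unfolding D_op_def T[OF that] by (simp only: mult.commute)
  have sA: "schwartz (?A1 (?c p k))" "schwartz (?A2 (?c p k))" "schwartz (?A3 (?c p k))"
    if "p \<in> V n" "k \<le> n" for p k
    using has_symbolD(1)[OF S(1)] has_symbolD(1)[OF S(2)] has_symbolD(1)[OF S(3)] schwartz_coef[OF G that]
    by blast+
  show "schwartz_V n (D_op G)" unfolding schwartz_V_def
  proof (intro ballI conjI allI)
    fix p z assume p: "p \<in> V n"
    have Vs: "(\<lambda>w. \<Sum>k\<le>n. (- bimon_deriv n k w (Y *v w)) * a k) \<in> V n"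
      if "\<And>k. k \<le> n \<Longrightarrow> (\<lambda>w. bimon_deriv n k w (Y *v w)) \<in> V n" for Y a
    proof -
      have "(\<lambda>w. \<Sum>k\<in>{..n}. (- a k) * bimon_deriv n k w (Y *v w)) \<in> V n"
        by (rule V_sum, rule V_cmult) (use that in auto)
      then show ?thesis by (simp add: mult.commute)
    qed
    have "D_op G z p = (\<lambda>w. ?R p w z)"
      using D[OF p] by blast
    moreover have "\<dots> \<in> V n"
      by (rule V_add[OF V_add[OF Vs Vs] Vs]) (rule bimon_deriv_X_in_V, assumption)+
    ultimately show "D_op G z p \<in> V n" by simp
  next
    fix p w assume p: "p \<in> V n"
    have "(\<lambda>z. D_op G z p w) = (\<lambda>z. ?R p w z)"
      using D[OF p] by blast
    moreover have "schwartz \<dots>"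
    proof (intro schwartz_add schwartz_sum)
      fix k assume "k \<in> {..n}"
      then have k: "k \<le> n" by simp
      show "schwartz (\<lambda>z. ?b1 k w * ?A1 (?c p k) z)"
        by (rule schwartz_cmult[OF sA(1)[OF p k]])
      show "schwartz (\<lambda>z. ?b2 k w * ?A2 (?c p k) z)"
        by (rule schwartz_cmult[OF sA(2)[OF p k]])
      show "schwartz (\<lambda>z. ?b3 k w * ?A3 (?c p k) z)"
        by (rule schwartz_cmult[OF sA(3)[OF p k]])
    qed
    ultimately show "schwartz (\<lambda>z. D_op G z p w)" by simp
  qed
  assume p: "p \<in> V n"
  have fs: "fourier (\<lambda>z. \<Sum>k\<le>n. b k * g k z) \<zeta> = (\<Sum>k\<le>n. b k * fourier (g k) \<zeta>)"
    if "\<And>k. k \<le> n \<Longrightarrow> schwartz (g k)" for b :: "nat \<Rightarrow> complex" and g :: "nat \<Rightarrow> complex^2 \<Rightarrow> complex"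
    using that by (subst fourier_sum) (auto simp: fourier_cmult intro!: schwartz_cmult)
  have ss: "schwartz (\<lambda>z. \<Sum>k\<le>n. b k * g k z)"
    if "\<And>k. k \<le> n \<Longrightarrow> schwartz (g k)" for b :: "nat \<Rightarrow> complex" and g :: "nat \<Rightarrow> complex^2 \<Rightarrow> complex"
    by (intro schwartz_sum schwartz_cmult) (use that in auto)
  let ?F = "\<lambda>k. fourier (?c p k) \<zeta>"
  have FA: "fourier (?A1 (?c p k)) \<zeta> = ?s1 \<zeta> * ?F k"
    "fourier (?A2 (?c p k)) \<zeta> = ?s2 \<zeta> * ?F k"
    "fourier (?A3 (?c p k)) \<zeta> = ?s3 \<zeta> * ?F k"
    if "k \<le> n" for k
    by (rule has_symbolD(2)[OF S(1) schwartz_coef[OF G p that]] has_symbolD(2)[OF S(2) schwartz_coef[OF G p that]]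
      has_symbolD(2)[OF S(3) schwartz_coef[OF G p that]])+
  have "fourier_op (D_op G) \<zeta> p w =
    (\<Sum>k\<le>n. ?b1 k w * fourier (?A1 (?c p k)) \<zeta>)
     + (\<Sum>k\<le>n. ?b2 k w * fourier (?A2 (?c p k)) \<zeta>)
     + (\<Sum>k\<le>n. ?b3 k w * fourier (?A3 (?c p k)) \<zeta>)"
    unfolding fourier_op_def D[OF p]
    by (subst fourier_add, intro schwartz_add ss sA[OF p], assumption, assumption, intro ss sA[OF p], assumption,
      subst fourier_add, intro ss sA[OF p], assumption, intro ss sA[OF p], assumption)
      (simp only: fs sA[OF p])
  also have "\<dots> = (\<Sum>k\<le>n. ?F k * (?s1 \<zeta> * ?b1 k w
      + ?s2 \<zeta> * ?b2 k w
      + ?s3 \<zeta> * ?b3 k w))"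
    unfolding sum.distrib[symmetric]
  proof (intro sum.cong refl)
    fix k assume "k \<in> {..n}"
    then have k: "k \<le> n" by simp
    show "?b1 k w * fourier (?A1 (?c p k)) \<zeta>
     + ?b2 k w * fourier (?A2 (?c p k)) \<zeta>
     + ?b3 k w * fourier (?A3 (?c p k)) \<zeta>
     = ?F k * (?s1 \<zeta> * ?b1 k w
      + ?s2 \<zeta> * ?b2 k w
      + ?s3 \<zeta> * ?b3 k w)"
      unfolding FA[OF k] by (simp only: distrib_left mult_ac)
  qed
  also have "\<dots> = symb n \<zeta> (fourier_op G \<zeta> p) w"
    unfolding fourier_op_expansion[OF G p] symb_sum_bimonom
    by (intro sum.cong refl) (simp only: symb_bimonom_dtau atMost_iff)
  finally show "fourier_op (D_op G) \<zeta> p w = symb n \<zeta> (fourier_op G \<zeta> p) w" .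
qed

text \<open>The tridiagonal action transferred to coefficient vectors: entry k collects what index k
  + 1 sends down and what index k - 1 sends up. The conditionals cut the vector off at both
  ends.\<close>

definition symb_step :: "nat \<Rightarrow> complex^2 \<Rightarrow> (nat \<Rightarrow> complex) \<Rightarrow> nat \<Rightarrow> complex" where
  "symb_step n z t k =
     (z $ 2 * cnj (z $ 2) - z $ 1 * cnj (z $ 1)) * (of_nat k - of_nat (n - k)) * t k
     - 2 * z $ 1 * cnj (z $ 2) * (if k < n then of_nat (Suc k) * t (Suc k) else 0)
     - 2 * cnj (z $ 1) * z $ 2 * (if k = 0 then 0 else of_nat (n - (k - 1)) * t (k - 1))"

lemma sum_shift_down:
  "(\<Sum>k\<le>n. a k * (of_nat k * m (k - 1))) = (\<Sum>k\<le>n. (if k < n then of_nat (Suc k) * a (Suc k) else 0) * (m k :: complex))"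
proof (cases n)
  case (Suc n')
  then show ?thesis
    by (simp only: sum.atMost_Suc_shift[where g="\<lambda>k. a k * (of_nat k * m (k - 1))"]) (simp add: mult_ac less_Suc_eq_le)
qed simp

lemma sum_shift_up:
  "(\<Sum>k\<le>n. a k * (of_nat (n - k) * m (Suc k))) = (\<Sum>k\<le>n. (if k = 0 then 0 else of_nat (n - (k - 1)) * a (k - 1)) * (m k :: complex))"
proof (cases n)
  case (Suc n')
  have "(\<Sum>k\<le>Suc n'. (if k = 0 then 0 else of_nat (Suc n' - (k - 1)) * a (k - 1)) * m k)
     = (\<Sum>k\<le>n'. of_nat (Suc n' - k) * a k * m (Suc k))"
    by (subst sum.atMost_Suc_shift) simp
  then show ?thesis unfolding Suc by (simp only:) (simp add: mult_ac)
qed simp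

lemma symb_recurrence:
  "symb n z (\<lambda>w. \<Sum>k\<le>n. t k * bimon n k w) = (\<lambda>w. \<Sum>k\<le>n. symb_step n z t k * bimon n k w)"
proof
  fix w
  let ?u = "\<lambda>k. (z $ 2 * cnj (z $ 2) - z $ 1 * cnj (z $ 1)) * (of_nat k - of_nat (n - k)) * t k * bimon n k w"
  let ?x = "2 * z $ 1 * cnj (z $ 2)" and ?y = "2 * cnj (z $ 1) * z $ 2"
  let ?down = "\<lambda>k. t k * (of_nat k * bimon n (k - 1) w)"
  let ?up = "\<lambda>k. t k * (of_nat (n - k) * bimon n (Suc k) w)"
  have "symb n z (\<lambda>w. \<Sum>k\<le>n. t k * bimon n k w) w = (\<Sum>k\<le>n. ?u k - ?x * ?down k - ?y * ?up k)"
    unfolding symb_sum_bimonom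
  proof (intro sum.cong refl)
    fix k assume "k \<in> {..n}"
    then have k: "k \<le> n" by simp
    show "t k * (of_nat n * herm z z * bimon n k w
        - 2 * herm w z * bimon_deriv n k w z)
      = ?u k - ?x * ?down k - ?y * ?up k"
      unfolding symb_bimonom_general[OF k] by (simp only: right_diff_distrib mult_ac)
  qed
  also have "\<dots> = (\<Sum>k\<le>n. ?u k) - ?x * (\<Sum>k\<le>n. ?down k) - ?y * (\<Sum>k\<le>n. ?up k)"
    by (simp only: sum_subtractf sum_distrib_left)
  also have "\<dots> = (\<Sum>k\<le>n. symb_step n z t k * bimon n k w)"
    unfolding sum_shift_down[of t "\<lambda>k. bimon n k w"] sum_shift_up[of t n "\<lambda>k. bimon n k w"]
      sum_distrib_left sum_subtractf[symmetric] symb_step_def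
    by (intro sum.cong refl) (simp only: left_diff_distrib mult.assoc)
  finally show "symb n z (\<lambda>w. \<Sum>k\<le>n. t k * bimon n k w) w = (\<Sum>k\<le>n. symb_step n z t k * bimon n k w)" .
qed

lemma symb_in_V: assumes "p \<in> V n" shows "symb n z p \<in> V n"
proof -
  have "symb n z p = symb n z (\<lambda>w. \<Sum>k\<le>n. coef n p k * bimon n k w)"
    by (rule arg_cong[OF V_coef[OF assms]])
  also have "\<dots> \<in> V n" unfolding symb_recurrence by (rule V_I)
  finally show ?thesis .
qed

lemma symb_linear:
  assumes "finite I" "\<And>i. i \<in> I \<Longrightarrow> p i \<in> V n"
  shows "symb n z (\<lambda>w. \<Sum>i\<in>I. a i * p i w) = (\<lambda>w. \<Sum>i\<in>I. a i * symb n z (p i) w)"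
proof
  fix w
  let ?s = "\<lambda>k. of_nat n * herm z z * bimon n k w
     - 2 * herm w z * bimon_deriv n k w z"
  have s: "symb n z q w = (\<Sum>k\<le>n. coef n q k * ?s k)" if "q \<in> V n" for q
    using symb_sum_bimonom[of n z "coef n q" w] V_coef[OF that, symmetric] by simp
  have q: "(\<lambda>w. \<Sum>i\<in>I. a i * p i w) \<in> V n" using assms by (intro V_sum V_cmult) auto
  have "symb n z (\<lambda>w. \<Sum>i\<in>I. a i * p i w) w = (\<Sum>k\<le>n. (\<Sum>i\<in>I. a i * coef n (p i) k) * ?s k)"
    unfolding s[OF q] by (intro sum.cong refl) (simp add: coef_linear[OF assms])
  also have "\<dots> = (\<Sum>i\<in>I. a i * (\<Sum>k\<le>n. coef n (p i) k * ?s k))"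
    unfolding sum_distrib_left sum_distrib_right by (subst sum.swap) (simp only: mult.assoc)
  also have "\<dots> = (\<Sum>i\<in>I. a i * symb n z (p i) w)"
    using s assms by simp
  finally show "symb n z (\<lambda>w. \<Sum>i\<in>I. a i * p i w) w = (\<Sum>i\<in>I. a i * symb n z (p i) w)" .
qed

lemma symb_pow_in_V: "p \<in> V n \<Longrightarrow> (symb n z ^^ j) p \<in> V n"
  by (induction j) (simp_all add: symb_in_V)

lemma symb_pow_linear:
  assumes "finite I" "\<And>i. i \<in> I \<Longrightarrow> p i \<in> V n"
  shows "(symb n z ^^ j) (\<lambda>w. \<Sum>i\<in>I. a i * p i w) = (\<lambda>w. \<Sum>i\<in>I. a i * (symb n z ^^ j) (p i) w)"
  using assms by (induction j) (simp_all add: symb_linear symb_pow_in_V)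

lemma D_op_pow_scalar:
  assumes f: "schwartz f"
  shows "schwartz_V n ((D_op ^^ j) (scalar_op f))"
    and "p \<in> V n \<Longrightarrow> fourier_op ((D_op ^^ j) (scalar_op f)) \<zeta> p w = fourier f \<zeta> * (symb n \<zeta> ^^ j) p w"
proof -
  show g: "schwartz_V n ((D_op ^^ j) (scalar_op f))" for j
  proof (induction j)
    case 0
    have "schwartz (\<lambda>z. f z * a)" for a using schwartz_cmult[OF f, of a] by (simp add: mult.commute)
    then show ?case by (auto simp: schwartz_V_def scalar_op_def V_cmult)
  qed (simp add: D_op_props)
  assume p: "p \<in> V n"
  show "fourier_op ((D_op ^^ j) (scalar_op f)) \<zeta> p w = fourier f \<zeta> * (symb n \<zeta> ^^ j) p w"
  proof (induction j arbitrary: w)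
    case 0
    show ?case using fourier_cmult[of "p w" f \<zeta>] by (simp add: fourier_op_def scalar_op_def mult.commute)
  next
    case (Suc j)
    have "fourier_op ((D_op ^^ Suc j) (scalar_op f)) \<zeta> p w
        = symb n \<zeta> (fourier_op ((D_op ^^ j) (scalar_op f)) \<zeta> p) w"
      using D_op_props(2)[OF g p] by simp
    also have "fourier_op ((D_op ^^ j) (scalar_op f)) \<zeta> p = (\<lambda>w. fourier f \<zeta> * (symb n \<zeta> ^^ j) p w)"
      using Suc by blast
    finally show ?case
      using symb_linear[of "{0::nat}" "\<lambda>_. (symb n \<zeta> ^^ j) p" n \<zeta> "\<lambda>_. fourier f \<zeta>"] symb_pow_in_V[OF p]
      by simp
  qed
qed

subsection \<open>Triangularity of the powers of the symbol\<close>

text \<open>The starting vector represents w_2^n, so row j lists the coefficients of the j-th power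
  of the symbol applied to it. This extreme monomial is cyclic for the symbol whenever z_1 z_2 is
  nonzero.\<close>

definition tri :: "nat \<Rightarrow> complex^2 \<Rightarrow> nat \<Rightarrow> nat \<Rightarrow> complex" where
  "tri n z j = (symb_step n z ^^ j) (\<lambda>k. if k = 0 then 1 else 0)"

lemma tri_simps: "tri n z 0 = (\<lambda>k. if k = 0 then 1 else 0)" "tri n z (Suc j) = symb_step n z (tri n z j)"
  by (simp_all add: tri_def)

lemma symb_pow_tri: "(symb n z ^^ j) (bimon n 0) = (\<lambda>w. \<Sum>k\<le>n. tri n z j k * bimon n k w)"
proof (induction j)
  case 0
  show ?case by (simp add: tri_simps if_distrib[of "\<lambda>c. c * _"] cong: if_cong)
qed (simp add: tri_simps symb_recurrence)

text \<open>One application of the symbol raises the index by at most one, and the start has index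
  0.\<close>

lemma tri_upper: "k > j \<Longrightarrow> tri n z j k = 0"
  by (induction j arbitrary: k) (auto simp: tri_simps symb_step_def)

text \<open>Index j is reached in j steps only by raising every time, so the entry is the product of
  the raising factors.\<close>

lemma tri_diag: "tri n z j j = (\<Prod>i<j. - 2 * of_nat (n - i)) * (cnj (z $ 1) * z $ 2) ^ j"
proof (induction j)
  case (Suc j)
  have "tri n z (Suc j) (Suc j) = - 2 * cnj (z $ 1) * z $ 2 * (of_nat (n - j) * tri n z j j)"
    by (simp add: tri_upper tri_simps symb_step_def)
  then show ?case unfolding Suc by (simp add: mult_ac)
qed (simp add: tri_simps)

lemma tri_diag_nonzero: "m \<le> n \<Longrightarrow> (\<Prod>i<m. - 2 * of_nat (n - i) :: complex) \<noteq> 0"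
  by (auto simp: prod_zero_iff)

lemma schwartz_z_mult: assumes "schwartz f"
  shows "schwartz (\<lambda>z::complex^2. z $ j * f z)" "schwartz (\<lambda>z::complex^2. cnj (z $ j) * f z)"
proof -
  let ?f = "\<lambda>b z. complex_of_real (z \<bullet> b) * f z"
  have n: "norm (axis j 1 :: complex^2) \<le> 1" "norm (axis j \<i> :: complex^2) \<le> 1"
    using norm_Basis[OF axis_in_Basis(1)] norm_Basis[OF axis_in_Basis(2)] by simp_all
  have s: "schwartz (\<lambda>z. ?f (axis j 1) z + \<i> * ?f (axis j \<i>) z)"
    "schwartz (\<lambda>z. ?f (axis j 1) z + (- \<i>) * ?f (axis j \<i>) z)"
    by (intro schwartz_add schwartz_cmult schwartz_coord n assms)+
  have e: "z $ j = complex_of_real (z \<bullet> axis j 1) + \<i> * complex_of_real (z \<bullet> axis j \<i>)"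
    "cnj (z $ j) = complex_of_real (z \<bullet> axis j 1) + (- \<i>) * complex_of_real (z \<bullet> axis j \<i>)" for z :: "complex^2"
    by (simp_all add: inner_axis inner_complex_def complex_eq_iff)
  show "schwartz (\<lambda>z::complex^2. z $ j * f z)" "schwartz (\<lambda>z::complex^2. cnj (z $ j) * f z)"
    using s unfolding e by (simp_all add: algebra_simps)
qed

text \<open>The entries are polynomials in the coordinates and their conjugates, hence multipliers
  of Schwartz functions.\<close>

lemma schwartz_tri: "schwartz f \<Longrightarrow> schwartz (\<lambda>z. tri n z j k * f z)"
proof (induction j arbitrary: k)
  case 0
  then show ?case by (cases "k = 0") (simp_all add: schwartz_0 tri_simps)
next
  case (Suc j)
  let ?s = "\<lambda>k z. tri n z j k * f z"
  have s: "schwartz (?s k)" for k using Suc by blast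
  note zz = schwartz_z_mult(1)[OF schwartz_z_mult(2)] schwartz_z_mult(2)[OF schwartz_z_mult(1)]
  have "schwartz (\<lambda>z. (of_nat k - of_nat (n - k)) * (z $ 2 * (cnj (z $ 2) * ?s k z) - z $ 1 * (cnj (z $ 1) * ?s k z))
     - (2 * (if k < n then of_nat (Suc k) else 0)) * (z $ 1 * (cnj (z $ 2) * ?s (Suc k) z))
     - (2 * (if k = 0 then 0 else of_nat (n - (k - 1)))) * (cnj (z $ 1) * (z $ 2 * ?s (k - 1) z)))"
    by (rule schwartz_diff[OF schwartz_diff[OF schwartz_cmult[OF schwartz_diff[OF zz(1)[OF s] zz(1)[OF s]]]
        schwartz_cmult[OF zz(1)[OF s]]] schwartz_cmult[OF zz(2)[OF s]]])
  moreover have "tri n z (Suc j) k * f z =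
    (of_nat k - of_nat (n - k)) * (z $ 2 * (cnj (z $ 2) * ?s k z) - z $ 1 * (cnj (z $ 1) * ?s k z))
     - (2 * (if k < n then of_nat (Suc k) else 0)) * (z $ 1 * (cnj (z $ 2) * ?s (Suc k) z))
     - (2 * (if k = 0 then 0 else of_nat (n - (k - 1)))) * (cnj (z $ 1) * (z $ 2 * ?s (k - 1) z))" for z
    unfolding tri_simps symb_step_def by (simp only: left_diff_distrib right_diff_distrib mult_ac if_distrib[of "\<lambda>c. c * _"] mult_zero_left mult_zero_right cong: if_cong)
      (auto simp: algebra_simps)
  ultimately show ?case by (simp only:)
qed

subsection \<open>Weights\<close>

definition torus :: "real \<Rightarrow> complex^2 \<Rightarrow> complex^2" where
  "torus \<phi> z = vector [cis \<phi> * z $ 1, cis (- \<phi>) * z $ 2]"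

definition has_weight :: "int \<Rightarrow> (complex^2 \<Rightarrow> complex) \<Rightarrow> bool" where
  "has_weight N e \<longleftrightarrow> (\<forall>\<phi> z. e (torus \<phi> z) = cis (of_int N * \<phi>) * e z)"

lemma linear_torus: "linear (torus \<phi>)"
  by (auto intro!: linearI simp: torus_def vec_eq_iff forall_2 algebra_simps)

lemma has_weight_partial:
  assumes e: "schwartz e" "has_weight N e"
  shows "partial_deriv (torus \<phi> v) e (torus \<phi> z) = cis (of_int N * \<phi>) * partial_deriv v e z"
proof -
  have d: "(e has_derivative frechet_derivative e (at x)) (at x)" for x
    using schwartz_differentiable[OF e(1)] frechet_derivative_works by blast
  have t: "(torus \<phi> has_derivative torus \<phi>) (at z)"
    by (intro linear_imp_has_derivative linear_torus)
  have "((\<lambda>z. e (torus \<phi> z)) has_derivative (\<lambda>h. frechet_derivative e (at (torus \<phi> z)) (torus \<phi> h))) (at z)"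
    by (rule has_derivative_compose[OF t d])
  then have "partial_deriv v (\<lambda>z. e (torus \<phi> z)) z = partial_deriv (torus \<phi> v) e (torus \<phi> z)"
    unfolding partial_deriv_def[of _ e] by (rule partial_deriv_eqI)
  moreover have "(\<lambda>z. e (torus \<phi> z)) = (\<lambda>z. cis (of_int N * \<phi>) * e z)"
    using e(2) by (simp add: has_weight_def)
  ultimately show ?thesis by (simp add: partial_deriv_cmult schwartz_differentiable[OF e(1)])
qed

lemma partial_deriv_combine:
  assumes "schwartz e"
  shows "partial_deriv (a *\<^sub>R u + b *\<^sub>R v) e z = of_real a * partial_deriv u e z + of_real b * partial_deriv v e z"
  using linear_frechet_derivative[OF schwartz_differentiable[OF assms, of z]]
  by (simp add: partial_deriv_def linear_add linear_scale scaleR_conv_of_real)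

text \<open>The coordinates z_1 and z_2 are rotated in opposite senses, so holomorphic and
  antiholomorphic derivatives swap their shifts between the two indices.\<close>

lemma has_weight_d:
  assumes e: "schwartz e" "has_weight N e"
  shows "has_weight (N - 1) (d_z 1 e)" "has_weight (N + 1) (d_zbar 1 e)"
    "has_weight (N + 1) (d_z 2 e)" "has_weight (N - 1) (d_zbar 2 e)"
proof -
  have t: "torus \<phi> (axis 1 1) = cos \<phi> *\<^sub>R axis 1 1 + sin \<phi> *\<^sub>R axis 1 \<i>"
    "torus \<phi> (axis 1 \<i>) = (- sin \<phi>) *\<^sub>R axis 1 1 + cos \<phi> *\<^sub>R axis 1 \<i>"
    "torus \<phi> (axis 2 1) = cos \<phi> *\<^sub>R axis 2 1 + (- sin \<phi>) *\<^sub>R axis 2 \<i>"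
    "torus \<phi> (axis 2 \<i>) = sin \<phi> *\<^sub>R axis 2 1 + cos \<phi> *\<^sub>R axis 2 \<i>" for \<phi>
    by (simp_all add: torus_def vec_eq_iff forall_2 axis_def complex_eq_iff)
  \<comment> \<open>A plane rotation is diagonalised over the complex numbers by the combinations P
    - \<i> Q and P + \<i> Q.\<close>
  have rot: "P' - \<i> * Q' = cis (- \<phi>) * c * (P - \<i> * Q)" "P' + \<i> * Q' = cis \<phi> * c * (P + \<i> * Q)"
    if "of_real (cos \<phi>) * P' + of_real (sin \<phi>) * Q' = c * P"
      "of_real (- sin \<phi>) * P' + of_real (cos \<phi>) * Q' = c * Q" for P Q P' Q' c \<phi>
  proof -
    have 1: "c * (P - \<i> * Q) = cis \<phi> * (P' - \<i> * Q')" "c * (P + \<i> * Q) = cis (- \<phi>) * (P' + \<i> * Q')"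
      unfolding right_diff_distrib distrib_left mult.left_commute[of c \<i>] that[symmetric]
      by (simp_all add: complex_eq_iff algebra_simps)
    show "P' - \<i> * Q' = cis (- \<phi>) * c * (P - \<i> * Q)" "P' + \<i> * Q' = cis \<phi> * c * (P + \<i> * Q)"
      unfolding mult.assoc[of _ c] 1 by (simp_all add: cis_mult flip: mult.assoc)
  qed
  note hw = has_weight_partial[OF e]
  have c: "cis (of_int (N - 1) * \<phi>) = cis (- \<phi>) * cis (of_int N * \<phi>)"
    "cis (of_int (N + 1) * \<phi>) = cis \<phi> * cis (of_int N * \<phi>)" for \<phi>
    by (simp_all add: cis_mult algebra_simps)
  have p1: "of_real (cos \<phi>) * partial_deriv (axis 1 1) e (torus \<phi> z) + of_real (sin \<phi>) * partial_deriv (axis 1 \<i>) e (torus \<phi> z)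
      = cis (of_int N * \<phi>) * partial_deriv (axis 1 1) e z"
    "of_real (- sin \<phi>) * partial_deriv (axis 1 1) e (torus \<phi> z) + of_real (cos \<phi>) * partial_deriv (axis 1 \<i>) e (torus \<phi> z)
      = cis (of_int N * \<phi>) * partial_deriv (axis 1 \<i>) e z" for \<phi> z
    unfolding partial_deriv_combine[OF e(1), symmetric] t[symmetric] by (rule hw)+
  \<comment> \<open>Written with the angle - \<phi> so that \<open>rot\<close> applies to the second
    coordinate as well.\<close>
  have p2: "of_real (cos (- \<phi>)) * partial_deriv (axis 2 1) e (torus \<phi> z) + of_real (sin (- \<phi>)) * partial_deriv (axis 2 \<i>) e (torus \<phi> z)
      = cis (of_int N * \<phi>) * partial_deriv (axis 2 1) e z"
    "of_real (- sin (- \<phi>)) * partial_deriv (axis 2 1) e (torus \<phi> z) + of_real (cos (- \<phi>)) * partial_deriv (axis 2 \<i>) e (torus \<phi> z)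
      = cis (of_int N * \<phi>) * partial_deriv (axis 2 \<i>) e z" for \<phi> z
    unfolding cos_minus sin_minus minus_minus partial_deriv_combine[OF e(1), symmetric] t[symmetric] by (rule hw)+
  note r1 = rot[OF p1] and r2 = rot[OF p2]
  show "has_weight (N - 1) (d_z 1 e)" "has_weight (N + 1) (d_zbar 1 e)"
    "has_weight (N + 1) (d_z 2 e)" "has_weight (N - 1) (d_zbar 2 e)"
    unfolding has_weight_def d_z_def d_zbar_def c r1 r2 by simp_all
qed

text \<open>A unit vector, so the point at parameter x \<ge> 0 has norm x; there cnj z_1 z_2 equals
  x^2 / 2 and does not vanish for x > 0.\<close>

definition diag_dir :: "complex^2" where
  "diag_dir = vector [of_real (1 / sqrt 2), of_real (1 / sqrt 2)]"

lemma partial_diag: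
  assumes "schwartz e"
  shows "partial_deriv diag_dir e = (\<lambda>z. of_real (1 / sqrt 2) * (d_z 1 e z + d_zbar 1 e z + (d_z 2 e z + d_zbar 2 e z)))"
proof
  fix z
  have dd: "diag_dir = (1 / sqrt 2) *\<^sub>R axis 1 1 + (1 / sqrt 2) *\<^sub>R axis 2 1"
    by (simp add: diag_dir_def vec_eq_iff forall_2 axis_def complex_eq_iff)
  have "partial_deriv diag_dir e z = of_real (1 / sqrt 2) * (partial_deriv (axis 1 1) e z + partial_deriv (axis 2 1) e z)"
    by (subst dd) (simp only: partial_deriv_combine[OF assms] distrib_left)
  moreover have "d_z j e z + d_zbar j e z = partial_deriv (axis j 1) e z" for j
    by (simp add: d_z_def d_zbar_def flip: add_divide_distrib)
  ultimately show "partial_deriv diag_dir e z = of_real (1 / sqrt 2) * (d_z 1 e z + d_zbar 1 e z + (d_z 2 e z + d_zbar 2 e z))"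
    by simp
qed

lemma schwartz_partial_pow: "schwartz e \<Longrightarrow> schwartz ((partial_deriv v ^^ l) e)"
  by (induction l) (simp_all add: schwartz_partial)

lemma pd_pow_add:
  assumes "schwartz e" "schwartz f"
  shows "(partial_deriv v ^^ l) (\<lambda>z. e z + f z) = (\<lambda>z. (partial_deriv v ^^ l) e z + (partial_deriv v ^^ l) f z)"
  by (induction l) (auto simp: partial_deriv_add schwartz_differentiable schwartz_partial_pow assms)

lemma pd_pow_cmult:
  assumes "schwartz e"
  shows "(partial_deriv v ^^ l) (\<lambda>z. c * e z) = (\<lambda>z. c * (partial_deriv v ^^ l) e z)"
  by (induction l) (auto simp: partial_deriv_cmult schwartz_differentiable schwartz_partial_pow assms)

text \<open>The operators \<open>d_z\<close> and \<open>d_zbar\<close> shift the weight by \<open>\<plusminus>1\<close>, and a function of nonzero weight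
  vanishes at the origin.\<close>

lemma has_weight_derivative_0:
  assumes "schwartz e" "has_weight N e" "int l < \<bar>N\<bar> \<or> odd (int l - N)"
  shows "(partial_deriv diag_dir ^^ l) e 0 = 0"
  using assms
proof (induction l arbitrary: e N)
  case 0
  then have N: "N \<noteq> 0" by auto
  have "torus \<phi> 0 = 0" for \<phi> by (simp add: torus_def vec_eq_iff forall_2)
  \<comment> \<open>The angle pi / N turns the weight factor into -1.\<close>
  then have "e 0 = cis (of_int N * (pi / of_int N)) * e 0"
    using 0(2) unfolding has_weight_def by metis
  then show ?case using N by simp
next
  case (Suc l)
  have s: "schwartz (d_z j e)" "schwartz (d_zbar j e)" for j
    using has_symbolD(1)[OF has_symbol_d_z] has_symbolD(1)[OF has_symbol_d_zbar] Suc.prems(1) by blast+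
  note w = has_weight_d[OF Suc.prems(1,2)]
  \<comment> \<open>Order and weight both change by one, so size and parity conditions survive; at
    order 0 either of them forces a nonzero weight.\<close>
  have N: "int l < \<bar>N - 1\<bar> \<or> odd (int l - (N - 1))" "int l < \<bar>N + 1\<bar> \<or> odd (int l - (N + 1))"
    using Suc.prems(3) by auto
  have "(partial_deriv diag_dir ^^ Suc l) e 0 = (partial_deriv diag_dir ^^ l) (partial_deriv diag_dir e) 0"
    by (simp only: funpow_Suc_right o_def)
  also have "\<dots> = 0"
    unfolding partial_diag[OF Suc.prems(1)]
    using Suc.IH[OF s(1) w(1) N(1)] Suc.IH[OF s(2) w(2) N(2)] Suc.IH[OF s(1) w(3) N(2)] Suc.IH[OF s(2) w(4) N(1)]
    by (simp only: pd_pow_cmult pd_pow_add schwartz_add s) simp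
  finally show ?case .
qed

lemma norm_diag_dir: "norm diag_dir = 1"
  by (simp add: norm_vec_def L2_set_def sum_2 diag_dir_def norm_divide power_divide)

lemma tower_line:
  assumes "schwartz e" "norm v = 1"
  shows "tower (\<lambda>l x. (partial_deriv v ^^ l) e (x *\<^sub>R v))"
  unfolding tower_def
proof (intro conjI allI impI)
  fix l and s :: real
  show "((\<lambda>x. (partial_deriv v ^^ l) e (x *\<^sub>R v)) has_vector_derivative (partial_deriv v ^^ Suc l) e (s *\<^sub>R v)) (at s within {0..})"
    using has_vector_derivative_line[OF schwartz_differentiable[OF schwartz_partial_pow[OF assms(1)]], where x=0 and v=v]
    by simp
next
  fix l p
  obtain C where C: "\<And>z. norm z ^ p * norm ((partial_deriv v ^^ l) e z) \<le> C"
    using rapid_decayD[OF schwartz_rapid_decay[OF schwartz_partial_pow[OF assms(1)]]] by blast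
  have "s ^ p * norm ((partial_deriv v ^^ l) e (s *\<^sub>R v)) \<le> C" if "s \<ge> 0" for s
    using C[of "s *\<^sub>R v"] that assms(2) by simp
  then show "\<exists>C. \<forall>s\<ge>0. s ^ p * norm ((partial_deriv v ^^ l) e (s *\<^sub>R v)) \<le> C" by blast
qed

lemma continuous_eq_off_0:
  fixes f g :: "'a::euclidean_space \<Rightarrow> complex"
  assumes "continuous_on UNIV f" "continuous_on UNIV g" "\<And>z. z \<noteq> 0 \<Longrightarrow> f z = g z"
  shows "f = g"
proof
  fix z
  have cl: "closure (- {0::'a}) = UNIV" by (simp add: closure_complement)
  have "f z - g z = 0"
    by (rule continuous_constant_on_closure[of "- {0}" "\<lambda>z. f z - g z"])
      (use assms cl in \<open>auto intro!: continuous_intros\<close>)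
  then show "f z = g z" by simp
qed

lemma norm_torus: "norm (torus \<phi> z) = norm z"
  by (simp add: torus_def norm_vec_def L2_set_def sum_2 norm_mult)

text \<open>Nothing is assumed about \<open>\<gamma>\<close> itself; all its smoothness is extracted
  from that of \<open>e\<close>. Since the factorisation is given off the origin, \<open>h 0\<close>
  is compared with \<open>\<gamma>\<close> for s > 0 and supplies the value at 0.\<close>

lemma tower_of_weighted:
  fixes e :: "complex^2 \<Rightarrow> complex"
  assumes e: "schwartz e" and c: "c \<noteq> 0"
    and eq: "\<And>z. z \<noteq> 0 \<Longrightarrow> e z = c * (cnj (z $ 1) * z $ 2) ^ m * \<gamma> ((norm z)\<^sup>2)"
  obtains h where "tower h" "\<And>s. s > 0 \<Longrightarrow> h 0 s = \<gamma> s"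
proof -
  \<comment> \<open>Off the origin the weight is visible in the factorisation; at the origin it
    follows by continuity.\<close>
  have w: "has_weight (- 2 * int m) e" unfolding has_weight_def
  proof
    fix \<phi>
    have "(\<lambda>z. e (torus \<phi> z)) = (\<lambda>z. cis (of_int (- 2 * int m) * \<phi>) * e z)"
    proof (rule continuous_eq_off_0)
      have ct: "continuous_on UNIV (torus \<phi>)"
        by (intro linear_continuous_on) (simp add: linear_conv_bounded_linear[symmetric] linear_torus)
      show "continuous_on UNIV (\<lambda>z. e (torus \<phi> z))"
        by (rule continuous_on_compose2[OF schwartz_continuous_on[OF e] ct]) auto
      show "continuous_on UNIV (\<lambda>z. cis (of_int (- 2 * int m) * \<phi>) * e z)"
        by (intro continuous_intros schwartz_continuous_on e)
      fix z :: "complex^2" assume z: "z \<noteq> 0"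
      have tz: "torus \<phi> z \<noteq> 0" using z norm_torus[of \<phi> z] by force
      have "cnj (torus \<phi> z $ 1) * torus \<phi> z $ 2 = cis (- 2 * \<phi>) * (cnj (z $ 1) * z $ 2)"
      proof -
        have "cis (- 2 * \<phi>) = cis (- \<phi>) * cis (- \<phi>)" by (simp add: cis_mult)
        then show ?thesis by (simp add: torus_def cis_cnj)
      qed
      moreover have "cis (- 2 * \<phi>) ^ m = cis (of_int (- 2 * int m) * \<phi>)"
        unfolding Complex.DeMoivre by (rule arg_cong[where f=cis]) simp
      ultimately show "e (torus \<phi> z) = cis (of_int (- 2 * int m) * \<phi>) * e z"
        unfolding eq[OF z] eq[OF tz] norm_torus by (simp add: power_mult_distrib)
    qed
    then show "\<forall>z. e (torus \<phi> z) = cis (of_int (- 2 * int m) * \<phi>) * e z" by metis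
  qed
  define g where "g = (\<lambda>l x. (partial_deriv diag_dir ^^ l) e (x *\<^sub>R diag_dir))"
  have g: "tower g" unfolding g_def by (rule tower_line[OF e norm_diag_dir])
  \<comment> \<open>The weight is even, so the parity condition singles out the odd orders.\<close>
  have g0: "g l 0 = 0" if "l < 2 * m \<or> odd l" for l
    using has_weight_derivative_0[OF e w, of l] that by (auto simp: g_def)
  obtain h where h: "tower h" "\<And>s. s \<ge> 0 \<Longrightarrow> g 0 s = of_real s ^ (2 * m) * h 0 s"
    "\<And>l. g (l + 2 * m) 0 = 0 \<Longrightarrow> h l 0 = 0"
    using tower_tdiv_power[OF g, of "2 * m"] g0 by blast
  have "even_tower h" unfolding even_tower_def using h(1,3) g0 by simp
  \<comment> \<open>The scalar undoes the constant \<open>c\<close> and the factor 2^m in (s /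
    2)^m.\<close>
  from tower_cmult[OF tower_sqrt[OF this], of "2 ^ m / c"]
  have t: "tower (\<lambda>k s. 2 ^ m / c * (half_quot ^^ k) h 0 (sqrt s))" .
  have "2 ^ m / c * (half_quot ^^ 0) h 0 (sqrt s) = \<gamma> s" if s: "s > 0" for s
  proof -
    let ?z = "sqrt s *\<^sub>R diag_dir"
    have nz: "?z \<noteq> 0" using s norm_diag_dir by force
    have zz: "cnj (?z $ 1) * ?z $ 2 = of_real (s / 2)"
    proof -
      have "(sqrt s * (1 / sqrt 2)) * (sqrt s * (1 / sqrt 2)) = s / 2" using s by simp
      then have "complex_of_real ((sqrt s * (1 / sqrt 2)) * (sqrt s * (1 / sqrt 2))) = of_real (s / 2)" by (simp only:)
      moreover have "?z $ 1 = of_real (sqrt s * (1 / sqrt 2))" "?z $ 2 = of_real (sqrt s * (1 / sqrt 2))"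
        unfolding vector_scaleR_component diag_dir_def vector_2 by (simp_all add: scaleR_conv_of_real)
      ultimately show ?thesis by (simp only: complex_cnj_complex_of_real complex_cnj_mult of_real_mult)
    qed
    have nn: "(norm ?z)\<^sup>2 = s" using s norm_diag_dir by simp
    have "c * of_real (s / 2) ^ m * \<gamma> s = of_real (sqrt s) ^ (2 * m) * h 0 (sqrt s)"
      using h(2)[of "sqrt s"] eq[OF nz] s unfolding zz nn by (simp add: g_def)
    also have "of_real (sqrt s) ^ (2 * m) = (complex_of_real s) ^ m"
      using s by (simp add: power_mult flip: of_real_power)
    finally have "c * (of_real s ^ m * \<gamma> s) = of_real s ^ m * (2 ^ m * h 0 (sqrt s))"
      by (simp add: power_divide field_simps)
    then have "of_real s ^ m * (c * \<gamma> s) = of_real s ^ m * (2 ^ m * h 0 (sqrt s))" by (simp only: mult_ac)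
    then have "c * \<gamma> s = 2 ^ m * h 0 (sqrt s)" using s by simp
    then show ?thesis using c by (simp add: field_simps)
  qed
  with t show thesis by (intro that[of "\<lambda>k s. 2 ^ m / c * (half_quot ^^ k) h 0 (sqrt s)"]) blast+
qed

subsection \<open>Unitary equivariance\<close>

lemma V_mult:
  assumes "p \<in> V a" "q \<in> V b" shows "(\<lambda>w. p w * q w) \<in> V (a + b)"
proof -
  have bm: "bimon a i w * bimon b j w = bimon (a + b) (i + j) w" if "i \<le> a" "j \<le> b" for i j w
  proof -
    have "a + b - (i + j) = (a - i) + (b - j)" using that by simp
    then show ?thesis by (simp add: bimon_def power_add mult_ac)
  qed
  have "(\<lambda>w. p w * q w) = (\<lambda>w. \<Sum>i\<in>{..a}. \<Sum>j\<in>{..b}. (coef a p i * coef b q j) * bimon (a + b) (i + j) w)"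
  proof
    fix w
    have "p w * q w = (\<Sum>i\<le>a. coef a p i * bimon a i w) * (\<Sum>j\<le>b. coef b q j * bimon b j w)"
      using V_coef_apply assms by metis
    also have "\<dots> = (\<Sum>i\<in>{..a}. \<Sum>j\<in>{..b}. (coef a p i * coef b q j) * bimon (a + b) (i + j) w)"
      unfolding sum_product
      by (intro sum.cong refl) (simp add: bm[symmetric] mult_ac)
    finally show "p w * q w = (\<Sum>i\<in>{..a}. \<Sum>j\<in>{..b}. (coef a p i * coef b q j) * bimon (a + b) (i + j) w)" .
  qed
  moreover have "\<dots> \<in> V (a + b)"
    by (rule V_sum, rule V_sum, rule V_cmult, rule V_mono) simp
  ultimately show ?thesis by simp
qed

lemma V_one: "(\<lambda>w. 1) \<in> V 0"
  using V_mono[of 0 0] by (simp add: bimon_def[abs_def])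

lemma V_power: assumes "p \<in> V 1" shows "(\<lambda>w. p w ^ k) \<in> V k"
proof (induction k)
  case (Suc k)
  from V_mult[OF assms Suc] show ?case by simp
qed (simp add: V_one)

lemma V_linear_form: "(\<lambda>w. (A *v w) $ i) \<in> V 1"
proof -
  have "(\<lambda>w. A $ i $ 1 * bimon 1 1 w + A $ i $ 2 * bimon 1 0 w) \<in> V 1"
    by (intro V_add V_cmult V_mono) auto
  then show ?thesis by (simp add: bimon_def matrix_vector_mult_def sum_2)
qed

lemma V_compose: assumes "p \<in> V n" shows "(\<lambda>w. p (A *v w)) \<in> V n"
proof -
  have b: "(\<lambda>w. bimon n k (A *v w)) \<in> V n" if "k \<le> n" for k
    using V_mult[OF V_power[OF V_linear_form[of A 1], of k] V_power[OF V_linear_form[of A 2], of "n - k"]] that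
    by (simp add: bimon_def)
  have "(\<lambda>w. p (A *v w)) = (\<lambda>w. \<Sum>k\<in>{..n}. coef n p k * bimon n k (A *v w))"
    using V_coef_apply[OF assms] by blast
  moreover have "\<dots> \<in> V n" by (rule V_sum, rule V_cmult, rule b) simp
  ultimately show ?thesis by simp
qed

lemma inner_eq_herm: "w \<bullet> z = Re (herm w z)"
  by (simp add: herm_def inner_vec_def sum_2 inner_complex_def)

lemma herm_self: "herm z z = of_real ((norm z)\<^sup>2)"
proof -
  have "(norm z)\<^sup>2 = (norm (z $ 1))\<^sup>2 + (norm (z $ 2))\<^sup>2"
    by (simp add: norm_vec_def L2_set_def sum_2)
  then show ?thesis by (simp only: herm_def of_real_add complex_norm_square)
qed

lemma U2_herm: assumes "k \<in> U2" shows "herm (k *v w) (k *v z) = herm w z"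
proof -
  have "conj_transpose k ** k = mat 1" using assms by (simp add: U2_def)
  then have e: "cnj (k $ 1 $ i) * k $ 1 $ j + cnj (k $ 2 $ i) * k $ 2 $ j = (if i = j then 1 else 0)" for i j
    by (simp add: vec_eq_iff matrix_matrix_mult_def conj_transpose_def sum_2 mat_def)
  have "herm (k *v w) (k *v z) =
     w $ 1 * cnj (z $ 1) * (cnj (k $ 1 $ 1) * k $ 1 $ 1 + cnj (k $ 2 $ 1) * k $ 2 $ 1)
   + w $ 2 * cnj (z $ 1) * (cnj (k $ 1 $ 1) * k $ 1 $ 2 + cnj (k $ 2 $ 1) * k $ 2 $ 2)
   + w $ 1 * cnj (z $ 2) * (cnj (k $ 1 $ 2) * k $ 1 $ 1 + cnj (k $ 2 $ 2) * k $ 2 $ 1)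
   + w $ 2 * cnj (z $ 2) * (cnj (k $ 1 $ 2) * k $ 1 $ 2 + cnj (k $ 2 $ 2) * k $ 2 $ 2)"
    by (simp add: herm_def matrix_vector_mult_def sum_2 algebra_simps)
  then show ?thesis unfolding e by (simp add: herm_def)
qed

lemma orthogonal_U2: assumes "k \<in> U2" shows "orthogonal_transformation (\<lambda>z. exp (\<i> * complex_of_real \<theta>) *s (k *v z))"
  unfolding orthogonal_transformation_def
proof (intro conjI allI)
  show "linear (\<lambda>z. exp (\<i> * complex_of_real \<theta>) *s (k *v z))"
    by (auto intro!: linearI simp: vec_eq_iff matrix_vector_mult_def sum_2 forall_2 algebra_simps)
  have u: "exp (\<i> * complex_of_real \<theta>) * cnj (exp (\<i> * complex_of_real \<theta>)) = 1"
    by (simp add: exp_cnj flip: exp_add)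
  have s: "herm (c *s v) (c *s w) = (c * cnj c) * herm v w" for c v w
    by (simp add: herm_def algebra_simps)
  show "(exp (\<i> * complex_of_real \<theta>) *s (k *v v)) \<bullet> (exp (\<i> * complex_of_real \<theta>) *s (k *v w)) = v \<bullet> w" for v w
    unfolding inner_eq_herm s u U2_herm[OF assms] by simp
qed

lemma orthogonal_U2': "k \<in> U2 \<Longrightarrow> orthogonal_transformation (\<lambda>z. k *v z)"
  using orthogonal_U2[of k 0] by simp

lemma symb_equivariant:
  assumes "k \<in> U2"
  shows "symb n (k *v z) p (k *v w) = symb n z (\<lambda>w. p (k *v w)) w"
proof -
  have "k *v w + s *s (k *v z) = k *v (w + s *s z)" for s
    by (simp add: vec_eq_iff forall_2 matrix_vector_mult_def sum_2 algebra_simps)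
  then show ?thesis by (simp add: symb_def U2_herm[OF assms])
qed

lemma symb_pow_equivariant:
  assumes "k \<in> U2"
  shows "(symb n (k *v z) ^^ j) p (k *v w) = (symb n z ^^ j) (\<lambda>w. p (k *v w)) w"
proof (induction j arbitrary: w)
  case (Suc j)
  have "(symb n (k *v z) ^^ Suc j) p (k *v w) = symb n z (\<lambda>w. (symb n (k *v z) ^^ j) p (k *v w)) w"
    using symb_equivariant[OF assms] by simp
  also have "(\<lambda>w. (symb n (k *v z) ^^ j) p (k *v w)) = (symb n z ^^ j) (\<lambda>w. p (k *v w))"
    using Suc by blast
  finally show ?case by simp
qed simp

lemma U2_inverse: assumes "k \<in> U2"
  shows "matrix_inv k = conj_transpose k" "k *v (conj_transpose k *v z) = z" "conj_transpose k *v (k *v z) = z"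
proof -
  have *: "conj_transpose k ** k = mat 1" "k ** conj_transpose k = mat 1"
    using assms by (auto simp: U2_def)
  show "matrix_inv k = conj_transpose k" by (rule matrix_inv_eqI[OF *(2,1)])
  show "k *v (conj_transpose k *v z) = z" "conj_transpose k *v (k *v z) = z"
    by (simp_all only: matrix_vector_mul_assoc * matrix_vector_mul_lid)
qed

text \<open>On \<open>V n\<close> the inverse of \<open>tau k\<close> is composition with
  \<open>k\<close>. Evaluating at \<open>k *v w\<close> removes all inverses, and equivariance
  becomes a substitution rule that the Fourier transform respects.\<close>

lemma K_equivariantD:
  assumes F: "K_equivariant n F" and k: "k \<in> SU2" and p: "p \<in> V n"
  shows "F (exp (\<i> * complex_of_real \<theta>) *s (k *v z)) p (k *v w) = F z (\<lambda>w. p (k *v w)) w"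
proof -
  have kU: "k \<in> U2" using k by (simp add: SU2_def)
  have inj: "inj_on (tau k) (V n)"
  proof (rule inj_onI)
    fix p q assume "tau k p = tau k q"
    then have "p (conj_transpose k *v w) = q (conj_transpose k *v w)" for w
      unfolding tau_def U2_inverse(1)[OF kU] by (rule fun_cong)
    then have "p w = q w" for w using U2_inverse(3)[OF kU, of w] by metis
    then show "p = q" by blast
  qed
  have "inv_into (V n) (tau k) p = (\<lambda>w. p (k *v w))"
    by (rule inv_into_f_eq[OF inj V_compose[OF p]]) (simp add: tau_def U2_inverse[OF kU])
  then have "F (exp (\<i> * complex_of_real \<theta>) *s (k *v z)) p = tau k (F z (\<lambda>w. p (k *v w)))"
    using F k p unfolding K_equivariant_def by metis
  then show ?thesis by (simp add: tau_def U2_inverse[OF kU])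
qed

lemma fourier_op_equivariant:
  assumes F: "K_equivariant n F" "schwartz_V n F" and k: "k \<in> SU2" and p: "p \<in> V n"
  shows "fourier_op F (exp (\<i> * complex_of_real \<theta>) *s (k *v \<zeta>)) p (k *v w) = fourier_op F \<zeta> (\<lambda>w. p (k *v w)) w"
proof -
  have kU: "k \<in> U2" using k by (simp add: SU2_def)
  have "(\<lambda>z. F z p (k *v w)) \<in> borel_measurable borel"
    using F(2) p by (intro schwartz_borel_measurable) (simp add: schwartz_V_def)
  from fourier_orthogonal[OF orthogonal_U2[OF kU] this]
  show ?thesis unfolding fourier_op_def by (simp add: K_equivariantD[OF F(1) k p])
qed

section \<open>Diagonalisation over the axis\<close>

definition diag_mat :: "complex \<Rightarrow> complex^2^2" where
  "diag_mat c = vector [vector [c, 0], vector [0, cnj c]]"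

lemma diag_mat_SU2: "norm c = 1 \<Longrightarrow> diag_mat c \<in> SU2"
  using complex_norm_square[of c]
  by (simp add: SU2_def U2_def diag_mat_def conj_transpose_def det_2 vec_eq_iff forall_2
      matrix_matrix_mult_def sum_2 mat_def mult.commute)

lemma bimon_diag_mat:
  assumes "k \<le> n"
  shows "bimon n k (diag_mat (cis \<phi>) *v w) = cis ((2 * real k - real n) * \<phi>) * bimon n k w"
proof -
  have "cis \<phi> ^ k * cis (- \<phi>) ^ (n - k) = cis ((2 * real k - real n) * \<phi>)"
    using assms unfolding Complex.DeMoivre cis_mult
    by (intro arg_cong[where f=cis]) (simp add: of_nat_diff algebra_simps)
  moreover have "bimon n k (diag_mat (cis \<phi>) *v w) = (cis \<phi> ^ k * cis (- \<phi>) ^ (n - k)) * bimon n k w"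
    by (simp add: bimon_def diag_mat_def matrix_vector_mult_def sum_2 power_mult_distrib cis_cnj mult_ac)
  ultimately show ?thesis by (simp only:)
qed

lemma End_V_sum:
  assumes T: "T \<in> End_V n" and "finite I" "\<And>i. i \<in> I \<Longrightarrow> p i \<in> V n"
  shows "T (\<lambda>w. \<Sum>i\<in>I. a i * p i w) = (\<lambda>w. \<Sum>i\<in>I. a i * T (p i) w)"
proof -
  have lin: "T (\<lambda>w. x * u w + y * v w) = (\<lambda>w. x * T u w + y * T v w)" if "u \<in> V n" "v \<in> V n" for x y u v
    using T that unfolding End_V_def by blast
  show ?thesis using assms(2,3)
  proof (induction I rule: finite_induct)
    case empty
    show ?case using lin[OF V_zero V_zero, where x=0 and y=0] by simp
  next
    case (insert x I)
    have "(\<lambda>w. \<Sum>i\<in>I. a i * p i w) \<in> V n" by (rule V_sum, rule V_cmult) (use insert in auto)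
    from lin[OF _ this, where u="p x" and x="a x" and y=1] insert show ?case by simp
  qed
qed

lemma schwartz_End_V: "schwartz_End n F \<Longrightarrow> schwartz_V n F"
  by (simp add: schwartz_End_def schwartz_V_def End_V_def)

lemma fourier_op_linear:
  assumes F: "schwartz_End n F" and I: "finite I" "\<And>i. i \<in> I \<Longrightarrow> p i \<in> V n"
  shows "fourier_op F \<zeta> (\<lambda>w. \<Sum>i\<in>I. a i * p i w) = (\<lambda>w. \<Sum>i\<in>I. a i * fourier_op F \<zeta> (p i) w)"
proof
  fix w
  have s: "schwartz (\<lambda>z. F z (p i) w)" if "i \<in> I" for i
    using F I(2)[OF that] by (simp add: schwartz_End_def)
  have "F z (\<lambda>w. \<Sum>i\<in>I. a i * p i w) w = (\<Sum>i\<in>I. a i * F z (p i) w)" for z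
    using End_V_sum[OF _ I, where T="F z" and a=a] F by (simp add: schwartz_End_def)
  then show "fourier_op F \<zeta> (\<lambda>w. \<Sum>i\<in>I. a i * p i w) w = (\<Sum>i\<in>I. a i * fourier_op F \<zeta> (p i) w)"
    unfolding fourier_op_def by (simp only:) (subst fourier_sum, auto simp: fourier_cmult intro!: schwartz_cmult s)
qed

text \<open>A diagonal matrix in SU(2) moves (r, 0) by a phase, which the scalar phase in the
  definition of equivariance cancels. The operator at (r, 0) therefore commutes with the torus,
  whose characters 2 k - n on the monomials are distinct.\<close>

lemma fourier_op_diagonal:
  assumes F: "K_equivariant n F" "schwartz_End n F" and a: "a \<le> n"
  obtains h where "fourier_op F (axis 1 (of_real r)) (bimon n a) = (\<lambda>w. h * bimon n a w)"
proof -
  note FV = schwartz_End_V[OF F(2)]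
  let ?c = "\<lambda>b \<phi>. cis ((2 * real b - real n) * \<phi>)"
  let ?\<zeta> = "axis 1 (complex_of_real r) :: complex^2"
  define q where "q = fourier_op F ?\<zeta> (bimon n a)"
  have q: "q \<in> V n" unfolding q_def by (rule fourier_op_in_V[OF FV V_mono[OF a]])
  have inv: "coef n q b * ?c b \<phi> = ?c a \<phi> * coef n q b"
    if b: "b \<le> n" for b \<phi>
  proof -
    have fix1: "exp (\<i> * complex_of_real (- \<phi>)) *s (diag_mat (cis \<phi>) *v ?\<zeta>) = ?\<zeta>"
      by (simp add: vec_eq_iff forall_2 diag_mat_def matrix_vector_mult_def sum_2 axis_def cis_conv_exp flip: exp_add mult.assoc)
    have d: "diag_mat (cis \<phi>) \<in> SU2" by (rule diag_mat_SU2) simp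
    have "q (diag_mat (cis \<phi>) *v w) = ?c a \<phi> * q w" for w
    proof -
      have "q (diag_mat (cis \<phi>) *v w) = fourier_op F ?\<zeta> (\<lambda>w. bimon n a (diag_mat (cis \<phi>) *v w)) w"
        using fourier_op_equivariant[OF F(1) FV d V_mono[OF a], of "- \<phi>" ?\<zeta> w]
        unfolding fix1 q_def .
      also have "(\<lambda>w. bimon n a (diag_mat (cis \<phi>) *v w)) = (\<lambda>w. \<Sum>i\<in>{0::nat}. ?c a \<phi> * bimon n a w)"
        by (simp add: bimon_diag_mat[OF a])
      also have "fourier_op F ?\<zeta> \<dots> w = ?c a \<phi> * q w"
        unfolding q_def by (subst fourier_op_linear[OF F(2)]) (auto intro: V_mono a)
      finally show ?thesis .
    qed
    moreover have "q (diag_mat (cis \<phi>) *v w) = (\<Sum>b\<le>n. (coef n q b * ?c b \<phi>) * bimon n b w)" for w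
      unfolding V_coef_apply[OF q, of "diag_mat (cis \<phi>) *v w"]
      by (intro sum.cong refl) (simp only: bimon_diag_mat atMost_iff mult.assoc)
    moreover have "?c a \<phi> * q w = (\<Sum>b\<le>n. (?c a \<phi> * coef n q b) * bimon n b w)" for w
      by (subst V_coef_apply[OF q]) (simp only: sum_distrib_left mult.assoc)
    ultimately have "(\<lambda>w. \<Sum>b\<le>n. (coef n q b * ?c b \<phi>) * bimon n b w) =
      (\<lambda>w. \<Sum>b\<le>n. (?c a \<phi> * coef n q b) * bimon n b w)"
      by (simp only:)
    from arg_cong[OF this, of "\<lambda>p. coef n p b"] show ?thesis by (simp only: coef_sum_mono[OF b])
  qed
  have zero: "coef n q b = 0" if b: "b \<le> n" "b \<noteq> a" for b
  proof -
    \<comment> \<open>This angle makes the characters of \<open>a\<close> and \<open>b\<close>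
      differ by the factor -1.\<close>
    define \<phi> where "\<phi> = pi / (2 * (real a - real b))"
    have "(2 * real a - real n) * \<phi> = (2 * real b - real n) * \<phi> + pi"
      using b by (simp add: \<phi>_def field_simps)
    then have "?c a \<phi> = - ?c b \<phi>"
      by (simp add: cis_mult[symmetric])
    then have "2 * (coef n q b * ?c b \<phi>) = 0"
      using inv[OF b(1), of \<phi>] by simp
    then show ?thesis by simp
  qed
  have "q w = coef n q a * bimon n a w" for w
  proof -
    have "q w = (\<Sum>b\<le>n. if b = a then coef n q a * bimon n a w else 0)"
      unfolding V_coef_apply[OF q, of w] by (intro sum.cong refl) (auto simp: zero)
    then show ?thesis using a by simp
  qed
  then show thesis using that unfolding q_def by blast
qed

lemma symb_pow_axis:
  assumes "a \<le> n"
  shows "(symb n (axis 1 (of_real r)) ^^ j) (bimon n a) =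
    (\<lambda>w. (of_real (r\<^sup>2) * (of_nat (n - a) - of_nat a)) ^ j * bimon n a w)"
proof (induction j)
  case (Suc j)
  let ?\<zeta> = "axis 1 (complex_of_real r) :: complex^2"
  let ?l = "complex_of_real (r\<^sup>2) * (of_nat (n - a) - of_nat a)"
  have one: "symb n ?\<zeta> (bimon n a) = (\<lambda>w. ?l * bimon n a w)"
  proof
    fix w
    have "bimon n a = (\<lambda>w. \<Sum>k\<le>n. (if k = a then 1 else 0) * bimon n k w)"
      using assms by (simp add: if_distrib[of "\<lambda>c. c * _"] cong: if_cong)
    then have "symb n ?\<zeta> (bimon n a) w = symb n ?\<zeta> (\<lambda>w. \<Sum>k\<le>n. (if k = a then 1 else 0) * bimon n k w) w"
      by (rule arg_cong)
    also have "\<dots> = (\<Sum>k\<le>n. if k = a then ?l * bimon n a w else 0)"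
      unfolding symb_sum_bimonom
    proof (intro sum.cong refl)
      fix k assume "k \<in> {..n}"
      then have k: "k \<le> n" by simp
      show "(if k = a then 1 else 0) * (of_nat n * herm ?\<zeta> ?\<zeta> * bimon n k w
          - 2 * herm w ?\<zeta> * bimon_deriv n k w ?\<zeta>)
        = (if k = a then ?l * bimon n a w else 0)"
        unfolding symb_bimonom_general[OF k] by (simp add: axis_def power2_eq_square algebra_simps)
    qed
    finally show "symb n ?\<zeta> (bimon n a) w = ?l * bimon n a w" using assms by simp
  qed
  have "(symb n ?\<zeta> ^^ Suc j) (bimon n a) = symb n ?\<zeta> (\<lambda>w. \<Sum>i\<in>{0::nat}. ?l ^ j * bimon n a w)"
    using Suc by simp
  also have "\<dots> = (\<lambda>w. \<Sum>i\<in>{0::nat}. ?l ^ j * symb n ?\<zeta> (bimon n a) w)"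
    by (rule symb_linear) (auto intro: V_mono assms)
  finally show ?case unfolding one by (simp add: mult_ac)
qed simp

text \<open>Both operators are diagonal in the monomials, so the claim is interpolation at the n + 1
  eigenvalues r^2 (n - 2 a), which r > 0 keeps apart. Linearity extends it to all of
  \<open>V n\<close>.\<close>

lemma symb_polynomial_on_axis:
  assumes F: "K_equivariant n F" "schwartz_End n F" and r: "r > 0"
  shows "\<exists>\<gamma>. \<forall>p\<in>V n. \<forall>w. fourier_op F (axis 1 (of_real r)) p w =
    (\<Sum>j\<le>n. \<gamma> j * (symb n (axis 1 (of_real r)) ^^ j) p w)"
proof -
  let ?\<zeta> = "axis 1 (complex_of_real r) :: complex^2"
  have "\<forall>a. \<exists>h. a \<le> n \<longrightarrow> fourier_op F ?\<zeta> (bimon n a) = (\<lambda>w. h * bimon n a w)"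
  proof
    fix a
    show "\<exists>h. a \<le> n \<longrightarrow> fourier_op F ?\<zeta> (bimon n a) = (\<lambda>w. h * bimon n a w)"
      by (cases "a \<le> n") (use fourier_op_diagonal[OF F, where a=a and r=r] in \<open>blast, simp\<close>)
  qed
  then obtain h where h: "\<And>a. a \<le> n \<Longrightarrow> fourier_op F ?\<zeta> (bimon n a) = (\<lambda>w. h a * bimon n a w)"
    by metis
  let ?x = "\<lambda>a. complex_of_real (r\<^sup>2) * (of_nat (n - a) - of_nat a)"
  have inj: "inj_on ?x {..n}"
  proof (rule inj_onI)
    fix a b assume ab: "a \<in> {..n}" "b \<in> {..n}" "?x a = ?x b"
    then have "complex_of_nat (n - a) - of_nat a = of_nat (n - b) - of_nat b" using r by simp
    then have "complex_of_nat a * 2 = of_nat b * 2" using ab(1,2) by (simp add: of_nat_diff algebra_simps)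
    then show "a = b" by simp
  qed
  obtain \<gamma> where \<gamma>: "\<And>a. a \<le> n \<Longrightarrow> h a = (\<Sum>j\<le>n. \<gamma> j * ?x a ^ j)"
    using interpolation[OF inj, where y=h] by blast
  have "fourier_op F ?\<zeta> p w = (\<Sum>j\<le>n. \<gamma> j * (symb n ?\<zeta> ^^ j) p w)" if p: "p \<in> V n" for p w
  proof -
    have m: "i \<in> {..n} \<Longrightarrow> bimon n i \<in> V n" for i by (simp add: V_mono)
    have "fourier_op F ?\<zeta> p w = (\<Sum>a\<le>n. coef n p a * fourier_op F ?\<zeta> (bimon n a) w)"
      by (subst V_coef[OF p], subst fourier_op_linear[OF F(2) finite_atMost m]) auto
    also have "\<dots> = (\<Sum>a\<le>n. coef n p a * (\<Sum>j\<le>n. \<gamma> j * (symb n ?\<zeta> ^^ j) (bimon n a) w))"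
    proof (intro sum.cong refl arg_cong2[where f="(*)"])
      fix a assume "a \<in> {..n}"
      then have a: "a \<le> n" by simp
      show "fourier_op F ?\<zeta> (bimon n a) w = (\<Sum>j\<le>n. \<gamma> j * (symb n ?\<zeta> ^^ j) (bimon n a) w)"
        unfolding h[OF a] \<gamma>[OF a] symb_pow_axis[OF a] sum_distrib_right by (simp only: mult.assoc)
    qed
    also have "\<dots> = (\<Sum>j\<le>n. \<gamma> j * (\<Sum>a\<le>n. coef n p a * (symb n ?\<zeta> ^^ j) (bimon n a) w))"
      unfolding sum_distrib_left by (subst sum.swap) (intro sum.cong refl mult.left_commute)
    also have "\<dots> = (\<Sum>j\<le>n. \<gamma> j * (symb n ?\<zeta> ^^ j) p w)"
    proof (intro sum.cong refl arg_cong2[where f="(*)"])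
      fix j :: nat
      have "(symb n ?\<zeta> ^^ j) p w = (symb n ?\<zeta> ^^ j) (\<lambda>w. \<Sum>a\<le>n. coef n p a * bimon n a w) w"
        by (subst V_coef[OF p]) rule
      also have "\<dots> = (\<Sum>a\<le>n. coef n p a * (symb n ?\<zeta> ^^ j) (bimon n a) w)"
        by (rule fun_cong[OF symb_pow_linear[OF finite_atMost m]])
      finally show "(\<Sum>a\<le>n. coef n p a * (symb n ?\<zeta> ^^ j) (bimon n a) w) = (symb n ?\<zeta> ^^ j) p w" by simp
    qed
    finally show ?thesis .
  qed
  then show ?thesis by blast
qed

lemma SU2_transitive:
  fixes z :: "complex^2"
  assumes "z \<noteq> 0" obtains k where "k \<in> SU2" "k *v axis 1 (of_real (norm z)) = z"
proof -
  define r where "r = complex_of_real (norm z)"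
  \<comment> \<open>The first column is the normalised \<open>z\<close>; the second is its
    orthogonal completion with determinant 1.\<close>
  define k :: "complex^2^2" where
    "k = vector [vector [z $ 1 / r, - cnj (z $ 2) / r], vector [z $ 2 / r, cnj (z $ 1) / r]]"
  have r: "r \<noteq> 0" "cnj r = r" using assms by (auto simp: r_def)
  have rr: "z $ 1 * cnj (z $ 1) + z $ 2 * cnj (z $ 2) = r * r"
    using herm_self[of z] by (simp add: herm_def r_def power2_eq_square)
  then have rr': "z $ 1 * cnj (z $ 1) / (r * r) + z $ 2 * cnj (z $ 2) / (r * r) = 1"
    using r by (simp add: add_divide_distrib[symmetric])
  have "k \<in> SU2"
    using rr' r by (simp add: SU2_def U2_def k_def conj_transpose_def det_2 vec_eq_iff forall_2
      matrix_matrix_mult_def sum_2 mat_def mult.commute add.commute)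
  moreover have "k *v axis 1 (of_real (norm z)) = z"
    using r by (simp add: k_def vec_eq_iff forall_2 matrix_vector_mult_def sum_2 axis_def r_def[symmetric])
  ultimately show thesis by (rule that)
qed

text \<open>Both sides transform in the same way under SU(2), which acts transitively on spheres, so
  coefficients found at one point of a sphere serve the whole sphere. The choice is made radius by
  radius.\<close>

lemma symb_polynomial:
  assumes F: "K_equivariant n F" "schwartz_End n F"
  obtains \<gamma> where "\<And>z p w. z \<noteq> 0 \<Longrightarrow> p \<in> V n \<Longrightarrow>
    fourier_op F z p w = (\<Sum>j\<le>n. \<gamma> j ((norm z)\<^sup>2) * (symb n z ^^ j) p w)"
proof -
  define P where "P = (\<lambda>r \<gamma>. \<forall>p\<in>V n. \<forall>w. fourier_op F (axis 1 (of_real r)) p w =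
    (\<Sum>j\<le>n. \<gamma> j * (symb n (axis 1 (of_real r)) ^^ j) p w))"
  have ex: "\<forall>r. \<exists>\<gamma>. r > 0 \<longrightarrow> P r \<gamma>"
    using symb_polynomial_on_axis[OF F] unfolding P_def by simp
  from choice[OF ex] obtain g where "\<forall>r. r > 0 \<longrightarrow> P r (g r)" ..
  then have \<gamma>: "fourier_op F (axis 1 (of_real r)) p w =
    (\<Sum>j\<le>n. g r j * (symb n (axis 1 (of_real r)) ^^ j) p w)" if "r > 0" "p \<in> V n" for r p w
    using that unfolding P_def by simp
  have "fourier_op F z p w = (\<Sum>j\<le>n. g (sqrt ((norm z)\<^sup>2)) j * (symb n z ^^ j) p w)"
    if z: "z \<noteq> 0" and p: "p \<in> V n" for z p w
  proof -
    let ?\<zeta> = "axis 1 (complex_of_real (norm z)) :: complex^2"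
    obtain k where k: "k \<in> SU2" "k *v ?\<zeta> = z" using SU2_transitive[OF z] .
    have kU: "k \<in> U2" using k(1) by (simp add: SU2_def)
    define w' where "w' = conj_transpose k *v w"
    have w: "w = k *v w'" by (simp add: w'_def U2_inverse[OF kU])
    have "fourier_op F z p w = fourier_op F ?\<zeta> (\<lambda>w. p (k *v w)) w'"
      using fourier_op_equivariant[OF F(1) schwartz_End_V[OF F(2)] k(1) p, of 0 ?\<zeta> w']
      by (simp add: k(2) w[symmetric])
    also have "\<dots> = (\<Sum>j\<le>n. g (norm z) j * (symb n ?\<zeta> ^^ j) (\<lambda>w. p (k *v w)) w')"
      using z by (intro \<gamma> V_compose p) simp
    also have "\<dots> = (\<Sum>j\<le>n. g (norm z) j * (symb n z ^^ j) p w)"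
    proof (intro sum.cong refl arg_cong2[where f="(*)"])
      show "(symb n ?\<zeta> ^^ j) (\<lambda>w. p (k *v w)) w' = (symb n z ^^ j) p w" for j
        using symb_pow_equivariant[OF kU, where n=n and z="?\<zeta>" and j=j and p=p and w=w'] unfolding k(2) w[symmetric] by (rule sym)
    qed
    finally show ?thesis by simp
  qed
  then show thesis by (rule that[of "\<lambda>j s. g (sqrt s) j"])
qed

subsection \<open>The decomposition\<close>

lemma fourier_op_radial_coefficients:
  assumes F: "K_equivariant n F" "schwartz_End n F"
  obtains t where "\<And>j. j \<le> n \<Longrightarrow> tower (t j)"
    "\<And>z p w. z \<noteq> 0 \<Longrightarrow> p \<in> V n \<Longrightarrow>
      fourier_op F z p w = (\<Sum>j\<le>n. t j 0 ((norm z)\<^sup>2) * (symb n z ^^ j) p w)"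
proof -
  note FV = schwartz_End_V[OF F(2)]
  obtain \<gamma> where \<gamma>: "\<And>z p w. z \<noteq> 0 \<Longrightarrow> p \<in> V n \<Longrightarrow>
    fourier_op F z p w = (\<Sum>j\<le>n. \<gamma> j ((norm z)\<^sup>2) * (symb n z ^^ j) p w)"
    using symb_polynomial[OF F] by blast
  let ?m0 = "bimon n 0"
  have m0: "?m0 \<in> V n" by (simp add: V_mono)
  let ?c = "\<lambda>m z. fourier (\<lambda>x. coef n (F x ?m0) m) z"
  have c: "?c m z = (\<Sum>j\<le>n. \<gamma> j ((norm z)\<^sup>2) * tri n z j m)" if z: "z \<noteq> 0" and m: "m \<le> n" for m z
  proof -
    have "fourier_op F z ?m0 = (\<lambda>w. \<Sum>j\<le>n. \<gamma> j ((norm z)\<^sup>2) * (symb n z ^^ j) ?m0 w)"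
      using \<gamma>[OF z m0] by blast
    then have "coef n (fourier_op F z ?m0) m = (\<Sum>j\<le>n. \<gamma> j ((norm z)\<^sup>2) * coef n ((symb n z ^^ j) ?m0) m)"
      using coef_linear[of "{..n}" "\<lambda>j. (symb n z ^^ j) ?m0" n m "\<lambda>j. \<gamma> j ((norm z)\<^sup>2)"] m symb_pow_in_V[OF m0]
      by simp
    then show ?thesis
      unfolding fourier_op_expansion[OF FV m0] symb_pow_tri by (simp only: coef_sum_mono[OF m])
  qed
  have ex: "\<exists>h. tower h \<and> (\<forall>s>0. h 0 s = \<gamma> m s)" if "m \<le> n" for m
    using that
  proof (induction "n - m" arbitrary: m rule: less_induct)
    case less
    have "\<forall>j. \<exists>h. j \<in> {m<..n} \<longrightarrow> tower h \<and> (\<forall>s>0. h 0 s = \<gamma> j s)"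
    proof
      fix j
      show "\<exists>h. j \<in> {m<..n} \<longrightarrow> tower h \<and> (\<forall>s>0. h 0 s = \<gamma> j s)"
        using less.hyps[of j] less.prems by (cases "j \<in> {m<..n}") auto
    qed
    from choice[OF this] obtain h where
      h: "\<And>j. j \<in> {m<..n} \<Longrightarrow> tower (h j)" "\<And>j s. j \<in> {m<..n} \<Longrightarrow> s > 0 \<Longrightarrow> h j 0 s = \<gamma> j s"
      by blast
    \<comment> \<open>The terms subtracted use the smooth \<open>h j\<close> and not the
      \<open>\<gamma> j\<close>. This makes \<open>e\<close> Schwartz across the origin, while off
      the origin the two agree.\<close>
    define e where "e = (\<lambda>z. ?c m z - (\<Sum>j\<in>{m<..n}. tri n z j m * h j 0 ((norm z)\<^sup>2)))"
    have "schwartz e" unfolding e_def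
      by (rule schwartz_diff[OF schwartz_fourier[OF schwartz_coef[OF FV m0 less.prems]] schwartz_sum])
        (rule schwartz_tri[OF schwartz_radial[OF h(1)]])
    moreover have "e z = (\<Prod>i<m. - 2 * of_nat (n - i)) * (cnj (z $ 1) * z $ 2) ^ m * \<gamma> m ((norm z)\<^sup>2)"
      if z: "z \<noteq> 0" for z
    proof -
      have split: "{..n} = {..<m} \<union> ({m} \<union> {m<..n})" using less.prems by auto
      have "?c m z = (\<Sum>j\<in>{..<m}. \<gamma> j ((norm z)\<^sup>2) * tri n z j m)
          + (\<gamma> m ((norm z)\<^sup>2) * tri n z m m + (\<Sum>j\<in>{m<..n}. \<gamma> j ((norm z)\<^sup>2) * tri n z j m))"
        unfolding c[OF z less.prems] split
        by (subst sum.union_disjoint, simp, simp, force, subst sum.union_disjoint) auto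
      also have "(\<Sum>j\<in>{..<m}. \<gamma> j ((norm z)\<^sup>2) * tri n z j m) = 0"
        by (rule sum.neutral) (simp add: tri_upper)
      also have "(\<Sum>j\<in>{m<..n}. \<gamma> j ((norm z)\<^sup>2) * tri n z j m)
          = (\<Sum>j\<in>{m<..n}. tri n z j m * h j 0 ((norm z)\<^sup>2))"
        using z by (intro sum.cong refl) (simp add: h(2) mult.commute)
      finally show ?thesis unfolding e_def tri_diag by (simp add: mult.commute)
    qed
    ultimately obtain t where "tower t" "\<And>s. s > 0 \<Longrightarrow> t 0 s = \<gamma> m s"
      using tower_of_weighted[OF _ tri_diag_nonzero[OF less.prems]] by blast
    then show ?case by blast
  qed
  have "\<forall>j. \<exists>h. j \<le> n \<longrightarrow> tower h \<and> (\<forall>s>0. h 0 s = \<gamma> j s)" using ex by blast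
  from choice[OF this] obtain t where
    t: "\<And>j. j \<le> n \<Longrightarrow> tower (t j)" "\<And>j s. j \<le> n \<Longrightarrow> s > 0 \<Longrightarrow> t j 0 s = \<gamma> j s"
    by blast
  show thesis
  proof (rule that[OF t(1)])
    fix z :: "complex^2" and p w assume z: "z \<noteq> 0" and p: "p \<in> V n"
    show "fourier_op F z p w = (\<Sum>j\<le>n. t j 0 ((norm z)\<^sup>2) * (symb n z ^^ j) p w)"
      unfolding \<gamma>[OF z p] using z by (intro sum.cong refl) (simp add: t(2))
  qed
qed

lemma fourier_K_invariant:
  assumes "schwartz f" "K_invariant f" shows "K_invariant (fourier f)"
  unfolding K_invariant_def
proof (intro ballI allI)
  fix k z assume k: "k \<in> U2"
  have "fourier f (k *v z) = fourier (\<lambda>x. f (k *v x)) z"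
    by (rule fourier_orthogonal[OF orthogonal_U2'[OF k] schwartz_borel_measurable[OF assms(1)]])
  also have "(\<lambda>x. f (k *v x)) = f" using assms(2) k by (simp add: K_invariant_def)
  finally show "fourier f (k *v z) = fourier f z" .
qed

lemma fourier_inject:
  fixes f g :: "'a::euclidean_space \<Rightarrow> complex"
  assumes "schwartz f" "schwartz g" "fourier f = fourier g" shows "f = g"
proof -
  obtain c where c: "c \<noteq> 0" "\<And>(f::'a \<Rightarrow> complex) x. schwartz f \<Longrightarrow> fourier (fourier f) (- x) = c * f x"
    using fourier_fourier[OF schwartz_gauss] by blast
  have "c * f x = c * g x" for x by (simp only: c(2)[OF assms(1), symmetric] c(2)[OF assms(2), symmetric] assms(3))
  then show ?thesis using c(1) by auto
qed

text \<open>For an even function the double transform is just multiplication by a nonzero constant,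
  so the preimage is again a transform, and invariance comes for free.\<close>

lemma radial_fourier_preimage:
  assumes t: "tower t"
  obtains f :: "complex^2 \<Rightarrow> complex" where "schwartz f" "K_invariant f" "\<And>z. fourier f z = t 0 ((norm z)\<^sup>2)"
proof -
  define g :: "complex^2 \<Rightarrow> complex" where "g = (\<lambda>z. t 0 ((norm z)\<^sup>2))"
  have g: "schwartz g" unfolding g_def by (rule schwartz_radial[OF t])
  have "norm (k *v z) = norm z" if "k \<in> U2" for k z
    using orthogonal_transformation_norm[OF orthogonal_U2'[OF that]] .
  then have inv: "K_invariant g" by (simp add: K_invariant_def g_def)
  obtain c where c: "c \<noteq> 0" "\<And>(f::complex^2 \<Rightarrow> complex) x. schwartz f \<Longrightarrow> fourier (fourier f) (- x) = c * f x"
    using fourier_fourier[OF schwartz_gauss] by blast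
  define f where "f = (\<lambda>z. (1 / c) * fourier g z)"
  have "schwartz f" unfolding f_def by (rule schwartz_cmult[OF schwartz_fourier[OF g]])
  moreover have "K_invariant f"
    using fourier_K_invariant[OF g inv] by (simp add: K_invariant_def f_def)
  moreover have "fourier f z = t 0 ((norm z)\<^sup>2)" for z
    unfolding f_def fourier_cmult using c(2)[OF g, of "- z"] c(1) by (simp add: g_def)
  ultimately show thesis by (rule that)
qed

definition D_sum :: "nat \<Rightarrow> (nat \<Rightarrow> complex^2 \<Rightarrow> complex) \<Rightarrow> complex^2 \<Rightarrow> operator" where
  "D_sum n f z p w = (\<Sum>j\<le>n. (D_op ^^ j) (scalar_op (f j)) z p w)"

lemma D_sum_schwartz:
  assumes "\<And>j. j \<le> n \<Longrightarrow> schwartz (f j)" "p \<in> V n"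
  shows "schwartz (\<lambda>z. D_sum n f z p w)"
    and "fourier (\<lambda>z. D_sum n f z p w) \<zeta> = (\<Sum>j\<le>n. fourier (f j) \<zeta> * (symb n \<zeta> ^^ j) p w)"
proof -
  have s: "schwartz (\<lambda>z. (D_op ^^ j) (scalar_op (f j)) z p w)" if "j \<in> {..n}" for j
    using D_op_pow_scalar(1)[OF assms(1), of j n] that assms(2) by (simp add: schwartz_V_def)
  show "schwartz (\<lambda>z. D_sum n f z p w)" unfolding D_sum_def by (rule schwartz_sum[OF s])
  have "fourier (\<lambda>z. D_sum n f z p w) \<zeta> = (\<Sum>j\<le>n. fourier (\<lambda>z. (D_op ^^ j) (scalar_op (f j)) z p w) \<zeta>)"
    unfolding D_sum_def by (rule fourier_sum[OF s])
  also have "\<dots> = (\<Sum>j\<le>n. fourier (f j) \<zeta> * (symb n \<zeta> ^^ j) p w)"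
    using D_op_pow_scalar(2)[OF assms(1) assms(2)] unfolding fourier_op_def by (intro sum.cong refl) simp
  finally show "fourier (\<lambda>z. D_sum n f z p w) \<zeta> = (\<Sum>j\<le>n. fourier (f j) \<zeta> * (symb n \<zeta> ^^ j) p w)" .
qed

lemma decomposition_exists:
  assumes F: "K_equivariant n F" "schwartz_End n F"
  obtains f where "\<And>j. j \<le> n \<Longrightarrow> schwartz (f j) \<and> K_invariant (f j)"
    "\<And>z p. p \<in> V n \<Longrightarrow> F z p = D_sum n f z p"
proof -
  obtain t where t: "\<And>j. j \<le> n \<Longrightarrow> tower (t j)"
    "\<And>z p w. z \<noteq> 0 \<Longrightarrow> p \<in> V n \<Longrightarrow>
      fourier_op F z p w = (\<Sum>j\<le>n. t j 0 ((norm z)\<^sup>2) * (symb n z ^^ j) p w)"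
    using fourier_op_radial_coefficients[OF F] by blast
  have "\<forall>j. \<exists>f. j \<le> n \<longrightarrow> schwartz f \<and> K_invariant f \<and> (\<forall>z. fourier f z = t j 0 ((norm z)\<^sup>2))"
    using radial_fourier_preimage[OF t(1)] by metis
  from choice[OF this] obtain f where
    f: "\<And>j. j \<le> n \<Longrightarrow> schwartz (f j)" "\<And>j. j \<le> n \<Longrightarrow> K_invariant (f j)"
      "\<And>j z. j \<le> n \<Longrightarrow> fourier (f j) z = t j 0 ((norm z)\<^sup>2)"
    by blast
  have "F z p w = D_sum n f z p w" if p: "p \<in> V n" for z p w
  proof -
    have s: "schwartz (\<lambda>z. F z p w)" using F(2) p by (simp add: schwartz_End_def)
    have "fourier (\<lambda>z. F z p w) = fourier (\<lambda>z. D_sum n f z p w)"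
    \<comment> \<open>The expansion of the transform is known only for nonzero arguments.\<close>
    proof (rule continuous_eq_off_0)
      show "continuous_on UNIV (fourier (\<lambda>z. F z p w))" "continuous_on UNIV (fourier (\<lambda>z. D_sum n f z p w))"
        by (intro schwartz_continuous_on schwartz_fourier s D_sum_schwartz f p; assumption)+
      fix z :: "complex^2" assume z: "z \<noteq> 0"
      have "fourier (\<lambda>z. D_sum n f z p w) z = (\<Sum>j\<le>n. fourier (f j) z * (symb n z ^^ j) p w)"
        by (rule D_sum_schwartz(2)[OF f(1) p])
      then show "fourier (\<lambda>z. F z p w) z = fourier (\<lambda>z. D_sum n f z p w) z"
        using t(2)[OF z p, of w] by (simp add: fourier_op_def f(3))
    qed
    from fourier_inject[OF s D_sum_schwartz(1)[OF f(1) p] this] show ?thesis by (rule fun_cong)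
  qed
  then show thesis using f(1,2) by (intro that[of f]) blast+
qed

lemma K_invariant_axis:
  assumes "K_invariant f" "z \<noteq> 0" shows "f z = f (axis 1 (of_real (norm z)))"
proof -
  obtain k where "k \<in> SU2" "k *v axis 1 (of_real (norm z)) = z" using SU2_transitive[OF assms(2)] .
  then show ?thesis using assms(1) unfolding K_invariant_def SU2_def by (metis (no_types, lifting) mem_Collect_eq)
qed

text \<open>Applied to w_2^n on the diagonal ray, the difference of two representations gives a
  triangular system with nonzero diagonal, solved from the top index downwards. The ray meets every
  sphere, so invariance of the transforms does the rest.\<close>

lemma D_sum_inject:
  assumes f: "\<And>j. j \<le> n \<Longrightarrow> schwartz (f j)" "\<And>j. j \<le> n \<Longrightarrow> K_invariant (f j)"
    and g: "\<And>j. j \<le> n \<Longrightarrow> schwartz (g j)" "\<And>j. j \<le> n \<Longrightarrow> K_invariant (g j)"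
    and fg: "\<And>z p w. p \<in> V n \<Longrightarrow> D_sum n f z p w = D_sum n g z p w" and m: "m \<le> n"
  shows "f m = g m"
proof -
  have m0: "bimon n 0 \<in> V n" by (simp add: V_mono)
  let ?d = "\<lambda>j z. fourier (f j) z - fourier (g j) z"
  have eq: "(\<Sum>j\<le>n. ?d j z * tri n z j k) = 0" if k: "k \<le> n" for z k
  proof -
    have "(\<lambda>w. \<Sum>j\<le>n. ?d j z * (symb n z ^^ j) (bimon n 0) w) = (\<lambda>w. \<Sum>i\<le>n. 0 * bimon n i w)"
    proof
      fix w
      show "(\<Sum>j\<le>n. ?d j z * (symb n z ^^ j) (bimon n 0) w) = (\<Sum>i\<le>n. 0 * bimon n i w)"
        using D_sum_schwartz(2)[where f=f, OF f(1) m0, where w=w and \<zeta>=z]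
          D_sum_schwartz(2)[where f=g, OF g(1) m0, where w=w and \<zeta>=z]
        by (simp add: fg[OF m0] left_diff_distrib sum_subtractf)
    qed
    from arg_cong[OF this, of "\<lambda>p. coef n p k"]
    have "coef n (\<lambda>w. \<Sum>j\<le>n. ?d j z * (symb n z ^^ j) (bimon n 0) w) k = 0"
      by (simp only: coef_sum_mono[OF k])
    then show ?thesis
      using coef_linear[of "{..n}" "\<lambda>j. (symb n z ^^ j) (bimon n 0)" n k "\<lambda>j. ?d j z"]
        symb_pow_in_V[OF m0] k unfolding symb_pow_tri by (simp only: coef_sum_mono[OF k]) simp
  qed
  have diag: "?d m (r *\<^sub>R diag_dir) = 0" if r: "r \<noteq> 0" and m: "m \<le> n" for r m
    using m
  proof (induction "n - m" arbitrary: m rule: less_induct)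
    case less
    let ?z = "r *\<^sub>R diag_dir"
    have "?d j ?z * tri n ?z j m = (if j = m then ?d m ?z * tri n ?z m m else 0)" if "j \<in> {..n}" for j
    proof (cases j m rule: linorder_cases)
      case greater
      then show ?thesis using less.hyps[of j] that less.prems by simp
    qed (simp_all add: tri_upper)
    then have "(\<Sum>j\<le>n. ?d j ?z * tri n ?z j m) = (\<Sum>j\<le>n. if j = m then ?d m ?z * tri n ?z m m else 0)"
      by (intro sum.cong refl) blast
    then have "?d m ?z * tri n ?z m m = 0"
      using eq[OF less.prems, of ?z] less.prems by simp
    moreover have "tri n ?z m m \<noteq> 0"
    proof -
      have "?z $ 1 \<noteq> 0" "?z $ 2 \<noteq> 0"
        unfolding vector_scaleR_component diag_dir_def vector_2 using r by simp_all
      then show ?thesis unfolding tri_diag using tri_diag_nonzero[OF less.prems] by simp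
    qed
    ultimately show ?case by simp
  qed
  have "fourier (f m) = fourier (g m)"
  proof (rule continuous_eq_off_0)
    show "continuous_on UNIV (fourier (f m))" "continuous_on UNIV (fourier (g m))"
      by (intro schwartz_continuous_on schwartz_fourier f(1) g(1) m)+
    fix z :: "complex^2" assume z: "z \<noteq> 0"
    \<comment> \<open>This point of the ray lies on the sphere through \<open>z\<close>, where
      invariant functions are constant.\<close>
    have n: "norm z *\<^sub>R diag_dir \<noteq> 0" "norm (norm z *\<^sub>R diag_dir) = norm z" using z norm_diag_dir by auto
    have "fourier h z = fourier h (norm z *\<^sub>R diag_dir)" if "schwartz h" "K_invariant h" for h
      using K_invariant_axis[OF fourier_K_invariant[OF that]] z n by metis
    then show "fourier (f m) z = fourier (g m) z" using diag[OF _ m, of "norm z"] z f g m by simp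
  qed
  then show ?thesis by (rule fourier_inject[OF f(1)[OF m] g(1)[OF m]])
qed

theorem mainTheorem5:
  fixes n :: nat and F :: "complex^2 \<Rightarrow> operator"
  assumes "schwartz_End n F" and "K_equivariant n F"
  shows "\<exists>!f. f \<in> {..n} \<rightarrow>\<^sub>E {g. schwartz g \<and> K_invariant g} \<and>
              (\<forall>z. \<forall>p\<in>V n. F z p = (\<lambda>w. \<Sum>j\<le>n. (D_op ^^ j) (scalar_op (f j)) z p w))"
proof -
  have D: "(\<lambda>w. \<Sum>j\<le>n. (D_op ^^ j) (scalar_op (f j)) z p w) = D_sum n f z p" for f z p
    by (simp add: D_sum_def fun_eq_iff)
  obtain f where f: "\<And>j. j \<le> n \<Longrightarrow> schwartz (f j) \<and> K_invariant (f j)"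
    "\<And>z p. p \<in> V n \<Longrightarrow> F z p = D_sum n f z p"
    using decomposition_exists[OF assms(2,1)] by blast
  show ?thesis unfolding D
  proof (rule ex1I)
    \<comment> \<open>Uniqueness is claimed for families that are \<open>undefined\<close> beyond n;
      restricting does not affect the sum.\<close>
    have "D_sum n (restrict f {..n}) z p = D_sum n f z p" for z p
      unfolding D_sum_def fun_eq_iff by (intro allI sum.cong) auto
    then show "restrict f {..n} \<in> {..n} \<rightarrow>\<^sub>E {g. schwartz g \<and> K_invariant g} \<and>
        (\<forall>z. \<forall>p\<in>V n. F z p = D_sum n (restrict f {..n}) z p)"
      using f by (auto simp: PiE_iff)
  next
    fix g assume g: "g \<in> {..n} \<rightarrow>\<^sub>E {g. schwartz g \<and> K_invariant g} \<and> (\<forall>z. \<forall>p\<in>V n. F z p = D_sum n g z p)"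
    have gs: "schwartz (g j) \<and> K_invariant (g j)" if "j \<le> n" for j
      using g that by (auto simp: PiE_iff)
    have "g m = f m" if "m \<le> n" for m
      using gs f g by (intro D_sum_inject[OF _ _ _ _ _ that]) auto
    moreover have "g \<in> extensional {..n}" using g by (simp add: PiE_iff)
    ultimately show "g = restrict f {..n}" by (auto simp: fun_eq_iff extensional_def restrict_def)
  qed
qed

end
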